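(* Consider state-dependent material parameters $M(\varphi),\alpha(\varphi),\mathbb C(\varphi)$, a time step $\tau>0$ and time index $n\ge1$, and let $\varphi_h^{n-1}\in\mathcal V_h^{\mathrm{ch}}$, $\mathbf u_h^{n-1}\in\mathcal V_h^{\mathbf u}$, $\theta_h^{n-1}\in\mathcal V_h^{\mathrm f}$ be given. Then solving the discrete problem (D) find $\varphi_h^n,\mu_h^n\in\mathcal V_h^{\mathrm{ch}}$, $\mathbf u_h^n\in\mathcal V_h^{\mathbf u}$, $\theta_h^n,p_h^n\in\mathcal V_h^{\mathrm f}$ such that for all $\eta_h^\varphi,\eta_h^\mu\in\mathcal V_h^{\mathrm{ch}}$, $\boldsymbol\eta_h\in\mathcal V_h^{\mathbf u}$, $\eta_h^\theta,\eta_h^p\in\mathcal V_h^{\mathrm f}$ $$\begin{aligned} &(\varphi_h^n-\varphi_h^{n-1},\eta_h^\varphi)+\tau(m\nabla\mu_h^n,\nabla\eta_h^\varphi)-\tau(R,\eta_h^\varphi)=0,\\ &(\mu_h^n,\eta_h^\mu)-\gamma\Big(\ell(\nabla\varphi_h^n,\nabla\eta_h^\mu)+\tfrac1\ell(\Psi_c'(\varphi_h^n)-\Psi_e'(\varphi_h^{n-1}),\eta_h^\mu)\Big)-(\mathcal E_{\mathrm e,\varphi}^{\mathrm{si}},\eta_h^\mu)-(\mathcal E_{\mathrm f,\varphi}^{\mathrm{si}},\eta_h^\mu)=0,\\ &(\mathbb C(\varphi_h^{n-1})(\boldsymbol\varepsilon(\mathbf u_h^n)-\mathcal T(\varphi_h^n)),\boldsymbol\varepsilon(\boldsymbol\eta_h))-(\alpha(\varphi_h^n)M(\varphi_h^{n-1})(\theta_h^n-\alpha(\varphi_h^n)\nabla\cdot\mathbf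 u_h^n),\nabla\cdot\boldsymbol\eta_h)-(\mathbf f,\boldsymbol\eta_h)=0,\\ &(\theta_h^n-\theta_h^{n-1},\eta_h^\theta)+\tau(\kappa\nabla p_h^n,\nabla\eta_h^\theta)-\tau(S_{\mathrm f},\eta_h^\theta)=0,\\ &(p_h^n,\eta_h^p)-(M(\varphi_h^{n-1})(\theta_h^n-\alpha(\varphi_h^n)\nabla\cdot\mathbf u_h^n),\eta_h^p)=0, \end{aligned}$$ where $$\mathcal E_{\mathrm e,\varphi}^{\mathrm{si}}=-\mathcal T'(\varphi_h^n):\mathbb C(\varphi_h^{n-1})(\boldsymbol\varepsilon(\mathbf u_h^n)-\mathcal T(\varphi_h^n))+\tfrac12(\boldsymbol\varepsilon(\mathbf u_h^{n-1})-\mathcal T(\varphi_h^{n-1})):\mathbb C'(\varphi_h^{n-1})(\boldsymbol\varepsilon(\mathbf u_h^{n-1})-\mathcal T(\varphi_h^{n-1})),$$ $$\mathcal E_{\mathrm f,\varphi}^{\mathrm{si}}=\tfrac{M'(\varphi_h^{n-1})}2(\theta_h^{n-1}-\alpha(\varphi_h^{n-1})\nabla\cdot\mathbf u_h^{n-1})^2-\alpha'(\varphi_h^n)M(\varphi_h^{n-1})(\theta_h^n-\alpha(\varphi_h^n)\nabla\cdot\mathbf u_h^n)\nabla\cdot\mathbf u_h^n,$$ is equivalent to solving the minimization problem (M) $\displaystyle(\varphi_h^n,\mathbf u_h^n,\theta_h^n)=\operatorname*{arg\,min}_{\varphi_h\in\bar{\mathcal V}_h^{\mathrm{ch},n},\,\mathbf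 u_h\in\mathcal V_h^{\mathbf u},\,\theta_h\in\bar{\mathcal V}_h^{\mathrm f,n}}\tilde{\mathcal H}_\tau^n(\varphi_h,\mathbf u_h,\theta_h)$ with the potential $$\tilde{\mathcal H}_\tau^n(\varphi_h,\mathbf u_h,\theta_h)=\frac{\|\varphi_h-\varphi_h^{n-1}-\tau R\|^2_{\mathcal V_{h,m}^{\mathrm{ch},'}}}{2\tau}+\tilde{\mathcal E}_{\mathrm c}(\varphi_h,\boldsymbol\varepsilon(\mathbf u_h),\theta_h;\varphi_h^{n-1})+\frac{\|\theta_h-\theta_h^{n-1}-\tau S_{\mathrm f}\|^2_{\mathcal V_{h,\kappa}^{\mathrm f,'}}}{2\tau}+(\tilde{\mathcal E}_e,\varphi_h)-(\mathbf f,\mathbf u_h),$$ the convex energy $$\tilde{\mathcal E}_{\mathrm c}=\int_\Omega\frac{\gamma\ell}2|\nabla\varphi_h|^2+\frac12(\boldsymbol\varepsilon(\mathbf u_h)-\mathcal T(\varphi_h)):\mathbb C(\varphi_h^{n-1})(\boldsymbol\varepsilon(\mathbf u_h)-\mathcal T(\varphi_h))+\frac{M(\varphi_h^{n-1})}2(\theta_h-\alpha(\varphi_h)\nabla\cdot\mathbf u_h)^2\,dx+\frac\gamma\ell\int_\Omega\Psi_c(\varphi_h)\,dx,$$ and $$\tilde{\mathcal E}_e=-\frac\gamma\ell\Psi_e'(\varphi_h^{n-1})+\frac12(\boldsymbol\varepsilon(\mathbf u_h^{n-1})-\mathcal T(\varphi_h^{n-1})):\mathbb C'(\varphi_h^{n-1})(\boldsymbol\varepsilon(\mathbf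 u_h^{n-1})-\mathcal T(\varphi_h^{n-1}))+\frac{M'(\varphi_h^{n-1})}2(\theta_h^{n-1}-\alpha(\varphi_h^{n-1})\nabla\cdot\mathbf u_h^{n-1})^2;$$ that is, $(\varphi_h^n,\mathbf u_h^n,\theta_h^n)$ solves (M) if and only if there exist $\mu_h^n\in\mathcal V_h^{\mathrm{ch}}$, $p_h^n\in\mathcal V_h^{\mathrm f}$ such that $(\varphi_h^n,\mu_h^n,\mathbf u_h^n,\theta_h^n,p_h^n)$ solves (D).
   Context: Setting. $\Omega\subset\mathbb R^d$, $d\in\{2,3\}$, is a domain with Lipschitz continuous boundary; $(\cdot,\cdot)$ and $\|\cdot\|$ denote $L^2(\Omega)$ inner products and norms (scalar, vector or tensor valued); $\boldsymbol\varepsilon(\mathbf u)=\frac12(\nabla\mathbf u+\nabla\mathbf u^T)$. $\gamma,\ell>0$ are constants. $\mathcal V_h^{\mathrm{ch}}\subseteq H^1(\Omega)$, $\mathcal V_h^{\mathbf u}\subseteq (H_0^1(\Omega))^d$, $\mathcal V_h^{\mathrm f}\subseteq H^1(\Omega)$ are conforming finite element spaces with mesh diameter $h$. Assumptions. (A1) $\Psi:\mathbb R\to\mathbb R$, $\Psi\ge0$, $\Psi=\Psi_c-\Psi_e$ with $\Psi_c,\Psi_e$ convex and differentiable, and $\Psi_c'$ Lipschitz. (A2) $m,\kappa$ are positive constants; $M,\alpha:\mathbb R\to\mathbb R$ are Lipschitz continuous and differentiable with $0<c_M\le M(\varphi)\le C_M<\infty$ and $0<c_\alpha\le\alpha(\varphi)\le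 C_\alpha\le1$ for all $\varphi\in\mathbb R$. (A3) The fourth-order stiffness tensor $\mathbb C(\varphi)$ (with the usual symmetries of linear elasticity) is Lipschitz continuous and differentiable in $\varphi\in\mathbb R$ with $c_{\mathbb C}|\boldsymbol\varepsilon|^2\le\boldsymbol\varepsilon:\mathbb C(\varphi)\boldsymbol\varepsilon\le C_{\mathbb C}|\boldsymbol\varepsilon|^2$ for all $\varphi\in\mathbb R$, $\boldsymbol\varepsilon\in\mathbb R^{d\times d}_{\mathrm{sym}}$, $c_{\mathbb C},C_{\mathbb C}>0$. (A4) The eigenstrain $\mathcal T$ (symmetric-matrix-valued function of $\varphi$, applied pointwise) is Lipschitz continuous, differentiable, and satisfies $c_{\mathcal T}\|\varphi\|_{L^2(\Omega)}\le\|\mathcal T(\varphi)\|_{L^2(\Omega)^{d\times d}}\le C_{\mathcal T}\|\varphi\|_{L^2(\Omega)}$ for all $\varphi\in L^2(\Omega)$, with $c_{\mathcal T},C_{\mathcal T}>0$. (A5) $R,S_{\mathrm f}\in L^2(\Omega)$, $\mathbf f\in (L^2(\Omega))^d$, independent of time. Dual norms. For $(y,\mathrm z)\in\{(m,\mathrm{ch}),(\kappa,\mathrm f)\}$ let $\mathcal V_{h,0}^{\mathrm z}=\{\phi_h\in\mathcal V_h^{\mathrm z}:\int_\Omega\phi_h\,dx=0\}$ with norm $\|\phi_h\|_{h,y}=\|y^{1/2}\nabla\phi_h\|$, and let $\mathcal V_{h,y}^{\mathrm z,'}$ be the dual space of $(\mathcal V_{h,0}^{\mathrm z},\|\cdot\|_{h,y})$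 with dual norm $\|s\|_{\mathcal V_{h,y}^{\mathrm z,'}}=\sup\{\langle s,l_h\rangle/\|l_h\|_{h,y}: l_h\in\mathcal V_{h,0}^{\mathrm z},\|l_h\|_{h,y}\ne0\}$; $L^2$ functions are identified with functionals via the $L^2$ inner product. Affine spaces. $\bar{\mathcal V}_h^{\mathrm{ch},n}=\{\varphi_h\in\mathcal V_h^{\mathrm{ch}}:\int_\Omega\frac{\varphi_h-\varphi_h^{n-1}}\tau dx=\int_\Omega R\,dx\}$, $\bar{\mathcal V}_h^{\mathrm f,n}=\{\theta_h\in\mathcal V_h^{\mathrm f}:\int_\Omega\frac{\theta_h-\theta_h^{n-1}}\tau dx=\int_\Omega S_{\mathrm f}\,dx\}$.
   Formalization: Convexity of the energy E_c on the admissible set does not follow from (A1)-(A5) and is assumed explicitly for (D)=>(M), which can fail without it; (M)=>(D) is proved unconditionally. The scalar finite element spaces are taken to contain the constants. *)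

theory Defs
  imports "HOL-Analysis.Analysis"
begin

text \<open>
  Functions on the domain \<open>\<Omega>\<close> are represented by functions on the whole space whose values outside
  \<open>\<Omega>\<close> are irrelevant. The inner product \<open>\<bullet>\<close> is the product of reals, the dot product of
  vectors and the Frobenius product \<open>A : B\<close> of matrices, so \<open>L2_inner\<close> and \<open>L2_norm\<close> serve
  scalar, vector and tensor valued functions alike.
\<close>

definition L2 :: "(real^'d) set \<Rightarrow> (real^'d \<Rightarrow> 'b::euclidean_space) set" where
  "L2 \<Omega> = {f. f \<in> borel_measurable (lebesgue_on \<Omega>) \<and>
               integrable (lebesgue_on \<Omega>) (\<lambda>x. (norm (f x))\<^sup>2)}"

definition L2_inner :: "(real^'d) set \<Rightarrow> (real^'d \<Rightarrow> 'b::euclidean_space) \<Rightarrow> (real^'d \<Rightarrow> 'b) \<Rightarrow> real" where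
  "L2_inner \<Omega> f g = (LINT x|lebesgue_on \<Omega>. f x \<bullet> g x)"

definition L2_norm :: "(real^'d) set \<Rightarrow> (real^'d \<Rightarrow> 'b::euclidean_space) \<Rightarrow> real" where
  "L2_norm \<Omega> f = sqrt (L2_inner \<Omega> f f)"

text \<open>
  First order weak derivatives are tested with the functions in \<open>C\<^sup>1\<close> with compact support in \<open>\<Omega>\<close>,
  and \<open>H\<^sup>1\<^sub>0\<close> is the closure of these functions in \<open>H\<^sup>1\<close>, as in Gilbarg and Trudinger,
  sections 7.3 and 7.5; by mollification, smooth test functions give the same notions.
\<close>

definition test_function :: "(real^'d) set \<Rightarrow> (real^'d \<Rightarrow> real) \<Rightarrow> (real^'d \<Rightarrow> real^'d) \<Rightarrow> bool" where
  "test_function \<Omega> \<psi> d\<psi> \<longleftrightarrow>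
     (\<forall>x. GDERIV \<psi> x :> d\<psi> x) \<and> continuous_on UNIV d\<psi> \<and>
     (\<exists>K. compact K \<and> K \<subseteq> \<Omega> \<and> (\<forall>x. x \<notin> K \<longrightarrow> \<psi> x = 0))"

definition has_weak_grad :: "(real^'d) set \<Rightarrow> (real^'d \<Rightarrow> real) \<Rightarrow> (real^'d \<Rightarrow> real^'d) \<Rightarrow> bool" where
  "has_weak_grad \<Omega> v g \<longleftrightarrow> g \<in> L2 \<Omega> \<and>
     (\<forall>\<psi> d\<psi>. test_function \<Omega> \<psi> d\<psi> \<longrightarrow>
        (LINT x|lebesgue_on \<Omega>. v x *\<^sub>R d\<psi> x) = - (LINT x|lebesgue_on \<Omega>. \<psi> x *\<^sub>R g x))"

definition H1 :: "(real^'d) set \<Rightarrow> (real^'d \<Rightarrow> real) set" where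
  "H1 \<Omega> = {v. v \<in> L2 \<Omega> \<and> (\<exists>g. has_weak_grad \<Omega> v g)}"

text \<open>The weak gradient is unique up to null sets; \<open>grad\<close> picks a representative.\<close>

definition grad :: "(real^'d) set \<Rightarrow> (real^'d \<Rightarrow> real) \<Rightarrow> real^'d \<Rightarrow> real^'d" where
  "grad \<Omega> v = (SOME g. has_weak_grad \<Omega> v g)"

definition H10 :: "(real^'d) set \<Rightarrow> (real^'d \<Rightarrow> real) set" where
  "H10 \<Omega> = {v \<in> H1 \<Omega>. \<forall>\<epsilon>>0. \<exists>\<psi> d\<psi>. test_function \<Omega> \<psi> d\<psi> \<and>
      (L2_norm \<Omega> (\<lambda>x. v x - \<psi> x))\<^sup>2 + (L2_norm \<Omega> (\<lambda>x. grad \<Omega> v x - d\<psi> x))\<^sup>2 < \<epsilon>}"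

definition jacobian :: "(real^'d) set \<Rightarrow> (real^'d \<Rightarrow> real^'d) \<Rightarrow> real^'d \<Rightarrow> real^'d^'d" where
  "jacobian \<Omega> u x = (\<chi> i. grad \<Omega> (\<lambda>y. u y $ i) x)"

definition strain :: "(real^'d) set \<Rightarrow> (real^'d \<Rightarrow> real^'d) \<Rightarrow> real^'d \<Rightarrow> real^'d^'d" where
  "strain \<Omega> u x = (1/2) *\<^sub>R (jacobian \<Omega> u x + transpose (jacobian \<Omega> u x))"

definition divergence :: "(real^'d) set \<Rightarrow> (real^'d \<Rightarrow> real^'d) \<Rightarrow> real^'d \<Rightarrow> real" where
  "divergence \<Omega> u x = trace (jacobian \<Omega> u x)"

text \<open>
  Near each boundary point, in suitable Cartesian coordinates with last axis \<open>e\<close>, the domain is the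
  set above the graph of a Lipschitz function \<open>g\<close> on the hyperplane orthogonal to \<open>e\<close>.
\<close>

definition lipschitz_domain :: "(real^'d) set \<Rightarrow> bool" where
  "lipschitz_domain \<Omega> \<longleftrightarrow> open \<Omega> \<and> connected \<Omega> \<and> bounded \<Omega> \<and> \<Omega> \<noteq> {} \<and>
     (\<forall>x \<in> frontier \<Omega>. \<exists>r>0. \<exists>e g L. norm e = 1 \<and> L-lipschitz_on {z. z \<bullet> e = 0} g \<and>
        \<Omega> \<inter> ball x r = {y \<in> ball x r. g (y - (y \<bullet> e) *\<^sub>R e) < y \<bullet> e})"

definition is_mesh :: "(real^'d) set \<Rightarrow> real \<Rightarrow> (real^'d) set set \<Rightarrow> bool" where
  "is_mesh \<Omega> h \<T> \<longleftrightarrow> finite \<T> \<and> \<T> \<noteq> {} \<and> \<Union>\<T> = closure \<Omega> \<and>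
     (\<forall>K \<in> \<T>. compact K \<and> interior K \<noteq> {} \<and> negligible (frontier K)) \<and>
     (\<forall>K \<in> \<T>. \<forall>K' \<in> \<T>. K \<noteq> K' \<longrightarrow> interior K \<inter> interior K' = {}) \<and>
     h = Max (diameter ` \<T>)"

text \<open>
  Shape functions are only required to be \<open>C\<^sup>1\<close> up to the boundary of each element (the function
  \<open>p\<close> below), which covers polynomial as well as mapped (isoparametric) elements.
\<close>

definition piecewise_C1 :: "(real^'d) set set \<Rightarrow> (real^'d \<Rightarrow> real) \<Rightarrow> bool" where
  "piecewise_C1 \<T> v \<longleftrightarrow> (\<forall>K \<in> \<T>. \<exists>U p dp. open U \<and> K \<subseteq> U \<and>
     (\<forall>x \<in> U. GDERIV p x :> dp x) \<and> continuous_on U dp \<and> (\<forall>x \<in> interior K. v x = p x))"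

definition fin_dim_space :: "(real^'d) set \<Rightarrow> (real^'d \<Rightarrow> 'b::real_vector) set \<Rightarrow> bool" where
  "fin_dim_space \<Omega> V \<longleftrightarrow> V \<noteq> {} \<and>
     (\<forall>v \<in> V. \<forall>w \<in> V. \<forall>a b. (\<lambda>x. a *\<^sub>R v x + b *\<^sub>R w x) \<in> V) \<and>
     (\<exists>B \<subseteq> V. finite B \<and> (\<forall>v \<in> V. \<exists>c. \<forall>x \<in> \<Omega>. v x = (\<Sum>b\<in>B. c b *\<^sub>R b x)))"

text \<open>
  Without boundary conditions, finite element spaces contain the constants. This is what makes the
  balance laws testable with \<open>1\<close>.
\<close>

definition fe_space_H1 :: "(real^'d) set \<Rightarrow> (real^'d) set set \<Rightarrow> (real^'d \<Rightarrow> real) set \<Rightarrow> bool" where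
  "fe_space_H1 \<Omega> \<T> V \<longleftrightarrow> fin_dim_space \<Omega> V \<and> V \<subseteq> H1 \<Omega> \<and> (\<forall>v \<in> V. piecewise_C1 \<T> v) \<and>
     (\<exists>v \<in> V. \<forall>x \<in> \<Omega>. v x = 1)"

definition fe_space_H10_vec :: "(real^'d) set \<Rightarrow> (real^'d) set set \<Rightarrow> (real^'d \<Rightarrow> real^'d) set \<Rightarrow> bool" where
  "fe_space_H10_vec \<Omega> \<T> V \<longleftrightarrow> fin_dim_space \<Omega> V \<and>
     (\<forall>u \<in> V. \<forall>i. (\<lambda>x. u x $ i) \<in> H10 \<Omega> \<and> piecewise_C1 \<T> (\<lambda>x. u x $ i))"

definition mean_zero :: "(real^'d) set \<Rightarrow> (real^'d \<Rightarrow> real) set \<Rightarrow> (real^'d \<Rightarrow> real) set" where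
  "mean_zero \<Omega> V = {v \<in> V. (LINT x|lebesgue_on \<Omega>. v x) = 0}"

definition h_norm :: "(real^'d) set \<Rightarrow> real \<Rightarrow> (real^'d \<Rightarrow> real) \<Rightarrow> real" where
  "h_norm \<Omega> y v = L2_norm \<Omega> (\<lambda>x. sqrt y *\<^sub>R grad \<Omega> v x)"

text \<open>
  The element \<open>0\<close> is inserted only to make the supremum \<open>0\<close> if the space is trivial (\<open>Sup {}\<close> is
  unspecified on the reals); otherwise the set of quotients is symmetric and nothing changes.
\<close>

definition dual_norm :: "(real^'d) set \<Rightarrow> real \<Rightarrow> (real^'d \<Rightarrow> real) set \<Rightarrow> (real^'d \<Rightarrow> real) \<Rightarrow> real" where
  "dual_norm \<Omega> y V s =
     Sup (insert 0 {L2_inner \<Omega> s l / h_norm \<Omega> y l | l. l \<in> mean_zero \<Omega> V \<and> h_norm \<Omega> y l \<noteq> 0})"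

definition contract :: "real^'d^'d^'d^'d \<Rightarrow> real^'d^'d \<Rightarrow> real^'d^'d" where
  "contract \<C> A = (\<chi> i j. \<Sum>k\<in>UNIV. \<Sum>l\<in>UNIV. \<C> $ i $ j $ k $ l * A $ k $ l)"

definition elastic_symmetries :: "real^'d^'d^'d^'d \<Rightarrow> bool" where
  "elastic_symmetries \<C> \<longleftrightarrow> (\<forall>i j k l. \<C> $ i $ j $ k $ l = \<C> $ j $ i $ k $ l \<and>
     \<C> $ i $ j $ k $ l = \<C> $ i $ j $ l $ k \<and> \<C> $ i $ j $ k $ l = \<C> $ k $ l $ i $ j)"

record ('d::finite) chb_model =
  Omega :: "(real^'d) set"
  gam :: real
  ell :: real
  mob :: real                                    (* m *)
  kap :: real
  Psi_c :: "real \<Rightarrow> real"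
  Psi_e :: "real \<Rightarrow> real"
  Biot_M :: "real \<Rightarrow> real"                        (* M *)
  Biot_alpha :: "real \<Rightarrow> real"                    (* alpha *)
  stiff :: "real \<Rightarrow> real^'d^'d^'d^'d"             (* C *)
  eigen :: "real \<Rightarrow> real^'d^'d"                   (* T *)
  src_R :: "real^'d \<Rightarrow> real"
  src_S :: "real^'d \<Rightarrow> real"                      (* S_f *)
  load :: "real^'d \<Rightarrow> real^'d"                    (* f *)

text \<open>The fields \<open>phi0\<close>, \<open>u0\<close>, \<open>theta0\<close> hold the solution at the previous time index \<open>n - 1\<close>.\<close>

record ('d::finite) chb_step =
  tau :: real
  V_ch :: "(real^'d \<Rightarrow> real) set"
  V_u :: "(real^'d \<Rightarrow> real^'d) set"
  V_f :: "(real^'d \<Rightarrow> real) set"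
  phi0 :: "real^'d \<Rightarrow> real"
  u0 :: "real^'d \<Rightarrow> real^'d"
  theta0 :: "real^'d \<Rightarrow> real"

text \<open>
  The coefficients \<open>\<C>\<close> and \<open>M\<close> are evaluated at the previous phase field \<open>phi0\<close>, but the
  eigenstrain and \<open>\<alpha>\<close> at the current one.
\<close>

definition elastic_strain where
  "elastic_strain P \<phi> u x = strain (Omega P) u x - eigen P (\<phi> x)"

definition stress where
  "stress P S \<phi> u x = contract (stiff P (phi0 S x)) (elastic_strain P \<phi> u x)"

definition fluid_excess where
  "fluid_excess P \<phi> u \<theta> x = \<theta> x - Biot_alpha P (\<phi> x) * divergence (Omega P) u x"

definition pressure where
  "pressure P S \<phi> u \<theta> x = Biot_M P (phi0 S x) * fluid_excess P \<phi> u \<theta> x"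

definition old_elastic where
  "old_elastic P S x = (1/2) * (elastic_strain P (phi0 S) (u0 S) x \<bullet>
     contract (vector_derivative (stiff P) (at (phi0 S x))) (elastic_strain P (phi0 S) (u0 S) x))"

definition old_fluid where
  "old_fluid P S x =
     deriv (Biot_M P) (phi0 S x) / 2 * (fluid_excess P (phi0 S) (u0 S) (theta0 S) x)\<^sup>2"

definition E_e_si where
  "E_e_si P S \<phi> u x =
     - (vector_derivative (eigen P) (at (\<phi> x)) \<bullet> stress P S \<phi> u x) + old_elastic P S x"

definition E_f_si where
  "E_f_si P S \<phi> u \<theta> x =
     old_fluid P S x
     - deriv (Biot_alpha P) (\<phi> x) * pressure P S \<phi> u \<theta> x * divergence (Omega P) u x"

definition solves_discrete ::
  "('d::finite) chb_model \<Rightarrow> 'd chb_step \<Rightarrow> (real^'d \<Rightarrow> real) \<Rightarrow> (real^'d \<Rightarrow> real) \<Rightarrow>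
   (real^'d \<Rightarrow> real^'d) \<Rightarrow> (real^'d \<Rightarrow> real) \<Rightarrow> (real^'d \<Rightarrow> real) \<Rightarrow> bool" where
  "solves_discrete P S \<phi> \<mu> u \<theta> p \<longleftrightarrow>
    (let \<Omega> = Omega P in
     \<phi> \<in> V_ch S \<and> \<mu> \<in> V_ch S \<and> u \<in> V_u S \<and> \<theta> \<in> V_f S \<and> p \<in> V_f S \<and>
     (\<forall>\<eta> \<in> V_ch S.
        L2_inner \<Omega> (\<lambda>x. \<phi> x - phi0 S x) \<eta> + tau S * L2_inner \<Omega> (\<lambda>x. mob P *\<^sub>R grad \<Omega> \<mu> x) (grad \<Omega> \<eta>)
        - tau S * L2_inner \<Omega> (src_R P) \<eta> = 0) \<and>
     (\<forall>\<eta> \<in> V_ch S.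
        L2_inner \<Omega> \<mu> \<eta>
        - gam P * (ell P * L2_inner \<Omega> (grad \<Omega> \<phi>) (grad \<Omega> \<eta>)
            + 1 / ell P * L2_inner \<Omega> (\<lambda>x. deriv (Psi_c P) (\<phi> x) - deriv (Psi_e P) (phi0 S x)) \<eta>)
        - L2_inner \<Omega> (E_e_si P S \<phi> u) \<eta> - L2_inner \<Omega> (E_f_si P S \<phi> u \<theta>) \<eta> = 0) \<and>
     (\<forall>\<eta> \<in> V_u S.
        L2_inner \<Omega> (stress P S \<phi> u) (strain \<Omega> \<eta>)
        - L2_inner \<Omega> (\<lambda>x. Biot_alpha P (\<phi> x) * pressure P S \<phi> u \<theta> x) (divergence \<Omega> \<eta>)
        - L2_inner \<Omega> (load P) \<eta> = 0) \<and>
     (\<forall>\<eta> \<in> V_f S.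
        L2_inner \<Omega> (\<lambda>x. \<theta> x - theta0 S x) \<eta> + tau S * L2_inner \<Omega> (\<lambda>x. kap P *\<^sub>R grad \<Omega> p x) (grad \<Omega> \<eta>)
        - tau S * L2_inner \<Omega> (src_S P) \<eta> = 0) \<and>
     (\<forall>\<eta> \<in> V_f S. L2_inner \<Omega> p \<eta> - L2_inner \<Omega> (pressure P S \<phi> u \<theta>) \<eta> = 0))"

definition affine_space ::
  "(real^'d) set \<Rightarrow> real \<Rightarrow> (real^'d \<Rightarrow> real) set \<Rightarrow> (real^'d \<Rightarrow> real) \<Rightarrow> (real^'d \<Rightarrow> real) \<Rightarrow>
   (real^'d \<Rightarrow> real) set" where
  "affine_space \<Omega> \<tau> V v0 s = {v \<in> V.
     (LINT x|lebesgue_on \<Omega>. (v x - v0 x) / \<tau>) = (LINT x|lebesgue_on \<Omega>. s x)}"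

definition admissible ::
  "('d::finite) chb_model \<Rightarrow> 'd chb_step \<Rightarrow>
   ((real^'d \<Rightarrow> real) \<times> (real^'d \<Rightarrow> real^'d) \<times> (real^'d \<Rightarrow> real)) set" where
  "admissible P S =
     affine_space (Omega P) (tau S) (V_ch S) (phi0 S) (src_R P) \<times> V_u S \<times>
     affine_space (Omega P) (tau S) (V_f S) (theta0 S) (src_S P)"

definition energy_c where
  "energy_c P S \<phi> u \<theta> =
     (LINT x|lebesgue_on (Omega P).
        gam P * ell P / 2 * (norm (grad (Omega P) \<phi> x))\<^sup>2
        + (1/2) * (elastic_strain P \<phi> u x \<bullet> stress P S \<phi> u x)
        + Biot_M P (phi0 S x) / 2 * (fluid_excess P \<phi> u \<theta> x)\<^sup>2)
     + gam P / ell P * (LINT x|lebesgue_on (Omega P). Psi_c P (\<phi> x))"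

definition energy_e where
  "energy_e P S x =
     - (gam P / ell P) * deriv (Psi_e P) (phi0 S x) + old_elastic P S x + old_fluid P S x"

definition potential where
  "potential P S \<phi> u \<theta> =
     (dual_norm (Omega P) (mob P) (V_ch S) (\<lambda>x. \<phi> x - phi0 S x - tau S * src_R P x))\<^sup>2 / (2 * tau S)
     + energy_c P S \<phi> u \<theta>
     + (dual_norm (Omega P) (kap P) (V_f S) (\<lambda>x. \<theta> x - theta0 S x - tau S * src_S P x))\<^sup>2 / (2 * tau S)
     + L2_inner (Omega P) (energy_e P S) \<phi> - L2_inner (Omega P) (load P) u"

definition solves_min ::
  "('d::finite) chb_model \<Rightarrow> 'd chb_step \<Rightarrow> (real^'d \<Rightarrow> real) \<Rightarrow> (real^'d \<Rightarrow> real^'d) \<Rightarrow>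
   (real^'d \<Rightarrow> real) \<Rightarrow> bool" where
  "solves_min P S \<phi> u \<theta> \<longleftrightarrow>
     is_arg_min (\<lambda>(\<phi>, u, \<theta>). potential P S \<phi> u \<theta>) (\<lambda>z. z \<in> admissible P S) (\<phi>, u, \<theta>)"

text \<open>
  Convexity of \<open>energy_c\<close> on the admissible set; written out because function spaces are not
  an instance of \<open>real_vector\<close>, as \<open>convex_on\<close> would need.
\<close>

definition energy_c_convex :: "('d::finite) chb_model \<Rightarrow> 'd chb_step \<Rightarrow> bool" where
  "energy_c_convex P S \<longleftrightarrow>
     (\<forall>(\<phi>1, u1, \<theta>1) \<in> admissible P S. \<forall>(\<phi>2, u2, \<theta>2) \<in> admissible P S. \<forall>t \<in> {0..1}.
        energy_c P S (\<lambda>x. (1 - t) * \<phi>1 x + t * \<phi>2 x) (\<lambda>x. (1 - t) *\<^sub>R u1 x + t *\<^sub>R u2 x)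
                     (\<lambda>x. (1 - t) * \<theta>1 x + t * \<theta>2 x)
        \<le> (1 - t) * energy_c P S \<phi>1 u1 \<theta>1 + t * energy_c P S \<phi>2 u2 \<theta>2)"

end

theory Submission
  imports Defs
begin

text \<open>
  The dissipation term is a squared norm of a Riesz representative in the finite dimensional space of
  mean-free functions, so along lines in the admissible set it is an exact quadratic polynomial.
  Representatives exist because on the connected domain only constants have vanishing weak gradient;
  this in turn follows from the translation invariance of \<open>\<integral> v \<psi>\<close> and Fubini. Since finite element
  functions are bounded almost everywhere, \<open>energy_c\<close> can be differentiated under the integral sign with
  gradients merely in \<open>L\<^sup>2\<close>, and its first variation is the sum of the residuals of the discrete
  equations. The potentials \<open>\<mu>\<close> and \<open>p\<close> are, up to additive constants, the Riesz representatives divided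
  by \<open>- \<tau>\<close>: the constants are the Lagrange multipliers of the mean value constraints. Stationarity at
  a minimizer gives the discrete problem, and conversely a convex function lies above its tangent.
\<close>

section \<open>Test functions\<close>

text \<open>The passage from (D) to (M) is stated under \<open>energy_c_convex\<close> because
  \<open>energy_c\<close> is not convex in general: \<alpha> of the phase field multiplies the
  divergence, and the eigenstrain may be nonlinear. The mean value constraints say that the defects
  \<open>defect_ch\<close> and \<open>defect_f\<close> vanish on constants. This is the
  compatibility condition of a Neumann problem: the Riesz equation then holds against the whole
  space and not only against its mean-free part, which is what lets a representative be compared
  with \<mu> or \<open>p\<close>. Two features of the encoding shape the proof. The gradient is
  picked by Hilbert choice, so it is linear only up to null sets that depend on the functions, in
  particular on the parameter of a line; each quadratic energy is therefore rewritten with an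
  explicit curve before it is differentiated. And members of the spaces are functions on the whole
  space whose basis expansions hold only on the domain, so identities are transferred through
  differences that vanish there.\<close>

definition C1_function :: "(real^'d \<Rightarrow> real) \<Rightarrow> bool" where
  "C1_function \<psi> \<longleftrightarrow> (\<exists>d\<psi>. (\<forall>x. GDERIV \<psi> x :> d\<psi> x) \<and> continuous_on UNIV d\<psi>)"

lemma GDERIV_continuous_on:
  assumes "\<And>x. GDERIV f x :> df x"
  shows "continuous_on A f"
proof (rule has_derivative_continuous_on)
  show "(f has_derivative (\<lambda>h. h \<bullet> df x)) (at x within A)" for x
    using assms[of x] unfolding gderiv_def by (rule has_derivative_at_withinI)
qed

lemma C1_function_mult:
  assumes "C1_function f" "C1_function g"
  shows "C1_function (\<lambda>x. f x * g x)"
proof -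
  obtain df dg where
    df: "\<And>x. GDERIV f x :> df x" "continuous_on UNIV df" and
    dg: "\<And>x. GDERIV g x :> dg x" "continuous_on UNIV dg"
    using assms by (auto simp: C1_function_def)
  have "continuous_on UNIV f" "continuous_on UNIV g"
    using df dg by (auto intro: GDERIV_continuous_on)
  then have "continuous_on UNIV (\<lambda>x. f x *\<^sub>R dg x + g x *\<^sub>R df x)"
    using df dg by (intro continuous_intros)
  with GDERIV_mult[OF df(1) dg(1)] show ?thesis
    unfolding C1_function_def by (intro exI[of _ "\<lambda>x. f x *\<^sub>R dg x + g x *\<^sub>R df x"]) auto
qed

lemma C1_function_prod:
  assumes "finite I" "\<And>i. i \<in> I \<Longrightarrow> C1_function (f i)"
  shows "C1_function (\<lambda>x. \<Prod>i\<in>I. f i x)"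
  using assms
proof (induction I rule: finite_induct)
  case empty
  then show ?case
    by (auto simp: C1_function_def intro!: exI[of _ "\<lambda>x. 0"] GDERIV_const)
next
  case (insert i I)
  then show ?case by (simp add: C1_function_mult)
qed

lemma C1_function_compose_affine:
  fixes e :: "real^'d"
  assumes f: "\<And>s. (f has_real_derivative f' s) (at s)" and f': "continuous_on UNIV f'"
  shows "C1_function (\<lambda>x. f (e \<bullet> x + c))"
proof -
  have "GDERIV (\<lambda>x. e \<bullet> x + c) x :> e" for x
    unfolding gderiv_def
    by (rule has_derivative_eq_rhs, (rule derivative_intros)+) (auto simp: inner_commute)
  from GDERIV_DERIV_compose[OF this f]
  have "GDERIV (\<lambda>x. f (e \<bullet> x + c)) x :> f' (e \<bullet> x + c) *\<^sub>R e" for x .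
  moreover have "continuous_on UNIV (\<lambda>x. f' (e \<bullet> x + c) *\<^sub>R e)"
    by (intro continuous_intros continuous_on_compose2[OF f']) auto
  ultimately show ?thesis
    unfolding C1_function_def by (intro exI[of _ "\<lambda>x. f' (e \<bullet> x + c) *\<^sub>R e"]) auto
qed

section \<open>A C1 cutoff on the line and the approximation of boxes by test functions\<close>

definition sq_pos :: "real \<Rightarrow> real" where "sq_pos s = (max 0 s)\<^sup>2"

lemma DERIV_sq_pos: "(sq_pos has_real_derivative 2 * max 0 s) (at s)"
proof -
  consider "s > 0" | "s < 0" | "s = 0" by linarith
  then show ?thesis
  proof cases
    case 1
    have "((\<lambda>s. s\<^sup>2) has_real_derivative 2 * max 0 s) (at s)"
      using 1 by (auto intro!: derivative_eq_intros)
    then show ?thesis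
      by (rule has_field_derivative_transform_within_open[where S = "{0<..}"])
        (use 1 in \<open>auto simp: sq_pos_def\<close>)
  next
    case 2
    have "((\<lambda>s. 0) has_real_derivative 2 * max 0 s) (at s)"
      using 2 by (auto intro!: derivative_eq_intros)
    then show ?thesis
      by (rule has_field_derivative_transform_within_open[where S = "{..<0}"])
        (use 2 in \<open>auto simp: sq_pos_def\<close>)
  next
    case 3
    have "((\<lambda>h. sq_pos h / h) \<longlongrightarrow> 0) (at 0)"
    proof (rule Lim_null_comparison)
      show "\<forall>\<^sub>F h in at 0. norm (sq_pos h / h) \<le> \<bar>h\<bar>"
        by (rule always_eventually) (auto simp: sq_pos_def power2_eq_square max_def)
      show "((\<lambda>h::real. \<bar>h\<bar>) \<longlongrightarrow> 0) (at 0)"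
        by (auto intro!: tendsto_eq_intros)
    qed
    then show ?thesis using 3 by (simp add: DERIV_def sq_pos_def)
  qed
qed

text \<open>The truncated square is a simple C1 function that vanishes on a half-line, and dividing
  by \<open>1 + sq_pos s\<close> turns it into a cutoff. The value 1 is only approached at infinity,
  which suffices because only pointwise limits of scaled copies are used.\<close>

definition ramp :: "real \<Rightarrow> real" where "ramp s = sq_pos s / (1 + sq_pos s)"

lemma sq_pos_nonneg: "sq_pos s \<ge> 0"
  by (simp add: sq_pos_def)

lemma ramp_bounds: "0 \<le> ramp s" "ramp s \<le> 1"
  using sq_pos_nonneg[of s] by (auto simp: ramp_def divide_simps)

lemma ramp_eq_0: "s \<le> 0 \<Longrightarrow> ramp s = 0"
  by (simp add: ramp_def sq_pos_def max_absorb1)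

lemma DERIV_ramp:
  "(ramp has_real_derivative 2 * max 0 s / (1 + sq_pos s)\<^sup>2) (at s)"
proof -
  have "1 + sq_pos s \<noteq> 0" using sq_pos_nonneg[of s] by linarith
  then have "((\<lambda>s. sq_pos s / (1 + sq_pos s)) has_real_derivative
      (2 * max 0 s * (1 + sq_pos s) - sq_pos s * (0 + 2 * max 0 s)) / ((1 + sq_pos s) * (1 + sq_pos s))) (at s)"
    by (intro DERIV_divide DERIV_add DERIV_const DERIV_sq_pos)
  then show ?thesis by (simp add: ramp_def[abs_def] power2_eq_square algebra_simps)
qed

lemma continuous_on_ramp_deriv: "continuous_on UNIV (\<lambda>s. 2 * max 0 s / (1 + sq_pos s)\<^sup>2)"
proof -
  have "1 + sq_pos s \<noteq> 0" for s using sq_pos_nonneg[of s] by linarith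
  moreover have "continuous_on UNIV sq_pos"
    unfolding sq_pos_def by (intro continuous_intros)
  ultimately show ?thesis
    by (intro continuous_on_divide continuous_on_mult continuous_on_max continuous_on_power
        continuous_on_add continuous_on_const continuous_on_id) auto
qed

lemma ramp_tendsto_1:
  assumes "c > 0"
  shows "(\<lambda>n. ramp (c * real n - 1)) \<longlonglongrightarrow> 1"
proof -
  have "filterlim (\<lambda>n. c * real n - 1) at_top sequentially"
    using filterlim_tendsto_add_at_top[OF tendsto_const[of "-1"]
        filterlim_tendsto_pos_mult_at_top[OF tendsto_const assms filterlim_real_sequentially]]
    by simp
  moreover have "(ramp \<longlongrightarrow> 1) at_top"
  proof -
    have "filterlim (\<lambda>s::real. 1 + s\<^sup>2) at_infinity at_top"
      by (intro filterlim_at_top_imp_at_infinity filterlim_tendsto_add_at_top[OF tendsto_const]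
          filterlim_pow_at_top filterlim_ident) auto
    then have "((\<lambda>s::real. 1 - inverse (1 + s\<^sup>2)) \<longlongrightarrow> 1 - 0) at_top"
      by (intro tendsto_diff tendsto_const filterlim_compose[OF tendsto_inverse_0])
    moreover have "\<forall>\<^sub>F s in at_top. 1 - inverse (1 + s\<^sup>2) = ramp s"
      using eventually_ge_at_top[of 0]
    proof eventually_elim
      case (elim s)
      have "1 + s\<^sup>2 \<noteq> 0" by (smt (verit) zero_le_power2)
      then show ?case using elim by (simp add: ramp_def sq_pos_def field_simps)
    qed
    ultimately show ?thesis by (auto intro: Lim_transform_eventually)
  qed
  ultimately show ?thesis by (rule filterlim_compose[rotated])
qed

text \<open>Products over the coordinates suffice because boxes generate the Borel sets. The bounds
  0 and 1 supply the domination when identities tested with \<psi> are carried over to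
  boxes.\<close>

lemma box_test_functions:
  fixes a b :: "real^'d"
  obtains \<psi> :: "nat \<Rightarrow> real^'d \<Rightarrow> real" and d\<psi>
  where "\<And>n. test_function (box a b) (\<psi> n) (d\<psi> n)" "\<And>n x. 0 \<le> \<psi> n x" "\<And>n x. \<psi> n x \<le> 1"
    "\<And>x. (\<lambda>n. \<psi> n x) \<longlonglongrightarrow> indicat_real (box a b) x"
proof -
  define N where "N n = real (Suc n)" for n
  \<comment> \<open>The shift by 1 makes a factor vanish within distance \<open>1 / N n\<close> of a
    face, so the support is a compact box inside the open one. At an interior point all arguments
    tend to infinity.\<close>
  define \<psi> where "\<psi> n x = (\<Prod>i\<in>UNIV. ramp (N n * (x $ i - a $ i) - 1) * ramp (N n * (b $ i - x $ i) - 1))"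
    for n and x :: "real^'d"
  have "C1_function (\<psi> n)" for n
  proof -
    have "C1_function (\<lambda>x. ramp (N n * (x $ i - a $ i) - 1))" for i
      using C1_function_compose_affine[OF DERIV_ramp continuous_on_ramp_deriv,
          of "N n *\<^sub>R axis i 1" "- N n * a $ i - 1"]
      by (simp add: inner_axis' algebra_simps)
    moreover have "C1_function (\<lambda>x. ramp (N n * (b $ i - x $ i) - 1))" for i
      using C1_function_compose_affine[OF DERIV_ramp continuous_on_ramp_deriv,
          of "- N n *\<^sub>R axis i 1" "N n * b $ i - 1"]
      by (simp add: inner_axis' algebra_simps)
    ultimately show ?thesis
      unfolding \<psi>_def by (intro C1_function_prod C1_function_mult) auto
  qed
  then obtain d\<psi> where d\<psi>: "\<And>n. (\<forall>x. GDERIV (\<psi> n) x :> d\<psi> n x) \<and> continuous_on UNIV (d\<psi> n)"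
    unfolding C1_function_def by metis
  have supp: "\<exists>K. compact K \<and> K \<subseteq> box a b \<and> (\<forall>x. x \<notin> K \<longrightarrow> \<psi> n x = 0)" for n
  proof (intro exI conjI allI impI)
    let ?K = "cbox (\<chi> i. a $ i + 1 / N n) (\<chi> i. b $ i - 1 / N n)"
    have pos: "N n > 0" by (simp add: N_def)
    show "compact ?K" by (rule compact_cbox)
    show "?K \<subseteq> box a b"
    proof
      fix x assume "x \<in> ?K"
      then have "a $ i + 1 / N n \<le> x $ i \<and> x $ i \<le> b $ i - 1 / N n" for i
        by (auto simp: mem_box_cart)
      moreover have "1 / N n > 0" using pos by simp
      ultimately show "x \<in> box a b" unfolding mem_box_cart by (smt (verit))
    qed
    fix x assume "x \<notin> ?K"
    then obtain i where "x $ i < a $ i + 1 / N n \<or> x $ i > b $ i - 1 / N n"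
      by (auto simp: mem_box_cart not_le)
    then have "N n * (x $ i - a $ i) - 1 \<le> 0 \<or> N n * (b $ i - x $ i) - 1 \<le> 0"
      using pos by (auto simp: field_simps)
    then have "ramp (N n * (x $ i - a $ i) - 1) * ramp (N n * (b $ i - x $ i) - 1) = 0"
      using ramp_eq_0 by auto
    then show "\<psi> n x = 0"
      unfolding \<psi>_def by (meson UNIV_I finite prod_zero)
  qed
  have lim: "(\<lambda>n. \<psi> n x) \<longlonglongrightarrow> indicat_real (box a b) x" for x
  proof (cases "x \<in> box a b")
    case True
    then have *: "x $ i - a $ i > 0" "b $ i - x $ i > 0" for i
      by (auto simp: mem_box_cart)
    have "(\<lambda>n. ramp (N n * c - 1)) \<longlonglongrightarrow> 1" if "c > 0" for c
      using LIMSEQ_Suc[OF ramp_tendsto_1[OF that]] by (simp add: N_def mult.commute)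
    then have "(\<lambda>n. \<psi> n x) \<longlonglongrightarrow> (\<Prod>i\<in>(UNIV::'d set). 1 * 1)"
      unfolding \<psi>_def using * by (intro tendsto_intros) auto
    then show ?thesis using True by simp
  next
    case False
    then have "\<psi> n x = 0" for n using supp[of n] by blast
    then show ?thesis using False by simp
  qed
  show thesis
  proof (rule that)
    show "test_function (box a b) (\<psi> n) (d\<psi> n)" for n
      using d\<psi> supp by (simp add: test_function_def)
    show "0 \<le> \<psi> n x" for n x
      unfolding \<psi>_def by (intro prod_nonneg) (simp add: ramp_bounds)
    show "\<psi> n x \<le> 1" for n x
      unfolding \<psi>_def by (intro prod_le_1) (simp add: ramp_bounds mult_le_one)
  qed (rule lim)
qed

lemma test_function_mono: "test_function A \<psi> d\<psi> \<Longrightarrow> A \<subseteq> B \<Longrightarrow> test_function B \<psi> d\<psi>"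
  unfolding test_function_def by (meson subset_trans)

lemma test_function_continuous:
  assumes "test_function \<Omega> \<psi> d\<psi>"
  shows "continuous_on UNIV \<psi>" "continuous_on UNIV d\<psi>"
  using assms by (auto simp: test_function_def intro: GDERIV_continuous_on)

text \<open>\<open>test_function\<close> speaks of the support of \<psi> alone. The complement of K
  is open, so \<psi> is locally zero there and the gradient inherits the support.\<close>

lemma test_function_grad_eq_0:
  assumes \<psi>: "test_function \<Omega> \<psi> d\<psi>" and K: "compact K" "\<And>y. y \<notin> K \<Longrightarrow> \<psi> y = 0" and x: "x \<notin> K"
  shows "d\<psi> x = 0"
proof -
  have "open (- K)" using K(1) by (simp add: compact_imp_closed open_Compl)
  moreover have "(\<psi> has_derivative (\<lambda>h. h \<bullet> d\<psi> x)) (at x)"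
    using \<psi> by (simp add: test_function_def gderiv_def)
  ultimately have "((\<lambda>y. 0) has_derivative (\<lambda>h. h \<bullet> d\<psi> x)) (at x)"
    using K(2) x by (elim has_derivative_transform_within_open[where s = "- K"]) simp_all
  then have "(\<lambda>h. h \<bullet> d\<psi> x) = (\<lambda>h. 0)"
    by (rule has_derivative_unique[OF _ has_derivative_const])
  then have "d\<psi> x \<bullet> d\<psi> x = 0" by (rule fun_cong)
  then show ?thesis by simp
qed

lemma bounded_if_zero_outside_compact:
  fixes f :: "'a::metric_space \<Rightarrow> 'b::real_normed_vector"
  assumes "continuous_on UNIV f" "compact K" "\<And>x. x \<notin> K \<Longrightarrow> f x = 0"
  obtains B where "B \<ge> 0" "\<And>x. norm (f x) \<le> B"
proof -
  have "bounded (f ` K)"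
    using assms continuous_on_subset by (blast intro: compact_imp_bounded compact_continuous_image)
  then obtain B where "\<And>x. x \<in> K \<Longrightarrow> norm (f x) \<le> B"
    unfolding bounded_iff by blast
  then have "norm (f x) \<le> max B 0" for x
    using assms(3)[of x] by (cases "x \<in> K") (auto simp: max.coboundedI1)
  then show thesis using that[of "max B 0"] by auto
qed

lemma test_function_bounded:
  assumes "test_function \<Omega> \<psi> d\<psi>"
  obtains B where "B \<ge> 0" "\<And>x. norm (\<psi> x) \<le> B" "\<And>x. norm (d\<psi> x) \<le> B"
proof -
  obtain K where K: "compact K" "\<And>x. x \<notin> K \<Longrightarrow> \<psi> x = 0"
    using assms by (auto simp: test_function_def)
  obtain B1 where B1: "B1 \<ge> 0" "\<And>x. norm (\<psi> x) \<le> B1"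
    using bounded_if_zero_outside_compact[OF test_function_continuous(1)[OF assms] K] by blast
  obtain B2 where B2: "B2 \<ge> 0" "\<And>x. norm (d\<psi> x) \<le> B2"
    using bounded_if_zero_outside_compact[OF test_function_continuous(2)[OF assms] K(1)]
      test_function_grad_eq_0[OF assms K] by blast
  show thesis
    by (rule that[of "max B1 B2"]) (use B1 B2 in \<open>auto simp: max.coboundedI1 max.coboundedI2\<close>)
qed

section \<open>The fundamental lemma of the calculus of variations\<close>

lemma sigma_finite_completion:
  assumes "sigma_finite_measure M"
  shows "sigma_finite_measure (completion M)"
proof
  interpret sigma_finite_measure M by fact
  obtain A where A: "countable A" "A \<subseteq> sets M" "\<Union>A = space M"
    "\<And>a. a \<in> A \<Longrightarrow> emeasure M a \<noteq> \<infinity>"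
    using sigma_finite_countable by metis
  show "\<exists>A. countable A \<and> A \<subseteq> sets (completion M) \<and> \<Union>A = space (completion M) \<and>
      (\<forall>a\<in>A. emeasure (completion M) a \<noteq> \<infinity>)"
  proof (intro exI[of _ A] conjI ballI)
    show "A \<subseteq> sets (completion M)" using A(2) by blast
    fix a assume "a \<in> A"
    with A(2) have "emeasure (completion M) a = emeasure M a"
      by (simp add: subset_iff)
    then show "emeasure (completion M) a \<noteq> \<infinity>" using A(4) \<open>a \<in> A\<close> by simp
  qed (use A in simp_all)
qed

text \<open>Boxes form an intersection-stable generator, so a Dynkin argument carries the vanishing
  of the integral from boxes to all Borel sets; Lebesgue sets follow, and a function with zero
  integral over every measurable set is zero almost everywhere.\<close>

lemma AE_zero_if_box_integrals_zero:
  fixes f :: "'a::euclidean_space \<Rightarrow> 'b::euclidean_space"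
  assumes f: "integrable lebesgue f"
    and box: "\<And>a b. (LINT x|lebesgue. indicat_real (box a b) x *\<^sub>R f x) = 0"
  shows "AE x in lebesgue. f x = 0"
proof (rule sigma_finite_measure.density_zero[OF _ f])
  let ?P = "\<lambda>A. (LINT x|lebesgue. indicat_real A x *\<^sub>R f x) = 0"
  have fI: "integrable lebesgue (\<lambda>x. indicat_real A x *\<^sub>R f x)" if "A \<in> sets lebesgue" for A
    using that f by (rule integrable_mult_indicator)
  \<comment> \<open>Complements in the Dynkin class require the integral over the whole space,
    reached here as the limit over growing cubes.\<close>
  have UNIV: "(LINT x|lebesgue. f x) = 0"
  proof -
    let ?B = "\<lambda>n. box (- (real n *\<^sub>R One)) (real n *\<^sub>R One) :: 'a set"
    have "(\<lambda>n. LINT x|lebesgue. indicat_real (?B n) x *\<^sub>R f x) \<longlonglongrightarrow> (LINT x|lebesgue. f x)"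
    proof (rule integral_dominated_convergence)
      show "integrable lebesgue (\<lambda>x. norm (f x))" using f by simp
      show "AE x in lebesgue. (\<lambda>n. indicat_real (?B n) x *\<^sub>R f x) \<longlonglongrightarrow> f x"
      proof (rule AE_I2)
        fix x :: 'a
        have "x \<in> (\<Union>n. ?B n)" unfolding UN_box_eq_UNIV by simp
        then obtain n0 where n0: "x \<in> ?B n0" by blast
        have "\<forall>\<^sub>F n in sequentially. indicat_real (?B n) x *\<^sub>R f x = f x"
          using eventually_ge_at_top[of n0]
        proof eventually_elim
          case (elim n)
          have "real n0 \<le> real n" using elim by simp
          then have "x \<in> ?B n" using n0 by (force simp: mem_box)
          then show ?case by simp
        qed
        then show "(\<lambda>n. indicat_real (?B n) x *\<^sub>R f x) \<longlonglongrightarrow> f x"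
          by (rule tendsto_eventually)
      qed
    next
      show "(\<lambda>x. indicat_real (?B n) x *\<^sub>R f x) \<in> borel_measurable lebesgue" for n
        by (intro borel_measurable_integrable fI) simp
    qed (use f in \<open>auto simp: indicator_def\<close>)
    then have "(\<lambda>n. 0) \<longlonglongrightarrow> (LINT x|lebesgue. f x)" unfolding box .
    then show ?thesis using LIMSEQ_unique[OF _ tendsto_const] by metis
  qed
  have borel: "?P A" if "A \<in> sets borel" for A
  proof -
    let ?G = "range (\<lambda>(a, b). box a b :: 'a set)"
    have sig: "sets borel = sigma_sets UNIV ?G"
      by (subst borel_eq_box) (simp add: sets_measure_of)
    have stable: "Int_stable ?G"
    proof (rule Int_stableI)
      fix A B :: "'a set" assume "A \<in> ?G" "B \<in> ?G"
      then obtain a b c d where "A = box a b" "B = box c d" by auto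
      then have "A \<inter> B = (\<lambda>(a, b). box a b) (\<Sum>i\<in>Basis. max (a \<bullet> i) (c \<bullet> i) *\<^sub>R i,
          \<Sum>i\<in>Basis. min (b \<bullet> i) (d \<bullet> i) *\<^sub>R i)"
        by (simp only: box_Int_box prod.case)
      then show "A \<inter> B \<in> ?G" by blast
    qed
    show ?thesis
    proof (rule sigma_sets_induct_disjoint[OF stable, where P = ?P])
      show "A \<in> sigma_sets UNIV ?G" using that sig by simp
    next
      fix A assume "A \<in> ?G"
      then show "?P A" using box by force
    next
      fix A assume *: "A \<in> sigma_sets UNIV ?G" "?P A"
      then have "A \<in> sets lebesgue" by (simp flip: sig)
      then have "(LINT x|lebesgue. f x - indicat_real A x *\<^sub>R f x) = 0"
        using * f fI UNIV by simp
      moreover have "f x - indicat_real A x *\<^sub>R f x = indicat_real (UNIV - A) x *\<^sub>R f x" for x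
        by (auto simp: indicator_def)
      ultimately show "?P (UNIV - A)" by simp
    next
      fix A :: "nat \<Rightarrow> 'a set"
      assume *: "disjoint_family A" "range A \<subseteq> sigma_sets UNIV ?G" "\<And>i. ?P (A i)"
      then have A: "A i \<in> sets lebesgue" for i unfolding sig[symmetric] by auto
      then have UA: "(\<Union>i. A i) \<in> sets lebesgue" by blast
      have "(LINT x:(\<Union>i. A i)|lebesgue. f x) = (\<Sum>i. LINT x:A i|lebesgue. f x)"
        using * by (intro lebesgue_integral_countable_add A)
          (auto simp: disjoint_family_on_def set_integrable_def intro!: fI UA)
      then show "?P (\<Union>i. A i)" using * by (simp add: set_lebesgue_integral_def)
    qed auto
  qed
  show "sigma_finite_measure (lebesgue :: 'a measure)"
    by (rule sigma_finite_completion[OF sigma_finite_lborel])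
  fix A :: "'a set" assume A: "A \<in> sets lebesgue"
  \<comment> \<open>The part of A outside the Borel set B lies in a null set, so A and B give the
    same integral.\<close>
  obtain B N N' where B: "B \<in> sets lborel" "N' \<in> null_sets lborel" "N \<subseteq> N'" "A = B \<union> N"
    using A by (auto elim!: sets_completionE)
  have "AE x in lebesgue. x \<notin> N'" using B(2) by (simp add: AE_completion AE_not_in)
  then have "AE x in lebesgue. indicat_real A x *\<^sub>R f x = indicat_real B x *\<^sub>R f x"
    by eventually_elim (use B in \<open>auto simp: indicator_def\<close>)
  then have "(LINT x|lebesgue. indicat_real A x *\<^sub>R f x) = (LINT x|lebesgue. indicat_real B x *\<^sub>R f x)"
    using A B by (intro integral_cong_AE borel_measurable_integrable[OF fI]) auto
  then show "(LINT x:A|lebesgue. f x) = 0"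
    using borel[of B] B by (simp add: set_lebesgue_integral_def)
qed

text \<open>Each point has its own neighbourhood and its own exceptional null set; Lindelof leaves
  countably many of them, whose union is still null.\<close>

lemma AE_lebesgue_on_if_locally:
  fixes \<Omega> :: "'a::euclidean_space set"
  assumes "open \<Omega>"
    and loc: "\<And>x. x \<in> \<Omega> \<Longrightarrow> \<exists>U. open U \<and> x \<in> U \<and> (AE y in lebesgue. y \<in> U \<longrightarrow> P y)"
  shows "AE x in lebesgue_on \<Omega>. P x"
proof -
  define \<U> where "\<U> = {U. open U \<and> (AE y in lebesgue. y \<in> U \<longrightarrow> P y)}"
  obtain \<U>' where \<U>': "\<U>' \<subseteq> \<U>" "countable \<U>'" "\<Union>\<U>' = \<Union>\<U>"
    by (rule Lindelof[of \<U>]) (auto simp: \<U>_def)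
  have "AE y in lebesgue. \<forall>U\<in>\<U>'. y \<in> U \<longrightarrow> P y"
    by (subst AE_ball_countable[OF \<U>'(2)]) (use \<U>'(1) in \<open>auto simp: \<U>_def\<close>)
  then have "AE y in lebesgue. y \<in> \<Omega> \<longrightarrow> P y"
  proof eventually_elim
    case (elim y)
    show ?case
    proof
      assume "y \<in> \<Omega>"
      then have "y \<in> \<Union>\<U>" using loc[of y] unfolding \<U>_def by blast
      then show "P y" using elim \<U>'(3) by blast
    qed
  qed
  then show ?thesis
    using \<open>open \<Omega>\<close> by (simp add: AE_restrict_space_iff borel_open)
qed

text \<open>Dominated convergence replaces test functions by indicators of boxes inside \<Omega>.
  Truncated to one such box, g has zero integral over every box, hence vanishes there; this local
  statement is then globalised.\<close>

lemma fundamental_lemma: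
  fixes g :: "real^'d \<Rightarrow> 'b::euclidean_space"
  assumes "open \<Omega>" and g: "integrable (lebesgue_on \<Omega>) g"
    and zero: "\<And>\<psi> d\<psi>. test_function \<Omega> \<psi> d\<psi> \<Longrightarrow> (LINT x|lebesgue_on \<Omega>. \<psi> x *\<^sub>R g x) = 0"
  shows "AE x in lebesgue_on \<Omega>. g x = 0"
proof (rule AE_lebesgue_on_if_locally[OF \<open>open \<Omega>\<close>])
  have \<Omega>: "\<Omega> \<in> sets lebesgue" using \<open>open \<Omega>\<close> by (simp add: borel_open)
  have box0: "(LINT x|lebesgue_on \<Omega>. indicat_real (box a b) x *\<^sub>R g x) = 0" if ab: "box a b \<subseteq> \<Omega>" for a b
  proof -
    obtain \<psi> :: "nat \<Rightarrow> real^'d \<Rightarrow> real" and d\<psi>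
      where \<psi>: "\<And>n. test_function (box a b) (\<psi> n) (d\<psi> n)" "\<And>n x. 0 \<le> \<psi> n x" "\<And>n x. \<psi> n x \<le> 1"
        "\<And>x. (\<lambda>n. \<psi> n x) \<longlonglongrightarrow> indicat_real (box a b) x"
      using box_test_functions[of a b] by blast
    have meas: "\<psi> n \<in> borel_measurable (lebesgue_on \<Omega>)" for n
      by (intro continuous_imp_measurable_on_sets_lebesgue \<Omega>
          continuous_on_subset[OF test_function_continuous(1)[OF \<psi>(1)]]) simp
    have "(\<lambda>n. LINT x|lebesgue_on \<Omega>. \<psi> n x *\<^sub>R g x) \<longlonglongrightarrow>
        (LINT x|lebesgue_on \<Omega>. indicat_real (box a b) x *\<^sub>R g x)"
    proof (rule integral_dominated_convergence)
      show "(\<lambda>x. indicat_real (box a b) x *\<^sub>R g x) \<in> borel_measurable (lebesgue_on \<Omega>)"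
        using g by (intro borel_measurable_scaleR borel_measurable_indicator)
          (auto simp: sets_restrict_space_iff \<Omega> ab)
      show "(\<lambda>x. \<psi> n x *\<^sub>R g x) \<in> borel_measurable (lebesgue_on \<Omega>)" for n
        using g meas by (intro borel_measurable_scaleR) auto
      show "integrable (lebesgue_on \<Omega>) (\<lambda>x. norm (g x))" using g by simp
      show "AE x in lebesgue_on \<Omega>. (\<lambda>n. \<psi> n x *\<^sub>R g x) \<longlonglongrightarrow> indicat_real (box a b) x *\<^sub>R g x"
        by (intro AE_I2 tendsto_scaleR \<psi> tendsto_const)
      show "AE x in lebesgue_on \<Omega>. norm (\<psi> n x *\<^sub>R g x) \<le> norm (g x)" for n
        using \<psi>(2,3) by (intro AE_I2) (simp add: mult_left_le_one_le)
    qed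
    moreover have "(LINT x|lebesgue_on \<Omega>. \<psi> n x *\<^sub>R g x) = 0" for n
      by (rule zero[OF test_function_mono[OF \<psi>(1) ab]])
    ultimately show ?thesis by (simp add: LIMSEQ_const_iff)
  qed
  fix x0 assume "x0 \<in> \<Omega>"
  then obtain a b where ab: "x0 \<in> box a b" "box a b \<subseteq> \<Omega>"
    using \<open>open \<Omega>\<close> open_contains_box by metis
  \<comment> \<open>The box criterion is formulated on the whole space, so g is extended by
    zero.\<close>
  have gI: "integrable lebesgue (\<lambda>x. indicat_real \<Omega> x *\<^sub>R g x)"
    using g \<Omega> by (simp add: integrable_restrict_space)
  have ind: "indicat_real (box a b) x *\<^sub>R indicat_real \<Omega> x *\<^sub>R g x = indicat_real (box a b) x *\<^sub>R g x" for x
    using ab(2) by (auto simp: indicator_def)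
  have "AE x in lebesgue. indicat_real (box a b) x *\<^sub>R g x = 0"
  proof (rule AE_zero_if_box_integrals_zero)
    show "integrable lebesgue (\<lambda>x. indicat_real (box a b) x *\<^sub>R g x)"
      using integrable_mult_indicator[OF _ gI, of "box a b"] unfolding ind by simp
    fix c d :: "real^'d"
    \<comment> \<open>A box intersected with \<open>box a b\<close> is a box inside \<Omega>, to
      which \<open>box0\<close> applies.\<close>
    obtain p q where pq: "box c d \<inter> box a b = box p q"
      by (rule that[OF box_Int_box])
    have "(LINT x|lebesgue. indicat_real (box c d) x *\<^sub>R indicat_real (box a b) x *\<^sub>R g x)
        = (LINT x|lebesgue. indicat_real \<Omega> x *\<^sub>R indicat_real (box p q) x *\<^sub>R g x)"
      using ab(2) by (intro Bochner_Integration.integral_cong) (auto simp: indicator_def simp flip: pq)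
    also have "\<dots> = (LINT x|lebesgue_on \<Omega>. indicat_real (box p q) x *\<^sub>R g x)"
      using \<Omega> by (simp add: integral_restrict_space)
    also have "\<dots> = 0"
      using box0[of p q] pq ab(2) by blast
    finally show "(LINT x|lebesgue. indicat_real (box c d) x *\<^sub>R indicat_real (box a b) x *\<^sub>R g x) = 0" .
  qed
  then have "AE x in lebesgue. x \<in> box a b \<longrightarrow> g x = 0"
    by eventually_elim (auto simp: indicator_def)
  then show "\<exists>U. open U \<and> x0 \<in> U \<and> (AE x in lebesgue. x \<in> U \<longrightarrow> g x = 0)"
    using ab(1) open_box by blast
qed

section \<open>Differentiation under the integral sign\<close>

text \<open>Dominated convergence for the difference quotients along sequences. The hypotheses are
  tailored to the energies below: differentiability in t is asked at \<open>t0\<close> alone, and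
  the Lipschitz bound may fail on a null set that depends on t. Since sequences are countable, these
  null sets are harmless.\<close>

lemma has_real_derivative_integral:
  fixes F :: "real \<Rightarrow> 'a \<Rightarrow> real"
  assumes F: "\<And>t. integrable M (F t)" and D: "integrable M D"
    and F': "F' \<in> borel_measurable M"
    and deriv: "AE x in M. ((\<lambda>t. F t x) has_real_derivative F' x) (at t0)"
    and bound: "\<And>t. \<bar>t - t0\<bar> \<le> 1 \<Longrightarrow> AE x in M. \<bar>F t x - F t0 x\<bar> \<le> \<bar>t - t0\<bar> * D x"
  shows "integrable M F'" "((\<lambda>t. LINT x|M. F t x) has_real_derivative (LINT x|M. F' x)) (at t0)"
proof -
  let ?Q = "\<lambda>h x. (F (t0 + h) x - F t0 x) / h"
  have conv: "integrable M F' \<and> (\<lambda>n. LINT x|M. ?Q (X n) x) \<longlonglongrightarrow> (LINT x|M. F' x)"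
    if X: "\<And>n. X n \<noteq> 0" "X \<longlonglongrightarrow> 0" "\<And>n. \<bar>X n\<bar> \<le> 1" for X :: "nat \<Rightarrow> real"
  proof -
    have lim: "AE x in M. (\<lambda>n. ?Q (X n) x) \<longlonglongrightarrow> F' x"
      using deriv
    proof eventually_elim
      case (elim x)
      then have "((\<lambda>h. ?Q h x) \<longlongrightarrow> F' x) (at 0)" by (simp add: DERIV_def)
      then show ?case
        using X by (auto simp: tendsto_at_iff_sequentially o_def)
    qed
    have dom: "AE x in M. norm (?Q (X n) x) \<le> D x" for n
      using bound[of "t0 + X n"] X(3)[of n] X(1)[of n]
      by (auto simp: field_simps abs_divide)
    have meas: "(\<lambda>x. ?Q (X n) x) \<in> borel_measurable M" for n
      using F by auto
    show ?thesis
      using integrable_dominated_convergence[OF F' meas D lim dom]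
        integral_dominated_convergence[OF F' meas D lim dom] by blast
  qed
  show "integrable M F'"
    \<comment> \<open>Any nonzero null sequence bounded by 1 serves to extract integrability of the
      limit.\<close>
    using conv[of "\<lambda>n. inverse (real (Suc n))"] LIMSEQ_inverse_real_of_nat
    by (auto simp: field_simps)
  show "((\<lambda>t. LINT x|M. F t x) has_real_derivative (LINT x|M. F' x)) (at t0)"
    unfolding DERIV_def tendsto_at_iff_sequentially o_def
  proof (intro allI impI)
    fix X :: "nat \<Rightarrow> real" assume X: "\<forall>i. X i \<in> UNIV - {0}" "X \<longlonglongrightarrow> 0"
    \<comment> \<open>The domination holds for increments of size at most 1, so the first N terms of
      the sequence are dropped and restored by \<open>LIMSEQ_offset\<close>.\<close>
    then have "\<forall>\<^sub>F n in sequentially. dist (X n) 0 < 1"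
      by (metis tendstoD zero_less_one)
    then obtain N where N: "\<And>n. n \<ge> N \<Longrightarrow> dist (X n) 0 < 1"
      unfolding eventually_sequentially by blast
    have "(\<lambda>n. LINT x|M. ?Q (X (n + N)) x) \<longlonglongrightarrow> (LINT x|M. F' x)"
      using conv[of "\<lambda>n. X (n + N)"] X N LIMSEQ_ignore_initial_segment[OF X(2), of N]
      by (auto simp: less_imp_le)
    moreover have "(LINT x|M. ?Q h x) = ((LINT x|M. F (t0 + h) x) - (LINT x|M. F t0 x)) / h" for h
      using F by simp
    ultimately have "(\<lambda>n. ((LINT x|M. F (t0 + X (n + N)) x) - (LINT x|M. F t0 x)) / X (n + N))
        \<longlonglongrightarrow> (LINT x|M. F' x)" by (simp only:)
    then show "(\<lambda>n. ((LINT x|M. F (t0 + X n) x) - (LINT x|M. F t0 x)) / X n)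
        \<longlonglongrightarrow> (LINT x|M. F' x)"
      by (rule LIMSEQ_offset)
  qed
qed

section \<open>Functions with vanishing weak gradient\<close>

lemma test_function_translate:
  assumes \<psi>: "test_function A \<psi> d\<psi>" and sub: "\<And>x. x \<in> A \<Longrightarrow> x + y \<in> B"
  shows "test_function B (\<lambda>x. \<psi> (x - y)) (\<lambda>x. d\<psi> (x - y))"
proof -
  obtain K where K: "compact K" "K \<subseteq> A" "\<And>x. x \<notin> K \<Longrightarrow> \<psi> x = 0"
    using \<psi> by (auto simp: test_function_def)
  have der: "(\<psi> has_derivative (\<lambda>h. h \<bullet> d\<psi> x)) (at x)" for x
    using \<psi> by (simp add: test_function_def gderiv_def)
  have "((\<lambda>x. \<psi> (x - y)) has_derivative (\<lambda>h. h \<bullet> d\<psi> (x - y))) (at x)" for x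
  proof (rule has_derivative_compose[of "\<lambda>x. x - y" "\<lambda>h. h", OF _ der])
    show "((\<lambda>x. x - y) has_derivative (\<lambda>h. h)) (at x)"
      by (auto intro!: derivative_eq_intros)
  qed
  moreover have "continuous_on UNIV (\<lambda>x. d\<psi> (x - y))"
    by (rule continuous_on_compose2[OF test_function_continuous(2)[OF \<psi>]]) (auto intro!: continuous_intros)
  moreover have "compact ((\<lambda>x. x + y) ` K)"
    using K(1) by (intro compact_continuous_image continuous_intros)
  moreover have "(\<lambda>x. x + y) ` K \<subseteq> B" using K(2) sub by blast
  moreover have "\<psi> (x - y) = 0" if "x \<notin> (\<lambda>x. x + y) ` K" for x
    by (rule K(3)) (use that in force)
  ultimately show ?thesis
    unfolding test_function_def gderiv_def by blast
qed

lemma test_function_lipschitz: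
  fixes x y :: "real^'d"
  assumes \<psi>: "test_function \<Omega> \<psi> d\<psi>" and B: "\<And>x. norm (d\<psi> x) \<le> B"
  shows "\<bar>\<psi> x - \<psi> y\<bar> \<le> B * norm (x - y)"
proof -
  have "norm (\<psi> x - \<psi> y) \<le> B * norm (x - y)"
  proof (rule differentiable_bound[of UNIV])
    show "(\<psi> has_derivative (\<lambda>h. h \<bullet> d\<psi> x)) (at x within UNIV)" for x
      using \<psi> by (simp add: test_function_def gderiv_def)
    show "onorm (\<lambda>h. h \<bullet> d\<psi> x) \<le> B" for x
    proof (rule onorm_le)
      fix h :: "real^'d"
      have "norm (h \<bullet> d\<psi> x) \<le> norm h * norm (d\<psi> x)" by (simp add: Cauchy_Schwarz_ineq2)
      also have "\<dots> \<le> norm h * B" by (intro mult_left_mono B) simp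
      finally show "norm (h \<bullet> d\<psi> x) \<le> B * norm h" by (simp add: mult.commute)
    qed
  qed auto
  then show ?thesis by simp
qed

lemma integrable_mult_bounded_continuous:
  fixes f :: "'a::euclidean_space \<Rightarrow> real" and c :: "'a \<Rightarrow> 'b::euclidean_space"
  assumes f: "integrable lborel f" and c: "continuous_on UNIV c" and B: "\<And>x. norm (c x) \<le> B"
  shows "integrable lborel (\<lambda>x. f x *\<^sub>R c x)"
proof (rule Bochner_Integration.integrable_bound)
  show "integrable lborel (\<lambda>x. B * f x)" using f by simp
  have "c \<in> borel_measurable borel" by (rule borel_measurable_continuous_onI[OF c])
  then show "(\<lambda>x. f x *\<^sub>R c x) \<in> borel_measurable lborel"
    using f by (intro borel_measurable_scaleR) auto
  have "norm (f x *\<^sub>R c x) \<le> norm (B * f x)" for x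
    using B[of x] order_trans[OF norm_ge_zero B]
    by (simp add: abs_mult mult.commute[of "\<bar>f x\<bar>"] mult_right_mono)
  then show "AE x in lborel. norm (f x *\<^sub>R c x) \<le> norm (B * f x)" by simp
qed

text \<open>The t-derivative of the integral of f against \<psi> shifted by
  \<open>t *\<^sub>R w\<close> is an integral of f against the gradient of that shifted function. By
  \<open>sub\<close> the shifted function is a test function on \<Omega> for all t between 0 and 1,
  so the derivative is zero along the whole segment.\<close>

lemma translation_invariant_if_weak_grad_zero:
  fixes f :: "real^'d \<Rightarrow> real"
  assumes f: "integrable lborel f"
    and zero: "\<And>\<psi> d\<psi>. test_function \<Omega> \<psi> d\<psi> \<Longrightarrow> (LINT x|lborel. f x *\<^sub>R d\<psi> x) = 0"
    and \<psi>: "test_function A \<psi> d\<psi>"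
    and sub: "\<And>t x. 0 \<le> t \<Longrightarrow> t \<le> 1 \<Longrightarrow> x \<in> A \<Longrightarrow> x + t *\<^sub>R w \<in> \<Omega>"
  shows "(LINT x|lborel. f x * \<psi> (x - w)) = (LINT x|lborel. f x * \<psi> x)"
proof -
  obtain B where B: "B \<ge> 0" "\<And>x. norm (\<psi> x) \<le> B" "\<And>x. norm (d\<psi> x) \<le> B"
    using test_function_bounded[OF \<psi>] by blast
  note cont = test_function_continuous[OF \<psi>]
  have contt: "continuous_on UNIV (\<lambda>x. \<psi> (x - t *\<^sub>R w))" "continuous_on UNIV (\<lambda>x. d\<psi> (x - t *\<^sub>R w))" for t
    by (auto intro!: continuous_on_compose2[OF cont(1)] continuous_on_compose2[OF cont(2)] continuous_intros)
  have int1: "integrable lborel (\<lambda>x. f x * \<psi> (x - t *\<^sub>R w))" for t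
    using integrable_mult_bounded_continuous[OF f contt(1), of t B] B by simp
  have int2: "integrable lborel (\<lambda>x. f x *\<^sub>R d\<psi> (x - t *\<^sub>R w))" for t
    using integrable_mult_bounded_continuous[OF f contt(2), of t B] B by simp
  have der: "((\<lambda>t. LINT x|lborel. f x * \<psi> (x - t *\<^sub>R w)) has_real_derivative
      (LINT x|lborel. (f x *\<^sub>R d\<psi> (x - t0 *\<^sub>R w)) \<bullet> (- w))) (at t0)" for t0
  proof (rule has_real_derivative_integral(2)[OF int1])
    show "integrable lborel (\<lambda>x. B * norm w * \<bar>f x\<bar>)" using f by simp
    show "(\<lambda>x. f x *\<^sub>R d\<psi> (x - t0 *\<^sub>R w) \<bullet> - w) \<in> borel_measurable lborel"
      by (intro borel_measurable_inner borel_measurable_const borel_measurable_integrable[OF int2])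
    have "((\<lambda>t. f x * \<psi> (x - t *\<^sub>R w)) has_real_derivative f x *\<^sub>R d\<psi> (x - t0 *\<^sub>R w) \<bullet> - w) (at t0)" for x
    proof -
      have "(\<psi> has_derivative (\<lambda>h. h \<bullet> d\<psi> (x - t0 *\<^sub>R w))) (at (x - t0 *\<^sub>R w))"
        using \<psi> by (simp add: test_function_def gderiv_def)
      moreover have "((\<lambda>t. x - t *\<^sub>R w) has_derivative (\<lambda>t. - (t *\<^sub>R w))) (at t0)"
        by (auto intro!: derivative_eq_intros)
      ultimately have "((\<lambda>t. \<psi> (x - t *\<^sub>R w)) has_derivative (\<lambda>t. - (t *\<^sub>R w) \<bullet> d\<psi> (x - t0 *\<^sub>R w))) (at t0)"
        by (rule has_derivative_compose[rotated])
      then have "((\<lambda>t. \<psi> (x - t *\<^sub>R w)) has_real_derivative (- w \<bullet> d\<psi> (x - t0 *\<^sub>R w))) (at t0)"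
        unfolding has_field_derivative_def
        by (rule has_derivative_eq_rhs) (simp add: fun_eq_iff mult.commute)
      from DERIV_cmult[OF this, of "f x"] show ?thesis by (simp add: inner_commute)
    qed
    then show "AE x in lborel. ((\<lambda>t. f x * \<psi> (x - t *\<^sub>R w)) has_real_derivative
        f x *\<^sub>R d\<psi> (x - t0 *\<^sub>R w) \<bullet> - w) (at t0)" by simp
    fix t :: real
    have "\<bar>f x * \<psi> (x - t *\<^sub>R w) - f x * \<psi> (x - t0 *\<^sub>R w)\<bar> \<le> \<bar>t - t0\<bar> * (B * norm w * \<bar>f x\<bar>)" for x
    proof -
      have "\<bar>\<psi> (x - t *\<^sub>R w) - \<psi> (x - t0 *\<^sub>R w)\<bar> \<le> B * norm ((x - t *\<^sub>R w) - (x - t0 *\<^sub>R w))"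
        by (rule test_function_lipschitz[OF \<psi> B(3)])
      also have "(x - t *\<^sub>R w) - (x - t0 *\<^sub>R w) = (t0 - t) *\<^sub>R w" by (simp add: algebra_simps)
      finally have "\<bar>\<psi> (x - t *\<^sub>R w) - \<psi> (x - t0 *\<^sub>R w)\<bar> \<le> B * (\<bar>t - t0\<bar> * norm w)"
        by (simp add: abs_minus_commute)
      then have "\<bar>f x\<bar> * \<bar>\<psi> (x - t *\<^sub>R w) - \<psi> (x - t0 *\<^sub>R w)\<bar> \<le> \<bar>f x\<bar> * (B * (\<bar>t - t0\<bar> * norm w))"
        by (intro mult_left_mono) auto
      then show ?thesis by (simp add: abs_mult ac_simps flip: right_diff_distrib)
    qed
    then show "AE x in lborel. \<bar>f x * \<psi> (x - t *\<^sub>R w) - f x * \<psi> (x - t0 *\<^sub>R w)\<bar> \<le> \<bar>t - t0\<bar> * (B * norm w * \<bar>f x\<bar>)"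
      by simp
  qed
  have "((\<lambda>t. LINT x|lborel. f x * \<psi> (x - t *\<^sub>R w)) has_real_derivative 0) (at t0)"
    if "0 \<le> t0" "t0 \<le> 1" for t0
  proof -
    have "test_function \<Omega> (\<lambda>x. \<psi> (x - t0 *\<^sub>R w)) (\<lambda>x. d\<psi> (x - t0 *\<^sub>R w))"
      using sub that by (intro test_function_translate[OF \<psi>]) auto
    then have "(LINT x|lborel. f x *\<^sub>R d\<psi> (x - t0 *\<^sub>R w)) = 0" by (rule zero)
    moreover have "(LINT x|lborel. (f x *\<^sub>R d\<psi> (x - t0 *\<^sub>R w)) \<bullet> (- w))
        = (LINT x|lborel. f x *\<^sub>R d\<psi> (x - t0 *\<^sub>R w)) \<bullet> (- w)"
      by (rule integral_inner_left) (rule int2)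
    ultimately have "(LINT x|lborel. (f x *\<^sub>R d\<psi> (x - t0 *\<^sub>R w)) \<bullet> (- w)) = 0"
      by (simp only: inner_zero_left)
    then show ?thesis using der[of t0] by simp
  qed
  then have "(LINT x|lborel. f x * \<psi> (x - 1 *\<^sub>R w)) = (LINT x|lborel. f x * \<psi> (x - 0 *\<^sub>R w))"
    by (intro DERIV_isconst2[of 0 1] continuous_at_imp_continuous_on ballI DERIV_isCont) auto
  then show ?thesis by simp
qed

lemma lborel_integral_translate:
  fixes h :: "'a::euclidean_space \<Rightarrow> real"
  assumes [measurable]: "h \<in> borel_measurable borel"
  shows "(LINT x|lborel. h (x + y)) = (LINT x|lborel. h x)"
proof -
  have "(LINT x|lborel. h x) = (LINT x|distr lborel borel ((+) y). h x)"
    by (simp add: lborel_distr_plus)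
  also have "\<dots> = (LINT x|lborel. h (y + x))"
    by (rule integral_distr) measurable
  finally show ?thesis by (simp add: add.commute)
qed

lemma test_function_integrable:
  assumes \<psi>: "test_function \<Omega> \<psi> d\<psi>"
  shows "integrable lborel \<psi>"
proof -
  obtain K where K: "compact K" "\<And>x. x \<notin> K \<Longrightarrow> \<psi> x = 0"
    using \<psi> by (auto simp: test_function_def)
  have "integrable lborel (\<lambda>x. indicat_real K x *\<^sub>R \<psi> x)"
    using K(1) continuous_on_subset[OF test_function_continuous(1)[OF \<psi>]]
    by (intro borel_integrable_compact) auto
  moreover have "(\<lambda>x. indicat_real K x *\<^sub>R \<psi> x) = \<psi>"
    using K(2) by (auto simp: indicator_def fun_eq_iff)
  ultimately show ?thesis by (simp only:)
qed

lemma test_function_measurable: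
  assumes "test_function \<Omega> \<psi> d\<psi>"
  shows "\<psi> \<in> borel_measurable borel" "d\<psi> \<in> borel_measurable borel"
  using assms by (auto intro: borel_measurable_continuous_onI test_function_continuous)

text \<open>The integrals of the box cutoffs converge to the volume of the box, which is positive.
  The result serves as the kernel of a mollification.\<close>

lemma test_function_nonzero_integral:
  fixes a b :: "real^'d"
  assumes "box a b \<noteq> {}"
  obtains g dg where "test_function (box a b) g dg" "(LINT x|lborel. g x) \<noteq> 0"
proof -
  obtain \<psi> :: "nat \<Rightarrow> real^'d \<Rightarrow> real" and d\<psi>
    where \<psi>: "\<And>n. test_function (box a b) (\<psi> n) (d\<psi> n)" "\<And>n x. 0 \<le> \<psi> n x" "\<And>n x. \<psi> n x \<le> 1"
      "\<And>x. (\<lambda>n. \<psi> n x) \<longlonglongrightarrow> indicat_real (box a b) x"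
    using box_test_functions[of a b] by blast
  have "(\<lambda>n. LINT x|lborel. \<psi> n x) \<longlonglongrightarrow> (LINT x|lborel. indicat_real (box a b) x)"
  proof (rule integral_dominated_convergence)
    show "integrable lborel (indicat_real (box a b))"
      by (simp add: emeasure_lborel_box_eq)
    show "\<psi> n \<in> borel_measurable lborel" for n
      using test_function_measurable[OF \<psi>(1)] by simp
    show "AE x in lborel. (\<lambda>n. \<psi> n x) \<longlonglongrightarrow> indicat_real (box a b) x"
      by (intro AE_I2 \<psi>)
    have "\<psi> n x \<le> indicat_real (box a b) x" for n x
    proof (cases "x \<in> box a b")
      case False
      then have "\<psi> n x = 0" using \<psi>(1)[of n] unfolding test_function_def by blast
      then show ?thesis by simp
    qed (use \<psi>(3) in simp)
    then show "AE x in lborel. norm (\<psi> n x) \<le> indicat_real (box a b) x" for n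
      using \<psi>(2) by simp
  qed simp
  moreover have "(LINT x|lborel. indicat_real (box a b) x) > 0"
    using assms by (simp add: box_ne_empty measure_lborel_box_eq prod_pos inner_diff_left less_imp_le)
  ultimately have "\<forall>\<^sub>F n in sequentially. (LINT x|lborel. \<psi> n x) > 0"
    by (rule order_tendstoD(1))
  then obtain n where "(LINT x|lborel. \<psi> n x) > 0"
    by (auto simp: eventually_sequentially)
  then show thesis using that[OF \<psi>(1)] by force
qed

text \<open>A bridge between two measures: weak gradients are tested over
  \<open>lebesgue_on\<close>, while translations and Fubini are carried out over
  \<open>lborel\<close>.\<close>

lemma lebesgue_on_integral_eq_lborel:
  fixes h :: "'a::euclidean_space \<Rightarrow> 'b::euclidean_space"
  assumes "h \<in> borel_measurable borel" "A \<in> sets lebesgue" "\<And>x. x \<notin> A \<Longrightarrow> h x = 0"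
  shows "(LINT x|lebesgue_on A. h x) = (LINT x|lborel. h x)"
proof -
  have "(LINT x|lebesgue_on A. h x) = (LINT x|lebesgue. indicat_real A x *\<^sub>R h x)"
    using assms(2) by (simp add: integral_restrict_space)
  also have "\<dots> = (LINT x|lebesgue. h x)"
    using assms(3) by (intro Bochner_Integration.integral_cong) (auto simp: indicator_def)
  also have "\<dots> = (LINT x|lborel. h x)"
    using assms(1) by (simp add: integral_completion)
  finally show ?thesis .
qed

text \<open>
  Both integrals \<open>\<integral> f(x) g(x - z) dx\<close> and \<open>\<integral> f(x) \<xi>(x - y) dx\<close> are independent of the translation,
  so by Fubini \<open>(\<integral> f \<xi>) (\<integral> g) = c \<integral> \<xi>\<close> for all test functions \<open>\<xi>\<close> on the ball.
\<close>

lemma locally_constant_if_weak_grad_zero: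
  fixes f :: "real^'d \<Rightarrow> real"
  assumes f: "integrable lborel f"
    and zero: "\<And>\<psi> d\<psi>. test_function \<Omega> \<psi> d\<psi> \<Longrightarrow> (LINT x|lborel. f x *\<^sub>R d\<psi> x) = 0"
    and r: "r > 0" "ball x0 (2 * r) \<subseteq> \<Omega>"
  obtains c where "AE x in lebesgue_on (ball x0 r). f x = c"
proof -
  have f_meas [measurable]: "f \<in> borel_measurable borel"
    using borel_measurable_integrable[OF f] by simp
  obtain a b where ab: "(0::real^'d) \<in> box a b" "box a b \<subseteq> ball 0 r"
    using open_contains_box[of "ball 0 r"] r by (metis centre_in_ball open_ball)
  then obtain g dg where "test_function (box a b) g dg" and g0: "(LINT x|lborel. g x) \<noteq> 0"
    using test_function_nonzero_integral[of a b] by blast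
  then have g: "test_function (ball 0 r) g dg"
    using ab(2) test_function_mono by blast
  have [measurable]: "g \<in> borel_measurable borel" by (rule test_function_measurable[OF g])
  obtain Bg where Bg: "\<And>x. \<bar>g x\<bar> \<le> Bg" using test_function_bounded[OF g] by (metis real_norm_def)
  \<comment> \<open>Up to normalisation by the integral of g this is a mollification of f at z. The
    kernel g is supported in a ball of radius r, so for z in \<open>ball x0 r\<close> the integrand
    sees f only in the doubled ball.\<close>
  define V where "V z = (LINT y|lborel. f (z + y) * g y)" for z
  have V_eq: "V z = (LINT x|lborel. f x * g (x - z))" for z
    using lborel_integral_translate[of "\<lambda>x. f x * g (x - z)" z] by (simp add: V_def add.commute)
  have V_const: "V z = V x0" if "z \<in> ball x0 r" for z
  proof -
    have tg: "test_function (ball x0 r) (\<lambda>x. g (x - x0)) (\<lambda>x. dg (x - x0))"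
      by (rule test_function_translate[OF g]) (simp add: dist_norm norm_minus_commute)
    have "(LINT x|lborel. f x * g (x - (z - x0) - x0)) = (LINT x|lborel. f x * g (x - x0))"
    proof (rule translation_invariant_if_weak_grad_zero[OF f zero tg])
      fix t :: real and x :: "real^'d" assume *: "0 \<le> t" "t \<le> 1" "x \<in> ball x0 r"
      \<comment> \<open>A point of \<open>ball x0 r\<close> moved by less than r stays within
        \<open>ball x0 (2 * r)\<close>; this is the origin of the doubled radius.\<close>
      have "norm (x + t *\<^sub>R (z - x0) - x0) \<le> norm (x - x0) + t * norm (z - x0)"
        using norm_triangle_ineq[of "x - x0" "t *\<^sub>R (z - x0)"] * by (simp add: diff_add_eq)
      also have "\<dots> < r + 1 * r"
        using * that mult_mono[of t 1 "norm (z - x0)" r]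
        by (simp add: dist_norm norm_minus_commute)
      finally show "x + t *\<^sub>R (z - x0) \<in> \<Omega>"
        using r by (auto simp: dist_norm norm_minus_commute)
    qed
    then show ?thesis by (simp add: V_eq)
  qed
  have key: "(LINT x|lborel. f x * \<xi> x) * (LINT y|lborel. g y) = V x0 * (LINT z|lborel. \<xi> z)"
    if \<xi>: "test_function (ball x0 r) \<xi> d\<xi>" for \<xi> d\<xi>
  proof -
    have [measurable]: "\<xi> \<in> borel_measurable borel" by (rule test_function_measurable[OF \<xi>])
    have supp_\<xi>: "\<xi> z = 0" if "z \<notin> ball x0 r" for z
      using \<xi> that unfolding test_function_def by blast
    have supp_g: "g y = 0" if "y \<notin> ball 0 r" for y
      using g that unfolding test_function_def by blast
    \<comment> \<open>Integrated over y first, this gives \<open>\<xi> z * V z\<close>; integrated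
      over z first, it gives \<open>g y\<close> times the integral of f against \<xi>.\<close>
    let ?H = "\<lambda>z y. \<xi> z * f (z + y) * g y"
    have f_shift: "integrable lborel (\<lambda>y. f (z + y))" for z
    proof -
      have "integrable (distr lborel borel ((+) z)) f" using f by (simp add: lborel_distr_plus)
      then show ?thesis by (subst (asm) integrable_distr_eq) auto
    qed
    have norm_shift: "(LINT y|lborel. \<bar>f (z + y)\<bar>) = (LINT y|lborel. \<bar>f y\<bar>)" for z
      using lborel_integral_translate[of "\<lambda>y. \<bar>f y\<bar>" z] by (simp add: add.commute)
    have H_le: "\<bar>?H z y\<bar> \<le> \<bar>\<xi> z\<bar> * Bg * \<bar>f (z + y)\<bar>" for z y
    proof -
      have "\<bar>?H z y\<bar> = \<bar>\<xi> z\<bar> * \<bar>f (z + y)\<bar> * \<bar>g y\<bar>" by (simp add: abs_mult)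
      also have "\<dots> \<le> \<bar>\<xi> z\<bar> * \<bar>f (z + y)\<bar> * Bg" by (intro mult_left_mono Bg) simp
      finally show ?thesis by (simp add: ac_simps)
    qed
    have H_int: "integrable lborel (?H z)" for z
    proof (rule Bochner_Integration.integrable_bound)
      show "integrable lborel (\<lambda>y. \<xi> z * Bg * \<bar>f (z + y)\<bar>)" using f_shift by simp
      show "AE y in lborel. norm (?H z y) \<le> norm (\<xi> z * Bg * \<bar>f (z + y)\<bar>)"
        using H_le[of z] order_trans[OF abs_ge_zero Bg] by (simp add: abs_mult)
    qed simp
    have "integrable (lborel \<Otimes>\<^sub>M lborel) (\<lambda>(z, y). ?H z y)"
    proof (rule lborel_pair.Fubini_integrable)
      show "(\<lambda>(z, y). ?H z y) \<in> borel_measurable (lborel \<Otimes>\<^sub>M lborel)" by measurable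
      show "integrable lborel (\<lambda>z. LINT y|lborel. norm (case (z, y) of (z, y) \<Rightarrow> ?H z y))"
      proof (rule Bochner_Integration.integrable_bound)
        show "integrable lborel (\<lambda>z. \<xi> z * (Bg * (LINT y|lborel. \<bar>f y\<bar>)))"
          using test_function_integrable[OF \<xi>] by simp
        show "(\<lambda>z. LINT y|lborel. norm (case (z, y) of (z, y) \<Rightarrow> ?H z y)) \<in> borel_measurable lborel"
          by measurable
        have "(LINT y|lborel. \<bar>?H z y\<bar>) \<le> \<bar>\<xi> z\<bar> * (Bg * (LINT y|lborel. \<bar>f y\<bar>))" for z
        proof -
          have "(LINT y|lborel. \<bar>?H z y\<bar>) \<le> (LINT y|lborel. \<bar>\<xi> z\<bar> * Bg * \<bar>f (z + y)\<bar>)"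
            using H_int f_shift H_le by (intro integral_mono) auto
          then show ?thesis by (simp add: norm_shift)
        qed
        moreover have "0 \<le> (LINT y|lborel. \<bar>?H z y\<bar>)" for z by (rule integral_nonneg_AE) simp
        moreover have "\<bar>\<xi> z\<bar> * (Bg * (LINT y|lborel. \<bar>f y\<bar>)) = \<bar>\<xi> z * (Bg * (LINT y|lborel. \<bar>f y\<bar>))\<bar>" for z
          using order_trans[OF abs_ge_zero Bg] by (simp add: abs_mult)
        ultimately show "AE z in lborel. norm (LINT y|lborel. norm (case (z, y) of (z, y) \<Rightarrow> ?H z y))
            \<le> norm (\<xi> z * (Bg * (LINT y|lborel. \<bar>f y\<bar>)))"
          by simp
      qed
      show "AE z in lborel. integrable lborel (\<lambda>y. case (z, y) of (z, y) \<Rightarrow> ?H z y)"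
        using H_int by simp
    qed
    then have swap: "(LINT z|lborel. LINT y|lborel. ?H z y) = (LINT y|lborel. LINT z|lborel. ?H z y)"
      by (rule lborel_pair.Fubini_integral[symmetric])
    have "(LINT y|lborel. ?H z y) = \<xi> z * V x0" for z
    proof -
      have "(LINT y|lborel. ?H z y) = \<xi> z * V z" by (simp add: V_def mult.assoc)
      then show ?thesis using V_const supp_\<xi> by (cases "z \<in> ball x0 r") auto
    qed
    moreover have "(LINT z|lborel. ?H z y) = g y * (LINT x|lborel. f x * \<xi> x)" for y
    proof (cases "y \<in> ball 0 r")
      case True
      have "?H z y = g y * (f (z + y) * \<xi> (z + y - y))" for z
        by simp
      then have "(LINT z|lborel. ?H z y) = g y * (LINT z|lborel. f (z + y) * \<xi> (z + y - y))"
        by (simp only: integral_mult_right_zero)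
      also have "(LINT z|lborel. f (z + y) * \<xi> (z + y - y)) = (LINT x|lborel. f x * \<xi> (x - y))"
        by (rule lborel_integral_translate) measurable
      also have "\<dots> = (LINT x|lborel. f x * \<xi> x)"
      proof (rule translation_invariant_if_weak_grad_zero[OF f zero \<xi>])
        fix t :: real and x :: "real^'d" assume *: "0 \<le> t" "t \<le> 1" "x \<in> ball x0 r"
        have "norm (x + t *\<^sub>R y - x0) \<le> norm (x - x0) + t * norm y"
          using norm_triangle_ineq[of "x - x0" "t *\<^sub>R y"] * by (simp add: diff_add_eq)
        also have "\<dots> < r + 1 * r"
          using * True mult_mono[of t 1 "norm y" r] by (simp add: dist_norm norm_minus_commute)
        finally show "x + t *\<^sub>R y \<in> \<Omega>"
          using r by (auto simp: dist_norm norm_minus_commute)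
      qed
      finally show ?thesis .
    next
      case False
      then show ?thesis by (simp add: supp_g)
    qed
    ultimately have "(LINT z|lborel. \<xi> z * V x0) = (LINT y|lborel. g y * (LINT x|lborel. f x * \<xi> x))"
      using swap by (simp only:)
    then show ?thesis by (simp add: mult.commute)
  qed
  define G where "G = (LINT y|lborel. g y)"
  \<comment> \<open>By \<open>key\<close> the function \<open>f x * G - V x0\<close> is orthogonal
    to every test function on the ball. The nonzero factor G is divided out afterwards.\<close>
  have "AE x in lebesgue_on (ball x0 r). f x * G - V x0 = 0"
  proof (rule fundamental_lemma)
    have "integrable lebesgue f" using f by (simp add: integrable_completion)
    then have "integrable (lebesgue_on (ball x0 r)) f"
      using integrable_mult_indicator[of "ball x0 r" lebesgue f] by (simp add: integrable_restrict_space)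
    then show "integrable (lebesgue_on (ball x0 r)) (\<lambda>x. f x * G - V x0)"
      by (intro Bochner_Integration.integrable_diff integrable_mult_left finite_measure.integrable_const
          finite_measure_lebesgue_on) auto
    fix \<xi> d\<xi> assume \<xi>: "test_function (ball x0 r) \<xi> d\<xi>"
    have [measurable]: "\<xi> \<in> borel_measurable borel" by (rule test_function_measurable[OF \<xi>])
    obtain B where B: "\<And>x. \<bar>\<xi> x\<bar> \<le> B" using test_function_bounded[OF \<xi>] by (metis real_norm_def)
    have supp_\<xi>: "\<xi> z = 0" if "z \<notin> ball x0 r" for z
      using \<xi> that unfolding test_function_def by blast
    have "(LINT x|lebesgue_on (ball x0 r). \<xi> x *\<^sub>R (f x * G - V x0)) = (LINT x|lborel. \<xi> x *\<^sub>R (f x * G - V x0))"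
      by (rule lebesgue_on_integral_eq_lborel) (use supp_\<xi> in auto)
    also have "\<dots> = (LINT x|lborel. G * (f x * \<xi> x) - V x0 * \<xi> x)"
      by (simp add: algebra_simps)
    also have "\<dots> = G * (LINT x|lborel. f x * \<xi> x) - V x0 * (LINT x|lborel. \<xi> x)"
      using test_function_integrable[OF \<xi>]
        integrable_mult_bounded_continuous[OF f test_function_continuous(1)[OF \<xi>], of B] B
      by simp
    finally show "(LINT x|lebesgue_on (ball x0 r). \<xi> x *\<^sub>R (f x * G - V x0)) = 0"
      using key[OF \<xi>] by (simp add: G_def mult.commute)
  qed simp
  then have "AE x in lebesgue_on (ball x0 r). f x = V x0 / G"
    by eventually_elim (use g0 in \<open>simp add: G_def field_simps\<close>)
  then show thesis by (rule that)
qed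

text \<open>The local constants are patched together. The value near a point is unique because a
  nonempty open set is not negligible, it does not change within a small ball, and a locally
  constant function on a connected set is constant.\<close>

lemma weak_grad_zero_imp_constant:
  fixes v :: "real^'d \<Rightarrow> real"
  assumes \<Omega>: "open \<Omega>" "connected \<Omega>" and v: "integrable (lebesgue_on \<Omega>) v"
    and zero: "\<And>\<psi> d\<psi>. test_function \<Omega> \<psi> d\<psi> \<Longrightarrow> (LINT x|lebesgue_on \<Omega>. v x *\<^sub>R d\<psi> x) = 0"
  obtains c where "AE x in lebesgue_on \<Omega>. v x = c"
proof -
  have \<Omega>_sets: "\<Omega> \<in> sets lebesgue" using \<Omega>(1) by (simp add: borel_open)
  have vI: "integrable lebesgue (\<lambda>x. indicat_real \<Omega> x * v x)"
    using v \<Omega>_sets by (simp add: integrable_restrict_space)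
  \<comment> \<open>The local result concerns functions integrable over \<open>lborel\<close>, so v,
    extended by zero, is replaced by a Borel representative.\<close>
  then obtain f where f_meas: "f \<in> borel_measurable lborel"
    and f_eq: "AE x in lborel. indicat_real \<Omega> x * v x = f x"
    using completion_ex_borel_measurable_real[OF borel_measurable_integrable[OF vI]] by blast
  have f_eq': "AE x in lebesgue. indicat_real \<Omega> x * v x = f x"
    using f_eq by (rule AE_completion)
  have "integrable lebesgue f"
    using vI f_meas f_eq' by (subst integrable_cong_AE[symmetric, OF _ _ f_eq']) (auto intro: measurable_completion)
  then have f: "integrable lborel f" using f_meas by (simp add: integrable_completion)
  have f_zero: "(LINT x|lborel. f x *\<^sub>R d\<psi> x) = 0" if \<psi>: "test_function \<Omega> \<psi> d\<psi>" for \<psi> d\<psi>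
  proof -
    note m = test_function_measurable[OF \<psi>]
    have "(LINT x|lborel. f x *\<^sub>R d\<psi> x) = (LINT x|lebesgue. f x *\<^sub>R d\<psi> x)"
      using f_meas m by (intro integral_completion[symmetric]) simp
    also have "\<dots> = (LINT x|lebesgue. indicat_real \<Omega> x *\<^sub>R v x *\<^sub>R d\<psi> x)"
    proof (rule integral_cong_AE)
      show "(\<lambda>x. f x *\<^sub>R d\<psi> x) \<in> borel_measurable lebesgue"
        using f_meas m by (intro measurable_completion) simp
      have "(\<lambda>x. (indicat_real \<Omega> x * v x) *\<^sub>R d\<psi> x) \<in> borel_measurable lebesgue"
        using m by (intro borel_measurable_scaleR borel_measurable_integrable[OF vI] measurable_completion) simp
      then show "(\<lambda>x. indicat_real \<Omega> x *\<^sub>R v x *\<^sub>R d\<psi> x) \<in> borel_measurable lebesgue" by simp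
      show "AE x in lebesgue. f x *\<^sub>R d\<psi> x = indicat_real \<Omega> x *\<^sub>R v x *\<^sub>R d\<psi> x"
        using f_eq' by eventually_elim (simp only: scaleR_scaleR)
    qed
    also have "\<dots> = (LINT x|lebesgue_on \<Omega>. v x *\<^sub>R d\<psi> x)"
      using \<Omega>_sets by (simp add: integral_restrict_space)
    finally show ?thesis using zero[OF \<psi>] by simp
  qed
  \<comment> \<open>The constant c is an almost everywhere value of v near x. The intersection with
    \<Omega> spares later uses from choosing the ball inside the domain.\<close>
  define P where "P x c \<longleftrightarrow> (\<exists>r>0. AE y in lebesgue. y \<in> ball x r \<inter> \<Omega> \<longrightarrow> v y = c)" for x c
  have P_ex: "\<exists>r>0. \<exists>c. ball x0 r \<subseteq> \<Omega> \<and> (AE y in lebesgue. y \<in> ball x0 r \<longrightarrow> v y = c)" if x0: "x0 \<in> \<Omega>" for x0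
  proof -
    obtain R where R: "R > 0" "ball x0 R \<subseteq> \<Omega>"
      using \<Omega>(1) x0 open_contains_ball by blast
    obtain c where "AE x in lebesgue_on (ball x0 (R / 2)). f x = c"
    proof (rule locally_constant_if_weak_grad_zero[OF f, where \<Omega> = \<Omega> and r = "R / 2" and ?x0.0 = x0])
      show "(LINT x|lborel. f x *\<^sub>R d\<psi> x) = 0" if "test_function \<Omega> \<psi> d\<psi>" for \<psi> d\<psi>
        using that by (rule f_zero)
    qed (use R that in auto)
    then have "AE x in lebesgue. x \<in> ball x0 (R / 2) \<longrightarrow> f x = c"
      by (simp add: AE_restrict_space_iff)
    with f_eq' have "AE y in lebesgue. y \<in> ball x0 (R / 2) \<longrightarrow> v y = c"
    proof eventually_elim
      case (elim y)
      have "y \<in> ball x0 (R / 2) \<Longrightarrow> y \<in> \<Omega>"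
        using R by (auto simp: subset_iff)
      then show ?case using elim by auto
    qed
    moreover have "ball x0 (R / 2) \<subseteq> \<Omega>" using R by (auto simp: subset_iff)
    ultimately show ?thesis using R(1) by (intro exI[of _ "R / 2"]) auto
  qed
  have P_unique: "c = c'" if P: "P x c" "P x c'" and x: "x \<in> \<Omega>" for x c c'
  proof -
    obtain r r' where "r > 0" "r' > 0"
      and ae: "AE y in lebesgue. y \<in> ball x r \<inter> \<Omega> \<longrightarrow> v y = c" "AE y in lebesgue. y \<in> ball x r' \<inter> \<Omega> \<longrightarrow> v y = c'"
      using P unfolding P_def by blast
    let ?U = "ball x r \<inter> ball x r' \<inter> \<Omega>"
    have "open ?U" "x \<in> ?U" using \<Omega>(1) \<open>r > 0\<close> \<open>r' > 0\<close> x by auto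
    show ?thesis
    proof (rule ccontr)
      assume "c \<noteq> c'"
      have "AE y in lebesgue. y \<notin> ?U"
        using ae by eventually_elim (use \<open>c \<noteq> c'\<close> in auto)
      then have "?U \<in> null_sets lebesgue"
        using \<open>open ?U\<close> by (subst AE_iff_null_sets) (auto simp: borel_open)
      then have "negligible ?U" by (simp add: negligible_iff_null_sets)
      then show False using \<open>open ?U\<close> \<open>x \<in> ?U\<close> open_not_negligible by blast
    qed
  qed
  define C where "C x = (SOME c. P x c)" for x
  have C: "C x = c" if "P x c" "x \<in> \<Omega>" for x c
    unfolding C_def using that by (intro some_equality P_unique) 
  have loc: "\<exists>T. openin (top_of_set \<Omega>) T \<and> a \<in> T \<and> (\<forall>x\<in>T. C x = C a)" if a: "a \<in> \<Omega>" for a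
  proof -
    obtain r c where r: "r > 0" "ball a r \<subseteq> \<Omega>" "AE y in lebesgue. y \<in> ball a r \<longrightarrow> v y = c"
      using P_ex[OF a] by blast
    have "C x = c" if x: "x \<in> ball a r" for x
    proof (rule C)
      obtain s where s: "s > 0" "ball x s \<subseteq> ball a r" using x open_contains_ball by blast
      have "AE y in lebesgue. y \<in> ball x s \<inter> \<Omega> \<longrightarrow> v y = c"
        using r(3) by eventually_elim (use s in blast)
      then show "P x c" using s(1) by (auto simp: P_def)
    qed (use x r in blast)
    then show ?thesis using r(1,2) a \<Omega>(1)
      by (intro exI[of _ "ball a r"]) (auto intro: open_subset)
  qed
  then have "C constant_on \<Omega>" using \<Omega>(2) by (rule locally_constant_imp_constant[rotated])
  then obtain c where c: "\<And>x. x \<in> \<Omega> \<Longrightarrow> C x = c" by (auto simp: constant_on_def)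
  have "AE x in lebesgue_on \<Omega>. v x = c"
  proof (rule AE_lebesgue_on_if_locally[OF \<Omega>(1)])
    fix x assume x: "x \<in> \<Omega>"
    obtain r c' where r: "r > 0" "ball x r \<subseteq> \<Omega>" "AE y in lebesgue. y \<in> ball x r \<longrightarrow> v y = c'"
      using P_ex[OF x] by blast
    have "AE y in lebesgue. y \<in> ball x r \<inter> \<Omega> \<longrightarrow> v y = c'"
      using r(3) by eventually_elim blast
    then have "c' = c" using C[of x c'] c[OF x] x r(1) by (auto simp: P_def)
    then show "\<exists>U. open U \<and> x \<in> U \<and> (AE y in lebesgue. y \<in> U \<longrightarrow> v y = c)"
      using r by (intro exI[of _ "ball x r"]) auto
  qed
  then show thesis by (rule that)
qed

text \<open>The integral of \<psi> over the whole space does not change under translation, and its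
  derivative in direction w is the integral of \<open>d\<psi> x \<bullet> w\<close>. This is how
  constants turn out to have weak gradient zero.\<close>

lemma integral_test_function_grad:
  fixes d\<psi> :: "real^'d \<Rightarrow> real^'d"
  assumes \<psi>: "test_function \<Omega> \<psi> d\<psi>" and \<Omega>: "open \<Omega>"
  shows "(LINT x|lebesgue_on \<Omega>. d\<psi> x) = 0"
proof -
  obtain K where K: "compact K" "K \<subseteq> \<Omega>" "\<And>x. x \<notin> K \<Longrightarrow> \<psi> x = 0"
    using \<psi> by (auto simp: test_function_def)
  have d0: "d\<psi> x = 0" if "x \<notin> K" for x
    using test_function_grad_eq_0[OF \<psi> K(1,3) that] .
  obtain R where R: "\<And>x. x \<in> K \<Longrightarrow> norm x \<le> R"
    using compact_imp_bounded[OF K(1)] by (auto simp: bounded_iff)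
  obtain B where B: "B \<ge> 0" "\<And>x. norm (\<psi> x) \<le> B" "\<And>x. norm (d\<psi> x) \<le> B"
    using test_function_bounded[OF \<psi>] by blast
  note m = test_function_measurable[OF \<psi>]
  have dI: "integrable lborel d\<psi>"
  proof -
    have "integrable lborel (\<lambda>x. indicat_real K x *\<^sub>R d\<psi> x)"
      using K(1) continuous_on_subset[OF test_function_continuous(2)[OF \<psi>]]
      by (intro borel_integrable_compact) auto
    moreover have "(\<lambda>x. indicat_real K x *\<^sub>R d\<psi> x) = d\<psi>"
      using d0 by (auto simp: indicator_def fun_eq_iff)
    ultimately show ?thesis by (simp only:)
  qed
  have "(LINT x|lborel. d\<psi> x) \<bullet> w = 0" for w
  proof -
    \<comment> \<open>For increments of size at most 1, both \<psi> and its translate vanish outside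
      the ball of radius \<open>R + norm w\<close>, where R bounds the support.\<close>
    let ?D = "\<lambda>x. (B * norm w) * indicat_real (cball 0 (R + norm w)) x"
    have der: "((\<lambda>t. LINT x|lborel. \<psi> (x + t *\<^sub>R w)) has_real_derivative (LINT x|lborel. d\<psi> x \<bullet> w)) (at 0)"
    proof (rule has_real_derivative_integral(2))
      have "test_function UNIV (\<lambda>x. \<psi> (x - - (t *\<^sub>R w))) (\<lambda>x. d\<psi> (x - - (t *\<^sub>R w)))" for t
        by (rule test_function_translate[OF \<psi>]) simp
      then show "integrable lborel (\<lambda>x. \<psi> (x + t *\<^sub>R w))" for t
        using test_function_integrable by fastforce
      show "integrable lborel ?D"
        using emeasure_bounded_finite[OF bounded_cball, of 0 "R + norm w"]
        by (intro integrable_mult_right) (simp add: integrable_indicator_iff)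
      show "(\<lambda>x. d\<psi> x \<bullet> w) \<in> borel_measurable lborel" using m by simp
      have "((\<lambda>t. \<psi> (x + t *\<^sub>R w)) has_real_derivative d\<psi> x \<bullet> w) (at 0)" for x
      proof -
        have "(\<psi> has_derivative (\<lambda>h. h \<bullet> d\<psi> x)) (at (x + 0 *\<^sub>R w))"
          using \<psi> by (simp add: test_function_def gderiv_def)
        moreover have "((\<lambda>t. x + t *\<^sub>R w) has_derivative (\<lambda>t. t *\<^sub>R w)) (at 0)"
          by (auto intro!: derivative_eq_intros)
        ultimately have "((\<lambda>t. \<psi> (x + t *\<^sub>R w)) has_derivative (\<lambda>t. t *\<^sub>R w \<bullet> d\<psi> x)) (at 0)"
          by (rule has_derivative_compose[rotated])
        then show ?thesis
          unfolding has_field_derivative_def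
          by (rule has_derivative_eq_rhs) (simp add: fun_eq_iff mult.commute inner_commute)
      qed
      then show "AE x in lborel. ((\<lambda>t. \<psi> (x + t *\<^sub>R w)) has_real_derivative d\<psi> x \<bullet> w) (at 0)" by simp
      fix t :: real assume t: "\<bar>t - 0\<bar> \<le> 1"
      have "\<bar>\<psi> (x + t *\<^sub>R w) - \<psi> (x + 0 *\<^sub>R w)\<bar> \<le> \<bar>t - 0\<bar> * ?D x" for x
      proof (cases "x \<in> cball 0 (R + norm w)")
        case True
        have "\<bar>\<psi> (x + t *\<^sub>R w) - \<psi> x\<bar> \<le> B * norm (x + t *\<^sub>R w - x)"
          by (rule test_function_lipschitz[OF \<psi> B(3)])
        then show ?thesis using True by (simp add: ac_simps)
      next
        case False
        have "norm (t *\<^sub>R w) \<le> norm w" using t by (simp add: mult_left_le_one_le)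
        moreover have "norm x \<le> norm (x + t *\<^sub>R w) + norm (t *\<^sub>R w)"
          using norm_triangle_ineq4[of "x + t *\<^sub>R w" "t *\<^sub>R w"] by simp
        ultimately have "norm (x + t *\<^sub>R w) > R" "norm x > R" using False by (auto simp: not_le) (smt (verit) norm_ge_zero)
        then have "x + t *\<^sub>R w \<notin> K" "x \<notin> K" using R by fastforce+
        then show ?thesis using K(3) False by simp
      qed
      then show "AE x in lborel. \<bar>\<psi> (x + t *\<^sub>R w) - \<psi> (x + 0 *\<^sub>R w)\<bar> \<le> \<bar>t - 0\<bar> * ?D x" by simp
    qed
    have "(LINT x|lborel. \<psi> (x + t *\<^sub>R w)) = (LINT x|lborel. \<psi> x)" for t
      by (rule lborel_integral_translate[OF m(1)])
    then have "((\<lambda>t. LINT x|lborel. \<psi> x) has_real_derivative (LINT x|lborel. d\<psi> x \<bullet> w)) (at 0)"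
      using der by simp
    then have "(LINT x|lborel. d\<psi> x \<bullet> w) = 0" using DERIV_unique DERIV_const by blast
    then show ?thesis using integral_inner_left[of w lborel d\<psi>] dI by simp
  qed
  then have "(LINT x|lborel. d\<psi> x) = 0" by (metis inner_eq_zero_iff)
  moreover have "(LINT x|lebesgue_on \<Omega>. d\<psi> x) = (LINT x|lborel. d\<psi> x)"
    using m \<Omega> d0 K(2) by (intro lebesgue_on_integral_eq_lborel) (auto simp: borel_open)
  ultimately show ?thesis by simp
qed

section \<open>Square integrable functions and weak gradients\<close>

lemma L2_D:
  assumes "f \<in> L2 \<Omega>"
  shows "f \<in> borel_measurable (lebesgue_on \<Omega>)" "integrable (lebesgue_on \<Omega>) (\<lambda>x. (norm (f x))\<^sup>2)"
  using assms by (auto simp: L2_def)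

lemma L2_integrable_mult_norm:
  assumes "f \<in> L2 \<Omega>" "g \<in> L2 \<Omega>"
  shows "integrable (lebesgue_on \<Omega>) (\<lambda>x. norm (f x) * norm (g x))"
proof (rule Bochner_Integration.integrable_bound)
  show "integrable (lebesgue_on \<Omega>) (\<lambda>x. (norm (f x))\<^sup>2 + (norm (g x))\<^sup>2)"
    using assms by (auto intro: L2_D)
  show "(\<lambda>x. norm (f x) * norm (g x)) \<in> borel_measurable (lebesgue_on \<Omega>)"
    using L2_D(1)[OF assms(1)] L2_D(1)[OF assms(2)] by measurable
  have "a * b \<le> a\<^sup>2 + b\<^sup>2" if "a \<ge> 0" "b \<ge> 0" for a b :: real
    using sum_squares_bound[of a b] that mult_nonneg_nonneg[OF that] by linarith
  then show "AE x in lebesgue_on \<Omega>. norm (norm (f x) * norm (g x)) \<le> norm ((norm (f x))\<^sup>2 + (norm (g x))\<^sup>2)"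
    by (intro AE_I2) simp
qed

lemma L2_integrable_inner:
  assumes "f \<in> L2 \<Omega>" "g \<in> L2 \<Omega>"
  shows "integrable (lebesgue_on \<Omega>) (\<lambda>x. f x \<bullet> g x)"
proof (rule Bochner_Integration.integrable_bound[OF L2_integrable_mult_norm[OF assms]])
  show "(\<lambda>x. f x \<bullet> g x) \<in> borel_measurable (lebesgue_on \<Omega>)"
    using L2_D(1)[OF assms(1)] L2_D(1)[OF assms(2)] by (rule borel_measurable_inner)
qed (simp add: Cauchy_Schwarz_ineq2)

lemma L2_dominated:
  fixes h :: "real^'d \<Rightarrow> 'b::euclidean_space" and f :: "real^'d \<Rightarrow> 'c::euclidean_space"
  assumes f: "f \<in> L2 \<Omega>" and h: "h \<in> borel_measurable (lebesgue_on \<Omega>)"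
    and le: "AE x in lebesgue_on \<Omega>. norm (h x) \<le> K * norm (f x)"
  shows "h \<in> L2 \<Omega>"
proof -
  have "integrable (lebesgue_on \<Omega>) (\<lambda>x. (norm (h x))\<^sup>2)"
  proof (rule Bochner_Integration.integrable_bound)
    show "integrable (lebesgue_on \<Omega>) (\<lambda>x. K\<^sup>2 * (norm (f x))\<^sup>2)"
      using L2_D[OF f] by simp
    show "(\<lambda>x. (norm (h x))\<^sup>2) \<in> borel_measurable (lebesgue_on \<Omega>)"
      using h by measurable
    show "AE x in lebesgue_on \<Omega>. norm ((norm (h x))\<^sup>2) \<le> norm (K\<^sup>2 * (norm (f x))\<^sup>2)"
      using le
    proof eventually_elim
      case (elim x)
      then have "(norm (h x))\<^sup>2 \<le> (K * norm (f x))\<^sup>2" by (intro power_mono) auto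
      then show ?case by (simp add: power_mult_distrib)
    qed
  qed
  then show ?thesis using h by (simp add: L2_def)
qed

lemma L2_lincomb:
  assumes f: "f \<in> L2 \<Omega>" and g: "g \<in> L2 \<Omega>"
  shows "(\<lambda>x. a *\<^sub>R f x + b *\<^sub>R g x) \<in> L2 \<Omega>"
proof -
  have "integrable (lebesgue_on \<Omega>) (\<lambda>x. (norm (a *\<^sub>R f x + b *\<^sub>R g x))\<^sup>2)"
  proof (rule Bochner_Integration.integrable_bound)
    show "integrable (lebesgue_on \<Omega>) (\<lambda>x. 2 * (a\<^sup>2 * (norm (f x))\<^sup>2 + b\<^sup>2 * (norm (g x))\<^sup>2))"
      using L2_D[OF f] L2_D[OF g] by simp
    show "(\<lambda>x. (norm (a *\<^sub>R f x + b *\<^sub>R g x))\<^sup>2) \<in> borel_measurable (lebesgue_on \<Omega>)"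
      using L2_D(1)[OF f] L2_D(1)[OF g] by measurable
    have "(norm (u + v))\<^sup>2 \<le> 2 * ((norm u)\<^sup>2 + (norm v)\<^sup>2)" for u v :: 'b
    proof -
      have "0 \<le> (norm (u - v))\<^sup>2" by simp
      then show ?thesis by (simp add: power2_norm_eq_inner algebra_simps inner_commute)
    qed
    from this[of "a *\<^sub>R f _" "b *\<^sub>R g _"]
    show "AE x in lebesgue_on \<Omega>. norm ((norm (a *\<^sub>R f x + b *\<^sub>R g x))\<^sup>2)
        \<le> norm (2 * (a\<^sup>2 * (norm (f x))\<^sup>2 + b\<^sup>2 * (norm (g x))\<^sup>2))"
      by (intro AE_I2) (simp add: power_mult_distrib)
  qed
  moreover have "(\<lambda>x. a *\<^sub>R f x + b *\<^sub>R g x) \<in> borel_measurable (lebesgue_on \<Omega>)"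
    using L2_D(1)[OF f] L2_D(1)[OF g] by measurable
  ultimately show ?thesis by (simp add: L2_def)
qed

lemma L2_add: "f \<in> L2 \<Omega> \<Longrightarrow> g \<in> L2 \<Omega> \<Longrightarrow> (\<lambda>x. f x + g x) \<in> L2 \<Omega>"
  using L2_lincomb[of f \<Omega> g 1 1] by simp

lemma L2_diff: "f \<in> L2 \<Omega> \<Longrightarrow> g \<in> L2 \<Omega> \<Longrightarrow> (\<lambda>x. f x - g x) \<in> L2 \<Omega>"
  using L2_lincomb[of f \<Omega> g 1 "-1"] by simp

lemma L2_scaleR: "f \<in> L2 \<Omega> \<Longrightarrow> (\<lambda>x. a *\<^sub>R f x) \<in> L2 \<Omega>"
  using L2_lincomb[of f \<Omega> f a 0] by simp

lemma L2_bounded: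
  fixes h :: "real^'d \<Rightarrow> 'b::euclidean_space"
  assumes \<Omega>: "\<Omega> \<in> lmeasurable" and h: "h \<in> borel_measurable (lebesgue_on \<Omega>)"
    and le: "AE x in lebesgue_on \<Omega>. norm (h x) \<le> K"
  shows "h \<in> L2 \<Omega>"
proof (rule L2_dominated)
  interpret finite_measure "lebesgue_on \<Omega>" using \<Omega> by (rule finite_measure_lebesgue_on)
  show "(\<lambda>x. 1 :: real) \<in> L2 \<Omega>" by (simp add: L2_def)
qed (use h le in auto)

lemma L2_integrable:
  assumes \<Omega>: "\<Omega> \<in> lmeasurable" and f: "f \<in> L2 \<Omega>"
  shows "integrable (lebesgue_on \<Omega>) f"
proof (rule Bochner_Integration.integrable_bound[OF _ L2_D(1)[OF f]])
  have "(\<lambda>x. 1 :: real) \<in> L2 \<Omega>" using \<Omega> by (intro L2_bounded[of _ _ 1]) auto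
  from L2_integrable_mult_norm[OF f this] show "integrable (lebesgue_on \<Omega>) (\<lambda>x. norm (f x))" by simp
qed simp

lemma L2_inner_commute: "L2_inner \<Omega> f g = L2_inner \<Omega> g f"
  by (simp add: L2_inner_def inner_commute)

lemma L2_inner_lincomb_left:
  assumes "f \<in> L2 \<Omega>" "g \<in> L2 \<Omega>" "l \<in> L2 \<Omega>"
  shows "L2_inner \<Omega> (\<lambda>x. a *\<^sub>R f x + b *\<^sub>R g x) l = a * L2_inner \<Omega> f l + b * L2_inner \<Omega> g l"
  using assms by (simp add: L2_inner_def inner_add_left L2_integrable_inner)

lemma L2_inner_cong_AE:
  assumes "f \<in> L2 \<Omega>" "f' \<in> L2 \<Omega>" "g \<in> L2 \<Omega>" "AE x in lebesgue_on \<Omega>. f x = f' x"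
  shows "L2_inner \<Omega> f g = L2_inner \<Omega> f' g"
  unfolding L2_inner_def
proof (rule integral_cong_AE)
  show "AE x in lebesgue_on \<Omega>. f x \<bullet> g x = f' x \<bullet> g x" using assms(4) by eventually_elim simp
qed (use assms in \<open>auto intro: borel_measurable_integrable L2_integrable_inner\<close>)

lemma L2_inner_self_eq_0:
  assumes "f \<in> L2 \<Omega>" "L2_inner \<Omega> f f = 0"
  shows "AE x in lebesgue_on \<Omega>. f x = 0"
proof -
  have "AE x in lebesgue_on \<Omega>. f x \<bullet> f x = 0"
    using assms integral_nonneg_eq_0_iff_AE[OF L2_integrable_inner[OF assms(1,1)]]
    by (simp add: L2_inner_def)
  then show ?thesis by simp
qed

lemma L2_inner_self_nonneg: "L2_inner \<Omega> f f \<ge> 0"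
  by (simp add: L2_inner_def)

lemma integrable_mult_test_function:
  assumes \<Omega>: "\<Omega> \<in> sets lebesgue" and \<psi>: "test_function \<Omega>' \<psi> d\<psi>" and v: "integrable (lebesgue_on \<Omega>) v"
    and g: "integrable (lebesgue_on \<Omega>) g"
  shows "integrable (lebesgue_on \<Omega>) (\<lambda>x. (v x :: real) *\<^sub>R d\<psi> x)"
    "integrable (lebesgue_on \<Omega>) (\<lambda>x. \<psi> x *\<^sub>R (g x :: 'c::euclidean_space))"
proof -
  obtain B where B: "B \<ge> 0" "\<And>x. norm (\<psi> x) \<le> B" "\<And>x. norm (d\<psi> x) \<le> B"
    using test_function_bounded[OF \<psi>] by blast
  have m: "\<psi> \<in> borel_measurable (lebesgue_on \<Omega>)" "d\<psi> \<in> borel_measurable (lebesgue_on \<Omega>)"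
    by (auto intro!: continuous_imp_measurable_on_sets_lebesgue \<Omega>
        continuous_on_subset[OF test_function_continuous(1)[OF \<psi>]]
        continuous_on_subset[OF test_function_continuous(2)[OF \<psi>]])
  show "integrable (lebesgue_on \<Omega>) (\<lambda>x. v x *\<^sub>R d\<psi> x)"
  proof (rule Bochner_Integration.integrable_bound)
    show "integrable (lebesgue_on \<Omega>) (\<lambda>x. B * norm (v x))" using v by simp
    show "(\<lambda>x. v x *\<^sub>R d\<psi> x) \<in> borel_measurable (lebesgue_on \<Omega>)"
      using v m by (intro borel_measurable_scaleR) auto
    show "AE x in lebesgue_on \<Omega>. norm (v x *\<^sub>R d\<psi> x) \<le> norm (B * norm (v x))"
      using B by (intro AE_I2) (simp add: abs_mult mult_left_mono mult.commute[of B])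
  qed
  show "integrable (lebesgue_on \<Omega>) (\<lambda>x. \<psi> x *\<^sub>R g x)"
  proof (rule Bochner_Integration.integrable_bound)
    show "integrable (lebesgue_on \<Omega>) (\<lambda>x. B * norm (g x))" using g by simp
    show "(\<lambda>x. \<psi> x *\<^sub>R g x) \<in> borel_measurable (lebesgue_on \<Omega>)"
      using g m by (intro borel_measurable_scaleR) auto
    show "AE x in lebesgue_on \<Omega>. norm (\<psi> x *\<^sub>R g x) \<le> norm (B * norm (g x))"
      using B by (intro AE_I2) (simp add: abs_mult mult_right_mono)
  qed
qed

section \<open>Linearity and uniqueness of weak gradients, and bounds for finite element
  functions\<close>

lemma has_weak_grad_lincomb:
  assumes \<Omega>: "\<Omega> \<in> lmeasurable"
    and v: "v \<in> L2 \<Omega>" "has_weak_grad \<Omega> v g" and w: "w \<in> L2 \<Omega>" "has_weak_grad \<Omega> w h"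
  shows "has_weak_grad \<Omega> (\<lambda>x. a * v x + b * w x) (\<lambda>x. a *\<^sub>R g x + b *\<^sub>R h x)"
  unfolding has_weak_grad_def
proof (intro conjI allI impI)
  have g: "g \<in> L2 \<Omega>" and h: "h \<in> L2 \<Omega>" using v w by (auto simp: has_weak_grad_def)
  then show "(\<lambda>x. a *\<^sub>R g x + b *\<^sub>R h x) \<in> L2 \<Omega>" by (rule L2_lincomb)
  fix \<psi> d\<psi> assume \<psi>: "test_function \<Omega> \<psi> d\<psi>"
  have \<Omega>': "\<Omega> \<in> sets lebesgue" using \<Omega> by blast
  note int = integrable_mult_test_function[OF \<Omega>' \<psi> L2_integrable[OF \<Omega>] L2_integrable[OF \<Omega>]]
  have "(LINT x|lebesgue_on \<Omega>. (a * v x + b * w x) *\<^sub>R d\<psi> x)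
      = (LINT x|lebesgue_on \<Omega>. a *\<^sub>R (v x *\<^sub>R d\<psi> x) + b *\<^sub>R (w x *\<^sub>R d\<psi> x))"
    by (simp add: scaleR_add_left)
  also have "\<dots> = a *\<^sub>R (LINT x|lebesgue_on \<Omega>. v x *\<^sub>R d\<psi> x) + b *\<^sub>R (LINT x|lebesgue_on \<Omega>. w x *\<^sub>R d\<psi> x)"
    using int(1)[OF v(1) g] int(1)[OF w(1) h] by (simp del: scaleR_scaleR)
  also have "\<dots> = - (a *\<^sub>R (LINT x|lebesgue_on \<Omega>. \<psi> x *\<^sub>R g x) + b *\<^sub>R (LINT x|lebesgue_on \<Omega>. \<psi> x *\<^sub>R h x))"
    using v w \<psi> by (simp add: has_weak_grad_def)
  also have "\<dots> = - (LINT x|lebesgue_on \<Omega>. a *\<^sub>R (\<psi> x *\<^sub>R g x) + b *\<^sub>R (\<psi> x *\<^sub>R h x))"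
    using int(2)[OF v(1) g] int(2)[OF w(1) h] by (simp del: scaleR_scaleR)
  also have "\<dots> = - (LINT x|lebesgue_on \<Omega>. \<psi> x *\<^sub>R (a *\<^sub>R g x + b *\<^sub>R h x))"
    by (simp add: scaleR_add_right mult.commute)
  finally show "(LINT x|lebesgue_on \<Omega>. (a * v x + b * w x) *\<^sub>R d\<psi> x)
      = - (LINT x|lebesgue_on \<Omega>. \<psi> x *\<^sub>R (a *\<^sub>R g x + b *\<^sub>R h x))" .
qed

lemma has_weak_grad_unique:
  assumes \<Omega>: "open \<Omega>" "\<Omega> \<in> lmeasurable"
    and g: "has_weak_grad \<Omega> v g" and h: "has_weak_grad \<Omega> v h"
  shows "AE x in lebesgue_on \<Omega>. g x = h x"
proof -
  have gh: "g \<in> L2 \<Omega>" "h \<in> L2 \<Omega>" using g h by (auto simp: has_weak_grad_def)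
  have \<Omega>': "\<Omega> \<in> sets lebesgue" using \<Omega> by blast
  have "AE x in lebesgue_on \<Omega>. g x - h x = 0"
  proof (rule fundamental_lemma[OF \<Omega>(1)])
    show "integrable (lebesgue_on \<Omega>) (\<lambda>x. g x - h x)"
      using gh L2_integrable[OF \<Omega>(2)] by (intro Bochner_Integration.integrable_diff) auto
    fix \<psi> d\<psi> assume \<psi>: "test_function \<Omega> \<psi> d\<psi>"
    \<comment> \<open>A placeholder for the argument v of
      \<open>integrable_mult_test_function\<close>, whose second conclusion concerns g.\<close>
    have "integrable (lebesgue_on \<Omega>) (\<lambda>x. 0 :: real)" by simp
    note int = integrable_mult_test_function(2)[OF \<Omega>' \<psi> this L2_integrable[OF \<Omega>(2)]]
    have "(LINT x|lebesgue_on \<Omega>. \<psi> x *\<^sub>R (g x - h x))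
        = (LINT x|lebesgue_on \<Omega>. \<psi> x *\<^sub>R g x) - (LINT x|lebesgue_on \<Omega>. \<psi> x *\<^sub>R h x)"
      using int[OF gh(1)] int[OF gh(2)] by (simp add: scaleR_diff_right)
    also have "(LINT x|lebesgue_on \<Omega>. \<psi> x *\<^sub>R g x) = - (LINT x|lebesgue_on \<Omega>. v x *\<^sub>R d\<psi> x)"
      using g \<psi> by (simp add: has_weak_grad_def)
    also have "\<dots> = (LINT x|lebesgue_on \<Omega>. \<psi> x *\<^sub>R h x)"
      using h \<psi> by (simp add: has_weak_grad_def)
    also have "\<dots> - \<dots> = 0" by simp
    finally show "(LINT x|lebesgue_on \<Omega>. \<psi> x *\<^sub>R (g x - h x)) = 0" .
  qed
  then show ?thesis by simp
qed

lemma has_weak_grad_grad: "has_weak_grad \<Omega> v g \<Longrightarrow> has_weak_grad \<Omega> v (grad \<Omega> v)"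
  unfolding grad_def by (rule someI[of "has_weak_grad \<Omega> v"])

lemma grad_weak_grad: "v \<in> H1 \<Omega> \<Longrightarrow> has_weak_grad \<Omega> v (grad \<Omega> v)"
  by (auto simp: H1_def intro: has_weak_grad_grad)

lemma H1_D: "v \<in> H1 \<Omega> \<Longrightarrow> v \<in> L2 \<Omega>" "v \<in> H1 \<Omega> \<Longrightarrow> grad \<Omega> v \<in> L2 \<Omega>"
  using grad_weak_grad[of v \<Omega>] by (auto simp: H1_def has_weak_grad_def)

text \<open>The combination of the chosen gradients is a weak gradient of u, and so is the one
  chosen for u; uniqueness identifies them, but only almost everywhere.\<close>

lemma grad_lincomb:
  assumes \<Omega>: "open \<Omega>" "\<Omega> \<in> lmeasurable" and v: "v \<in> H1 \<Omega>" and w: "w \<in> H1 \<Omega>"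
    and eq: "\<And>x. u x = a * v x + b * w x"
  shows "AE x in lebesgue_on \<Omega>. grad \<Omega> u x = a *\<^sub>R grad \<Omega> v x + b *\<^sub>R grad \<Omega> w x"
proof -
  have u: "u = (\<lambda>x. a * v x + b * w x)" using eq by (simp add: fun_eq_iff)
  have *: "has_weak_grad \<Omega> u (\<lambda>x. a *\<^sub>R grad \<Omega> v x + b *\<^sub>R grad \<Omega> w x)"
    unfolding u using assms by (intro has_weak_grad_lincomb grad_weak_grad H1_D)
  then have "has_weak_grad \<Omega> u (grad \<Omega> u)" by (rule has_weak_grad_grad)
  then show ?thesis using * by (rule has_weak_grad_unique[OF \<Omega>])
qed

text \<open>The function is known on \<Omega> alone, so the claim is derived from the integral
  identity for test functions rather than from a formula for \<open>grad\<close>.\<close>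

lemma grad_constant:
  assumes \<Omega>: "open \<Omega>" "\<Omega> \<in> lmeasurable" and v: "v \<in> H1 \<Omega>" and c: "\<And>x. x \<in> \<Omega> \<Longrightarrow> v x = c"
  shows "AE x in lebesgue_on \<Omega>. grad \<Omega> v x = 0"
proof (rule has_weak_grad_unique[OF \<Omega> grad_weak_grad[OF v]])
  show "has_weak_grad \<Omega> v (\<lambda>x. 0)"
    unfolding has_weak_grad_def
  proof (intro conjI allI impI)
    show "(\<lambda>x. 0 :: real^'a) \<in> L2 \<Omega>" by (simp add: L2_def)
    fix \<psi> d\<psi> assume \<psi>: "test_function \<Omega> \<psi> d\<psi>"
    have "(LINT x|lebesgue_on \<Omega>. v x *\<^sub>R d\<psi> x) = (LINT x|lebesgue_on \<Omega>. c *\<^sub>R d\<psi> x)"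
      using c by (intro Bochner_Integration.integral_cong) auto
    also have "\<dots> = c *\<^sub>R (LINT x|lebesgue_on \<Omega>. d\<psi> x)" by simp
    also have "\<dots> = 0" using integral_test_function_grad[OF \<psi> \<Omega>(1)] by simp
    finally show "(LINT x|lebesgue_on \<Omega>. v x *\<^sub>R d\<psi> x) = - (LINT x|lebesgue_on \<Omega>. \<psi> x *\<^sub>R 0)" by simp
  qed
qed

lemma grad_zero_imp_constant:
  assumes \<Omega>: "open \<Omega>" "connected \<Omega>" "\<Omega> \<in> lmeasurable" and v: "v \<in> H1 \<Omega>"
    and zero: "AE x in lebesgue_on \<Omega>. grad \<Omega> v x = 0"
  obtains c where "AE x in lebesgue_on \<Omega>. v x = c"
proof (rule weak_grad_zero_imp_constant[OF \<Omega>(1,2)])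
  show "integrable (lebesgue_on \<Omega>) v" by (intro L2_integrable \<Omega>(3) H1_D(1) v)
  fix \<psi> d\<psi> assume \<psi>: "test_function \<Omega> \<psi> d\<psi>"
  have "(LINT x|lebesgue_on \<Omega>. \<psi> x *\<^sub>R grad \<Omega> v x) = 0"
    using zero by (intro integral_eq_zero_AE) auto
  then show "(LINT x|lebesgue_on \<Omega>. v x *\<^sub>R d\<psi> x) = 0"
    using grad_weak_grad[OF v] \<psi> by (simp add: has_weak_grad_def)
qed (use that in blast)

text \<open>On the interior of an element v agrees with a function continuous on the compact
  element, and the interiors cover \<Omega> up to the negligible frontiers. On the frontiers v is
  arbitrary, hence a bound almost everywhere.\<close>

lemma piecewise_C1_bounded:
  assumes mesh: "is_mesh \<Omega> h \<T>" and \<Omega>: "\<Omega> \<in> sets lebesgue" and v: "piecewise_C1 \<T> v"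
  obtains B where "AE x in lebesgue_on \<Omega>. \<bar>v x\<bar> \<le> B"
proof -
  have fin: "finite \<T>" and cover: "\<Omega> \<subseteq> \<Union>\<T>" and cpt: "\<And>K. K \<in> \<T> \<Longrightarrow> compact K \<and> negligible (frontier K)"
    using mesh closure_subset[of \<Omega>] unfolding is_mesh_def by auto
  have "\<exists>B. \<forall>x\<in>interior K. \<bar>v x\<bar> \<le> B" if K: "K \<in> \<T>" for K
  proof -
    have "\<exists>U p dp. open U \<and> K \<subseteq> U \<and> (\<forall>x\<in>U. GDERIV p x :> dp x) \<and> continuous_on U dp \<and>
        (\<forall>x\<in>interior K. v x = p x)"
      using v K unfolding piecewise_C1_def by (rule bspec)
    then obtain U p dp where p: "open U" "K \<subseteq> U" "\<forall>x\<in>U. GDERIV p x :> dp x"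
      "\<forall>x\<in>interior K. v x = p x"
      by (elim exE conjE)
    have "continuous_on K p"
    proof (rule has_derivative_continuous_on)
      fix x assume "x \<in> K"
      then have "GDERIV p x :> dp x" using p(2,3) by blast
      then show "(p has_derivative (\<lambda>h. h \<bullet> dp x)) (at x within K)"
        unfolding gderiv_def by (rule has_derivative_at_withinI)
    qed
    then have "bounded (p ` K)" using cpt[OF K] by (intro compact_imp_bounded compact_continuous_image) auto
    then obtain B where "\<And>x. x \<in> K \<Longrightarrow> norm (p x) \<le> B" by (auto simp: bounded_iff)
    then show ?thesis using p(4) interior_subset[of K] by (intro exI[of _ B]) auto
  qed
  then obtain B where B: "\<And>K x. K \<in> \<T> \<Longrightarrow> x \<in> interior K \<Longrightarrow> \<bar>v x\<bar> \<le> B K" by metis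
  have "negligible (\<Union>(frontier ` \<T>))"
    using fin cpt by (intro negligible_Union) auto
  then have "AE x in lebesgue. x \<notin> \<Union>(frontier ` \<T>)"
    by (intro AE_not_in) (simp add: negligible_iff_null_sets)
  then have "AE x in lebesgue_on \<Omega>. x \<notin> \<Union>(frontier ` \<T>)"
    using \<Omega> by (subst AE_restrict_space_iff) (auto elim: AE_mp)
  then have "AE x in lebesgue_on \<Omega>. \<bar>v x\<bar> \<le> (\<Sum>K\<in>\<T>. \<bar>B K\<bar>)"
  proof (rule lebesgue_on_mono)
    fix x assume x: "x \<notin> \<Union>(frontier ` \<T>)" "x \<in> \<Omega>"
    then obtain K where K: "K \<in> \<T>" "x \<in> K" using cover by blast
    then have "x \<in> interior K"
      using x(1) closure_subset[of K] by (auto simp: frontier_def)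
    then have "\<bar>v x\<bar> \<le> \<bar>B K\<bar>" using B[OF K(1)] by force
    also have "\<dots> \<le> (\<Sum>K\<in>\<T>. \<bar>B K\<bar>)" using fin K(1) by (intro member_le_sum) auto
    finally show "\<bar>v x\<bar> \<le> (\<Sum>K\<in>\<T>. \<bar>B K\<bar>)" .
  qed
  then show thesis by (rule that)
qed

section \<open>Riesz representation and the discrete dual norm\<close>

text \<open>Linearity is relative to a set V of functions, in the two-term form that matches the
  closure property of the finite element spaces.\<close>

definition linear_functional_on :: "('a \<Rightarrow> real) set \<Rightarrow> (('a \<Rightarrow> real) \<Rightarrow> real) \<Rightarrow> bool" where
  "linear_functional_on V G \<longleftrightarrow>
     (\<forall>v\<in>V. \<forall>w\<in>V. \<forall>a b. G (\<lambda>x. a * v x + b * w x) = a * G v + b * G w)"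

lemma linear_functional_onD:
  "linear_functional_on V G \<Longrightarrow> v \<in> V \<Longrightarrow> w \<in> V \<Longrightarrow> G (\<lambda>x. a * v x + b * w x) = a * G v + b * G w"
  by (simp add: linear_functional_on_def)

text \<open>
  The clause on functionals \<open>G\<close> says that \<open>z\<close> lies in the span of \<open>B\<close>. The induction on \<open>B\<close> is
  a Gram-Schmidt step: the new basis element is split into its projection and a remainder \<open>e\<close>.
\<close>

lemma riesz_finite:
  fixes V :: "('a \<Rightarrow> real) set" and A :: "('a \<Rightarrow> real) \<Rightarrow> ('a \<Rightarrow> real) \<Rightarrow> real"
  assumes ne: "V \<noteq> {}"
    and closed: "\<And>v w a b. v \<in> V \<Longrightarrow> w \<in> V \<Longrightarrow> (\<lambda>x. a * v x + b * w x) \<in> V"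
    and sym: "\<And>v w. A v w = A w v"
    and lin: "\<And>v. v \<in> V \<Longrightarrow> linear_functional_on V (A v)"
    and pos: "\<And>v. v \<in> V \<Longrightarrow> A v v \<ge> 0"
    and "finite B" "B \<subseteq> V"
    and F: "linear_functional_on V F" "\<And>v. v \<in> V \<Longrightarrow> A v v = 0 \<Longrightarrow> F v = 0"
  shows "\<exists>z\<in>V. (\<forall>b\<in>B. A z b = F b) \<and>
    (\<forall>G. linear_functional_on V G \<longrightarrow> (\<forall>b\<in>B. G b = 0) \<longrightarrow> G z = 0)"
  using \<open>finite B\<close> \<open>B \<subseteq> V\<close> F
proof (induction B arbitrary: F rule: finite_induct)
  case empty
  obtain v where "v \<in> V" using ne by blast
  show ?case
  \<comment> \<open>The zero function is written as a combination so that closure and linearity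
    apply to it literally.\<close>
  proof (intro bexI[of _ "\<lambda>x. 0 * v x + 0 * v x"] conjI allI impI ballI)
    show "(\<lambda>x. 0 * v x + 0 * v x) \<in> V" using \<open>v \<in> V\<close> by (intro closed)
    fix G assume "linear_functional_on V G"
    then have "G (\<lambda>x. 0 * v x + 0 * v x) = 0 * G v + 0 * G v"
      using \<open>v \<in> V\<close> unfolding linear_functional_on_def by blast
    then show "G (\<lambda>x. 0 * v x + 0 * v x) = 0" by simp
  qed simp
next
  case (insert b B)
  then have bV: "b \<in> V" and BV: "B \<subseteq> V" by auto
  \<comment> \<open>The form is only semidefinite. That its null vectors are orthogonal to all of V
    is what allows the induction hypothesis to be applied to \<open>A b\<close> in place of
    F.\<close>
  have kernel: "A v w = 0" if "v \<in> V" "w \<in> V" "A w w = 0" for v w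
  proof (rule ccontr)
    assume *: "A v w \<noteq> 0"
    \<comment> \<open>Chosen so that \<open>A v v + 2 * ?t * A v w\<close> equals -1, against
      positivity.\<close>
    let ?t = "- (A v v + 1) / (2 * A v w)"
    let ?u = "\<lambda>x. 1 * v x + ?t * w x"
    have u: "?u \<in> V" using that by (intro closed)
    have "A ?u ?u = A ?u v + ?t * A ?u w"
      using linear_functional_onD[OF lin[OF u] that(1,2), of 1 ?t] by simp
    also have "A ?u v = A v v + ?t * A v w"
      using linear_functional_onD[OF lin[OF that(1)] that(1,2), of 1 ?t] sym[of ?u v] by simp
    also have "A ?u w = A v w"
      using linear_functional_onD[OF lin[OF that(2)] that(1,2), of 1 ?t] sym[of ?u w] sym[of w v] that by simp
    finally have "A ?u ?u = A v v + 2 * (?t * A v w)" by simp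
    also have "\<dots> = - 1" using * by (simp add: field_simps)
    finally show False using pos[OF u] by simp
  qed
  obtain q where q: "q \<in> V" "\<And>b'. b' \<in> B \<Longrightarrow> A q b' = A b b'"
    "\<And>G. linear_functional_on V G \<Longrightarrow> (\<And>b'. b' \<in> B \<Longrightarrow> G b' = 0) \<Longrightarrow> G q = 0"
    using insert.IH[OF BV lin[OF bV] kernel[OF bV]] by metis
  obtain z where z: "z \<in> V" "\<And>b'. b' \<in> B \<Longrightarrow> A z b' = F b'"
    "\<And>G. linear_functional_on V G \<Longrightarrow> (\<And>b'. b' \<in> B \<Longrightarrow> G b' = 0) \<Longrightarrow> G z = 0"
    using insert.IH[OF BV insert.prems(2,3)] by metis
  define e where "e = (\<lambda>x. 1 * b x + (- 1) * q x)"
  have e: "e \<in> V" unfolding e_def using bV q(1) by (intro closed)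
  have G_e: "G e = G b - G q" if "linear_functional_on V G" for G
    using linear_functional_onD[OF that bV q(1), of 1 "- 1"] by (simp add: e_def)
  have A_e: "A e b' = 0" if "b' \<in> B" for b'
    using G_e[OF lin[of b']] q(2)[OF that] that BV sym[of _ b'] by auto
  have ze: "A e z = 0" and qe: "A e q = 0"
    using z(3)[OF lin[OF e]] q(3)[OF lin[OF e]] A_e by auto
  have eb: "A e e = A e b" using G_e[OF lin[OF e]] qe by simp
  \<comment> \<open>This functional vanishes on B, hence at q, which lies in its span.\<close>
  have "linear_functional_on V (\<lambda>v. A z v - F v)"
    using lin[OF z(1)] insert.prems(2) by (simp add: linear_functional_on_def algebra_simps)
  then have zq: "A z q = F q" using q(3)[of "\<lambda>v. A z v - F v"] z(2) by simp
  have zb: "A z b = F q" using G_e[OF lin[OF z(1)]] ze sym[of z e] zq by simp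
  show ?case
  proof (cases "A e e = 0")
    case True
    \<comment> \<open>A null remainder is invisible to F, so b imposes the same condition as q,
      which z already satisfies.\<close>
    then have "F b = F q" using G_e[OF insert.prems(2)] insert.prems(3)[OF e] by simp
    then show ?thesis using z zb by (intro bexI[of _ z]) auto
  next
    case False
    \<comment> \<open>Since e is orthogonal to B, adding a multiple of it leaves the equations on B
      intact, and the coefficient is the one that adjusts the equation at b.\<close>
    define z' where "z' = (\<lambda>x. 1 * z x + (F e / A e e) * e x)"
    have z': "z' \<in> V" unfolding z'_def using z(1) e by (intro closed)
    have G_z': "G z' = G z + F e / A e e * G e" if "linear_functional_on V G" for G
      using linear_functional_onD[OF that z(1) e, of 1 "F e / A e e"] by (simp add: z'_def)
    have A_z': "A z' v = A z v + F e / A e e * A e v" if "v \<in> V" for v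
      using G_z'[OF lin[OF that]] sym[of _ v] by simp
    show ?thesis
    proof (intro bexI[OF _ z'] conjI allI impI ballI)
      fix b' assume "b' \<in> insert b B"
      then show "A z' b' = F b'"
      proof
        assume "b' = b"
        then show ?thesis
          using A_z'[OF bV] zb eb False G_e[OF insert.prems(2)] by simp
      next
        assume "b' \<in> B"
        then show ?thesis using A_z'[of b'] z(2) A_e BV by auto
      qed
    next
      fix G assume G: "linear_functional_on V G" "\<forall>b'\<in>insert b B. G b' = 0"
      then have "G z = 0" "G q = 0" "G b = 0" using z(3)[OF G(1)] q(3)[OF G(1)] by auto
      then show "G z' = 0" using G_z'[OF G(1)] G_e[OF G(1)] by simp
    qed
  qed
qed

text \<open>Instantiated twice, for the phase field and for the fluid content. \<open>V_one\<close>
  asks for a member equal to 1 on \<Omega>; its values elsewhere are free.\<close>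

locale scalar_space =
  fixes \<Omega> :: "(real^'d) set" and V :: "(real^'d \<Rightarrow> real) set"
  assumes domain: "open \<Omega>" "connected \<Omega>" "\<Omega> \<in> lmeasurable" "\<Omega> \<noteq> {}"
    and fin_dim: "fin_dim_space \<Omega> V" and V_H1: "V \<subseteq> H1 \<Omega>" and V_one: "\<exists>v\<in>V. \<forall>x\<in>\<Omega>. v x = 1"
begin

abbreviation gip :: "(real^'d \<Rightarrow> real) \<Rightarrow> (real^'d \<Rightarrow> real) \<Rightarrow> real" where
  "gip v w \<equiv> L2_inner \<Omega> (grad \<Omega> v) (grad \<Omega> w)"

abbreviation mean :: "(real^'d \<Rightarrow> real) \<Rightarrow> real" where
  "mean v \<equiv> LINT x|lebesgue_on \<Omega>. v x"

lemma lincomb_closed: "v \<in> V \<Longrightarrow> w \<in> V \<Longrightarrow> (\<lambda>x. a * v x + b * w x) \<in> V"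
  using fin_dim by (auto simp: fin_dim_space_def)

lemma V_L2: "v \<in> V \<Longrightarrow> v \<in> L2 \<Omega>" and V_grad_L2: "v \<in> V \<Longrightarrow> grad \<Omega> v \<in> L2 \<Omega>"
  by (auto intro!: H1_D subsetD[OF V_H1])

lemma measure_pos: "measure (lebesgue_on \<Omega>) \<Omega> > 0"
proof -
  have "\<not> negligible \<Omega>" using domain open_not_negligible by blast
  then show ?thesis
    using domain(3) by (simp add: negligible_iff_measure zero_less_measure_iff less_le measure_restrict_space fmeasurableD)
qed

lemma mean_const: "(LINT x|lebesgue_on \<Omega>. c) = c * measure (lebesgue_on \<Omega>) \<Omega>"
  by simp

lemma grad_lincomb_V:
  assumes "v \<in> V" "w \<in> V"
  shows "AE x in lebesgue_on \<Omega>. grad \<Omega> (\<lambda>x. a * v x + b * w x) x = a *\<^sub>R grad \<Omega> v x + b *\<^sub>R grad \<Omega> w x"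
  using assms V_H1 by (intro grad_lincomb domain) auto

lemma gip_lincomb_left:
  assumes v: "v \<in> V" and w: "w \<in> V" and l: "l \<in> V"
  shows "gip (\<lambda>x. a * v x + b * w x) l = a * gip v l + b * gip w l"
proof -
  have "gip (\<lambda>x. a * v x + b * w x) l = L2_inner \<Omega> (\<lambda>x. a *\<^sub>R grad \<Omega> v x + b *\<^sub>R grad \<Omega> w x) (grad \<Omega> l)"
    using assms by (intro L2_inner_cong_AE grad_lincomb_V V_grad_L2 lincomb_closed L2_lincomb)
  also have "\<dots> = a * gip v l + b * gip w l"
    using assms by (intro L2_inner_lincomb_left V_grad_L2)
  finally show ?thesis .
qed

lemma gip_lincomb_right:
  assumes "v \<in> V" "w \<in> V" "l \<in> V"
  shows "gip l (\<lambda>x. a * v x + b * w x) = a * gip l v + b * gip l w"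
  using gip_lincomb_left[OF assms] by (simp add: L2_inner_commute)

lemma gip_constant:
  assumes v: "v \<in> V" and c: "\<And>x. x \<in> \<Omega> \<Longrightarrow> v x = c" and l: "l \<in> V"
  shows "gip v l = 0" "gip l v = 0"
proof -
  have "gip v l = L2_inner \<Omega> (\<lambda>x. 0) (grad \<Omega> l)"
    using assms V_H1
    by (intro L2_inner_cong_AE V_grad_L2 grad_constant[where c = c] domain) (auto simp: L2_def)
  then show "gip v l = 0" by (simp add: L2_inner_def)
  then show "gip l v = 0" by (simp add: L2_inner_commute)
qed

lemma mean_lincomb:
  assumes "v \<in> L2 \<Omega>" "w \<in> L2 \<Omega>"
  shows "mean (\<lambda>x. a * v x + b * w x) = a * mean v + b * mean w"
  using L2_integrable[OF domain(3) assms(1)] L2_integrable[OF domain(3) assms(2)] by simp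

lemma ip_lincomb_right:
  assumes "v \<in> L2 \<Omega>" "w \<in> L2 \<Omega>" "s \<in> L2 \<Omega>"
  shows "L2_inner \<Omega> s (\<lambda>x. a * v x + b * w x) = a * L2_inner \<Omega> s v + b * L2_inner \<Omega> s w"
  using L2_inner_lincomb_left[OF assms, of a b] by (simp add: L2_inner_commute)

text \<open>A discrete Neumann problem. The gradient product degenerates on constants, so the
  product of the means is added to it; on a connected domain the null vectors are then zero almost
  everywhere. Testing with 1 and using that s has mean zero gives \<open>mean z = 0\<close>, and the
  added term disappears.\<close>

lemma riesz_mean_zero:
  assumes y: "y > 0" and s: "s \<in> L2 \<Omega>" "mean s = 0"
  obtains z where "z \<in> V" "mean z = 0" "\<And>l. l \<in> V \<Longrightarrow> y * gip z l = L2_inner \<Omega> s l"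
proof -
  define A where "A v w = y * gip v w + mean v * mean w" for v w
  define F where "F = L2_inner \<Omega> s"
  obtain one where one: "one \<in> V" "\<And>x. x \<in> \<Omega> \<Longrightarrow> one x = 1" using V_one by blast
  obtain B where B: "B \<subseteq> V" "finite B" "\<And>v. v \<in> V \<Longrightarrow> \<exists>c. \<forall>x\<in>\<Omega>. v x = (\<Sum>b\<in>B. c b *\<^sub>R b x)"
    using fin_dim unfolding fin_dim_space_def by blast
  have A_lin: "linear_functional_on V (A v)" if "v \<in> V" for v
    unfolding linear_functional_on_def A_def
    using that by (simp add: gip_lincomb_right mean_lincomb V_L2 algebra_simps)
  have F_lin: "linear_functional_on V F"
    unfolding linear_functional_on_def F_def using s by (simp add: ip_lincomb_right V_L2)
  have A_pos: "A v v \<ge> 0" for v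
    using y by (simp add: A_def L2_inner_self_nonneg)
  have kernel: "F v = 0" if v: "v \<in> V" "A v v = 0" for v
  proof -
    have "y * gip v v \<ge> 0" "mean v * mean v \<ge> 0" using y by (simp_all add: L2_inner_self_nonneg)
    then have "y * gip v v = 0" "mean v * mean v = 0" using v(2) unfolding A_def by linarith+
    then have *: "gip v v = 0" "mean v = 0" using y by auto
    obtain c where c: "AE x in lebesgue_on \<Omega>. v x = c"
      using grad_zero_imp_constant[OF domain(1-3) _ L2_inner_self_eq_0[OF V_grad_L2[OF v(1)] *(1)]] V_H1 v(1)
      by blast
    then have "mean v = (LINT x|lebesgue_on \<Omega>. c)"
      using L2_D(1)[OF V_L2[OF v(1)]] by (intro integral_cong_AE) auto
    then have "c = 0" using *(2) measure_pos mean_const[of c] by simp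
    then show ?thesis
      unfolding F_def L2_inner_def using c by (intro integral_eq_zero_AE) auto
  qed
  have "\<exists>z\<in>V. (\<forall>b\<in>B. A z b = F b) \<and>
      (\<forall>G. linear_functional_on V G \<longrightarrow> (\<forall>b\<in>B. G b = 0) \<longrightarrow> G z = 0)"
  proof (rule riesz_finite)
    show "V \<noteq> {}" using one(1) by blast
    show "A v w = A w v" for v w
      unfolding A_def by (simp add: L2_inner_commute mult.commute)
  qed (simp_all add: lincomb_closed A_lin A_pos B F_lin kernel)
  then obtain z where z: "z \<in> V" "\<And>b. b \<in> B \<Longrightarrow> A z b = F b" by blast
  define G where "G l = A z l - F l" for l
  have G_lin: "linear_functional_on V G"
    using A_lin[OF z(1)] F_lin by (simp add: linear_functional_on_def G_def algebra_simps)
  \<comment> \<open>Membership and vanishing share one induction because the linearity of G is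
    available on V only.\<close>
  have G_sum: "(\<lambda>x. \<Sum>b\<in>B'. c b * b x) \<in> V \<and> G (\<lambda>x. \<Sum>b\<in>B'. c b * b x) = 0" if "finite B'" "B' \<subseteq> B" for B' c
    using that
  proof (induction B' rule: finite_induct)
    case empty
    have "(\<lambda>x. 0 * one x + 0 * one x) \<in> V" using one(1) by (intro lincomb_closed)
    moreover have "G (\<lambda>x. 0 * one x + 0 * one x) = 0 * G one + 0 * G one"
      by (rule linear_functional_onD[OF G_lin one(1) one(1)])
    ultimately show ?case by simp
  next
    case (insert b B')
    let ?w = "\<lambda>x. \<Sum>b\<in>B'. c b * b x"
    have w: "?w \<in> V" "G ?w = 0" and b: "b \<in> V" using insert B(1) by auto
    have eq: "(\<lambda>x. \<Sum>b\<in>insert b B'. c b * b x) = (\<lambda>x. c b * b x + 1 * ?w x)"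
      using insert by simp
    have "G (\<lambda>x. c b * b x + 1 * ?w x) = c b * G b + 1 * G ?w"
      by (rule linear_functional_onD[OF G_lin b w(1)])
    then show ?case
      using lincomb_closed[OF b w(1), of "c b" 1] w(2) z(2)[of b] insert.prems unfolding eq
      by (simp add: G_def)
  qed
  have Az: "A z l = F l" if l: "l \<in> V" for l
  proof -
    obtain c where c: "\<And>x. x \<in> \<Omega> \<Longrightarrow> l x = (\<Sum>b\<in>B. c b * b x)" using B(3)[OF l] by auto
    let ?w = "\<lambda>x. \<Sum>b\<in>B. c b * b x"
    \<comment> \<open>The expansion of l in B holds on \<Omega> only. The difference vanishes there,
      and every integral involved ignores the rest.\<close>
    let ?d = "\<lambda>x. 1 * l x + (- 1) * ?w x"
    have w: "?w \<in> V" "G ?w = 0" using G_sum[OF B(2)] by auto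
    have d: "?d \<in> V" "\<And>x. x \<in> \<Omega> \<Longrightarrow> ?d x = 0"
      using lincomb_closed[OF l w(1), of 1 "- 1"] c by simp_all
    have "gip z ?d = 0" using gip_constant(2)[OF d z(1)] .
    moreover have "mean ?d = 0" using d(2) by (intro integral_eq_zero_AE AE_I2) simp
    moreover have "F ?d = 0"
      unfolding F_def L2_inner_def using d(2) by (intro integral_eq_zero_AE AE_I2) simp
    ultimately have "G ?d = 0" by (simp only: G_def A_def)
    moreover have "G ?d = 1 * G l + (- 1) * G ?w"
      by (rule linear_functional_onD[OF G_lin l w(1)])
    ultimately show ?thesis using w(2) by (simp add: G_def)
  qed
  have mean_one: "mean one = measure (lebesgue_on \<Omega>) \<Omega>"
  proof -
    have "mean one = (LINT x|lebesgue_on \<Omega>. 1)"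
      using one(2) by (intro Bochner_Integration.integral_cong) auto
    then show ?thesis using mean_const[of 1] by simp
  qed
  have "F one = mean s"
    unfolding F_def L2_inner_def using one(2) by (intro Bochner_Integration.integral_cong) auto
  \<comment> \<open>Against 1 the gradient part vanishes, leaving the product of the means on the
    left and the mean of s on the right.\<close>
  then have "mean z * measure (lebesgue_on \<Omega>) \<Omega> = 0"
    using Az[OF one(1)] s(2) gip_constant(2)[OF one z(1)] mean_one by (simp add: A_def)
  then have mz: "mean z = 0" using measure_pos by simp
  have "y * gip z l = L2_inner \<Omega> s l" if "l \<in> V" for l
    using Az[OF that] mz by (simp add: A_def F_def)
  with z(1) mz show thesis by (rule that)
qed

lemma h_norm_eq: "y > 0 \<Longrightarrow> h_norm \<Omega> y v = sqrt (y * gip v v)"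
  by (simp add: h_norm_def L2_norm_def L2_inner_def power2_eq_square[symmetric] flip: mult.assoc)

lemma gip_Cauchy_Schwarz:
  assumes v: "v \<in> V" and w: "w \<in> V" and pos: "gip w w > 0"
  shows "(gip v w)\<^sup>2 \<le> gip v v * gip w w"
proof -
  \<comment> \<open>The minimiser of the quadratic polynomial t \<mapsto> \<open>gip\<close> of
    \<open>v + t * w\<close> with itself.\<close>
  let ?t = "- gip v w / gip w w"
  let ?u = "\<lambda>x. 1 * v x + ?t * w x"
  have u: "?u \<in> V" using v w by (rule lincomb_closed)
  have "0 \<le> gip ?u ?u" by (rule L2_inner_self_nonneg)
  also have "gip ?u ?u = gip ?u v + ?t * gip ?u w"
    using gip_lincomb_right[OF v w u, of 1 ?t] by simp
  also have "gip ?u v = gip v v + ?t * gip w v"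
    using gip_lincomb_left[OF v w v, of 1 ?t] by simp
  also have "gip ?u w = gip v w + ?t * gip w w"
    using gip_lincomb_left[OF v w w, of 1 ?t] by simp
  finally have "0 \<le> gip v v - gip v w * gip v w / gip w w"
    using pos by (simp add: L2_inner_commute)
  then show ?thesis using pos by (simp add: field_simps power2_eq_square)
qed

text \<open>The supremum is attained at the representative z itself, and Cauchy-Schwarz bounds all
  other quotients. If z has zero \<open>h_norm\<close>, the maximum is the inserted 0.\<close>

lemma dual_norm_eq:
  assumes y: "y > 0" and z: "z \<in> V" "mean z = 0" and riesz: "\<And>l. l \<in> V \<Longrightarrow> y * gip z l = L2_inner \<Omega> s l"
  shows "(dual_norm \<Omega> y V s)\<^sup>2 = y * gip z z"
proof -
  let ?Q = "{L2_inner \<Omega> s l / h_norm \<Omega> y l |l. l \<in> mean_zero \<Omega> V \<and> h_norm \<Omega> y l \<noteq> 0}"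
  have nonneg: "y * gip v v \<ge> 0" for v using y by (simp add: L2_inner_self_nonneg)
  have "dual_norm \<Omega> y V s = sqrt (y * gip z z)"
    unfolding dual_norm_def
  proof (rule cSup_eq_maximum)
    show "sqrt (y * gip z z) \<in> insert 0 ?Q"
    proof (cases "h_norm \<Omega> y z = 0")
      case True
      then show ?thesis using h_norm_eq[OF y] by simp
    next
      case False
      have "L2_inner \<Omega> s z / h_norm \<Omega> y z = sqrt (y * gip z z)"
        using riesz[OF z(1)] nonneg[of z] by (simp add: h_norm_eq[OF y] real_div_sqrt flip: riesz)
      moreover have "z \<in> mean_zero \<Omega> V" using z by (simp add: mean_zero_def)
      ultimately show ?thesis using False by force
    qed
    fix q assume "q \<in> insert 0 ?Q"
    then show "q \<le> sqrt (y * gip z z)"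
    proof
      assume "q = 0" then show ?thesis using nonneg by simp
    next
      assume "q \<in> ?Q"
      then obtain l where l: "l \<in> V" "h_norm \<Omega> y l \<noteq> 0" "q = L2_inner \<Omega> s l / h_norm \<Omega> y l"
        by (auto simp: mean_zero_def)
      have "y * gip l l > 0" using l(2) nonneg[of l] by (simp add: h_norm_eq[OF y] less_le)
      then have gl: "gip l l > 0" using y by (simp add: zero_less_mult_iff)
      have "(y * gip z l)\<^sup>2 \<le> (y * gip z z) * (y * gip l l)"
        using mult_left_mono[OF gip_Cauchy_Schwarz[OF z(1) l(1) gl], of "y\<^sup>2"]
        by (simp add: power2_eq_square ac_simps)
      then have "\<bar>y * gip z l\<bar> \<le> sqrt (y * gip z z) * sqrt (y * gip l l)"
        by (metis real_sqrt_abs real_sqrt_le_iff real_sqrt_mult)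
      then have "y * gip z l \<le> sqrt (y * gip z z) * sqrt (y * gip l l)" by simp
      then show ?thesis
        using \<open>y * gip l l > 0\<close> riesz[OF l(1)] by (simp add: l(3) h_norm_eq[OF y] divide_le_eq)
    qed
  qed
  then show ?thesis using nonneg[of z] by simp
qed

text \<open>Representatives depend linearly on the functional, so z plus t times the representative
  w of \<eta> belongs to the perturbed functional. The linear coefficient is
  \<open>y * gip w z\<close>; testing the equation of w with z turns it into
  \<open>L2_inner \<Omega> z \<eta>\<close>, linear in \<eta> with the same z for all
  directions.\<close>

lemma dual_norm_step:
  assumes y: "y > 0" and z: "z \<in> V" "mean z = 0" and riesz: "\<And>l. l \<in> V \<Longrightarrow> y * gip z l = L2_inner \<Omega> s l"
    and s: "s \<in> L2 \<Omega>" and \<eta>: "\<eta> \<in> V" "mean \<eta> = 0"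
  obtains q where "q \<ge> 0"
    "\<And>t. (dual_norm \<Omega> y V (\<lambda>x. s x + t * \<eta> x))\<^sup>2 = (dual_norm \<Omega> y V s)\<^sup>2 + 2 * t * L2_inner \<Omega> z \<eta> + t\<^sup>2 * q"
proof -
  obtain w where w: "w \<in> V" "mean w = 0" "\<And>l. l \<in> V \<Longrightarrow> y * gip w l = L2_inner \<Omega> \<eta> l"
    using riesz_mean_zero[OF y V_L2[OF \<eta>(1)] \<eta>(2)] by blast
  show thesis
  proof (rule that)
    show "y * gip w w \<ge> 0" using y by (simp add: L2_inner_self_nonneg)
    fix t
    let ?u = "\<lambda>x. 1 * z x + t * w x"
    have u: "?u \<in> V" using z(1) w(1) by (rule lincomb_closed)
    have "mean ?u = 0" using mean_lincomb[OF V_L2[OF z(1)] V_L2[OF w(1)], of 1 t] z(2) w(2) by simp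
    moreover have "y * gip ?u l = L2_inner \<Omega> (\<lambda>x. s x + t * \<eta> x) l" if l: "l \<in> V" for l
    proof -
      have "y * gip ?u l = y * gip z l + t * (y * gip w l)"
        using gip_lincomb_left[OF z(1) w(1) l, of 1 t] by (simp add: algebra_simps)
      also have "\<dots> = 1 * L2_inner \<Omega> s l + t * L2_inner \<Omega> \<eta> l" using riesz w(3) l by simp
      also have "\<dots> = L2_inner \<Omega> (\<lambda>x. 1 *\<^sub>R s x + t *\<^sub>R \<eta> x) l"
        by (rule L2_inner_lincomb_left[symmetric]) (intro s V_L2 \<eta>(1) l)+
      finally show ?thesis by simp
    qed
    ultimately have "(dual_norm \<Omega> y V (\<lambda>x. s x + t * \<eta> x))\<^sup>2 = y * gip ?u ?u"
      by (rule dual_norm_eq[OF y u])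
    also have "gip ?u ?u = 1 * gip ?u z + t * gip ?u w"
      by (rule gip_lincomb_right[OF z(1) w(1) u])
    also have "gip ?u z = 1 * gip z z + t * gip w z"
      by (rule gip_lincomb_left[OF z(1) w(1) z(1)])
    also have "gip ?u w = 1 * gip z w + t * gip w w"
      by (rule gip_lincomb_left[OF z(1) w(1) w(1)])
    also have "gip z w = gip w z" by (rule L2_inner_commute)
    also have "y * (1 * (1 * gip z z + t * gip w z) + t * (1 * gip w z + t * gip w w))
        = y * gip z z + 2 * t * (y * gip w z) + t\<^sup>2 * (y * gip w w)"
      by (simp add: power2_eq_square algebra_simps)
    also have "y * gip w z = L2_inner \<Omega> z \<eta>"
      using w(3)[OF z(1)] by (simp only: L2_inner_commute[of \<Omega> \<eta> z])
    also have "y * gip z z = (dual_norm \<Omega> y V s)\<^sup>2"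
      by (rule dual_norm_eq[OF y z riesz, symmetric])
    finally show "(dual_norm \<Omega> y V (\<lambda>x. s x + t * \<eta> x))\<^sup>2
        = (dual_norm \<Omega> y V s)\<^sup>2 + 2 * t * L2_inner \<Omega> z \<eta> + t\<^sup>2 * (y * gip w w)" .
  qed
qed

lemma constant_one:
  obtains one where "one \<in> V" "\<And>x. x \<in> \<Omega> \<Longrightarrow> one x = 1" "\<And>s. L2_inner \<Omega> s one = mean s"
    "\<And>s. L2_inner \<Omega> one s = mean s" "mean one = measure (lebesgue_on \<Omega>) \<Omega>"
proof -
  obtain one where one: "one \<in> V" "\<And>x. x \<in> \<Omega> \<Longrightarrow> one x = 1" using V_one by blast
  have "L2_inner \<Omega> s one = mean s" for s
    unfolding L2_inner_def using one(2) by (intro Bochner_Integration.integral_cong) auto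
  moreover from this have "L2_inner \<Omega> one s = mean s" for s
    by (simp add: L2_inner_commute[of _ one])
  moreover have "mean one = (LINT x|lebesgue_on \<Omega>. 1)"
    using one(2) by (intro Bochner_Integration.integral_cong) auto
  ultimately show thesis using that one by simp
qed

text \<open>
  The multiplier is \<open>- z / \<tau>\<close> plus a constant, which is fixed by testing with \<open>1\<close>.
\<close>

lemma multiplier_ex:
  assumes \<tau>: "\<tau> > 0" and z: "z \<in> V" "mean z = 0" and R: "linear_functional_on V R"
    and stat: "\<And>\<eta>. \<eta> \<in> V \<Longrightarrow> mean \<eta> = 0 \<Longrightarrow> L2_inner \<Omega> z \<eta> / \<tau> + R \<eta> = 0"
  obtains \<mu> where "\<mu> \<in> V" "\<And>\<eta>. \<eta> \<in> V \<Longrightarrow> L2_inner \<Omega> \<mu> \<eta> = R \<eta>"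
    "\<And>\<eta>. \<eta> \<in> V \<Longrightarrow> \<tau> * gip \<mu> \<eta> = - gip z \<eta>"
proof -
  obtain one where one: "one \<in> V" "\<And>x. x \<in> \<Omega> \<Longrightarrow> one x = 1" "\<And>s. L2_inner \<Omega> s one = mean s"
    "\<And>s. L2_inner \<Omega> one s = mean s" "mean one = measure (lebesgue_on \<Omega>) \<Omega>"
    using constant_one by blast
  let ?vol = "measure (lebesgue_on \<Omega>) \<Omega>"
  define c where "c = R one / ?vol"
  define \<mu> where "\<mu> = (\<lambda>x. (- 1 / \<tau>) * z x + c * one x)"
  show thesis
  proof (rule that)
    show \<mu>: "\<mu> \<in> V" unfolding \<mu>_def by (intro lincomb_closed z one)
    fix \<eta> assume \<eta>: "\<eta> \<in> V"
    \<comment> \<open>Subtracting the mean of \<eta> gives a direction allowed in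
      \<open>stat\<close>; linearity of R restores the constant part.\<close>
    define m where "m = mean \<eta> / ?vol"
    define \<eta>0 where "\<eta>0 = (\<lambda>x. 1 * \<eta> x + (- m) * one x)"
    have \<eta>0: "\<eta>0 \<in> V" unfolding \<eta>0_def by (intro lincomb_closed \<eta> one)
    have "mean \<eta>0 = 1 * mean \<eta> + (- m) * mean one"
      unfolding \<eta>0_def by (intro mean_lincomb V_L2 \<eta> one)
    then have mean0: "mean \<eta>0 = 0" using measure_pos by (simp add: m_def one(5))
    have R0: "R \<eta>0 = 1 * R \<eta> + (- m) * R one"
      unfolding \<eta>0_def by (rule linear_functional_onD[OF R \<eta> one(1)])
    have z0: "L2_inner \<Omega> z \<eta>0 = 1 * L2_inner \<Omega> z \<eta> + (- m) * L2_inner \<Omega> z one"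
      unfolding \<eta>0_def by (intro ip_lincomb_right V_L2 \<eta> one z)
    have "L2_inner \<Omega> \<mu> \<eta> = (- 1 / \<tau>) * L2_inner \<Omega> z \<eta> + c * L2_inner \<Omega> one \<eta>"
      using L2_inner_lincomb_left[OF V_L2[OF z(1)] V_L2[OF one(1)] V_L2[OF \<eta>], of "- 1 / \<tau>" c]
      by (simp add: \<mu>_def)
    also have "L2_inner \<Omega> z \<eta> = L2_inner \<Omega> z \<eta>0" using z0 by (simp add: one(3) z(2))
    also have "L2_inner \<Omega> z \<eta>0 = - \<tau> * R \<eta>0" using stat[OF \<eta>0 mean0] \<tau> by (simp add: field_simps)
    also have "(- 1 / \<tau>) * (- \<tau> * R \<eta>0) + c * L2_inner \<Omega> one \<eta> = R \<eta>"
      using \<tau> R0 by (simp add: one(4) c_def m_def)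
    finally show "L2_inner \<Omega> \<mu> \<eta> = R \<eta>" .
    have "gip \<mu> \<eta> = (- 1 / \<tau>) * gip z \<eta> + c * gip one \<eta>"
      unfolding \<mu>_def by (intro gip_lincomb_left z one \<eta>)
    then show "\<tau> * gip \<mu> \<eta> = - gip z \<eta>"
      using gip_constant(1)[OF one(1,2) \<eta>] \<tau> by simp
  qed
qed

text \<open>By the balance law z and \<open>- \<tau>\<close> times \<mu> have equal gradient
  products with all of V, so they should differ by a constant, which a mean-free \<eta> cannot see.
  The representative w of \<eta> expresses this without comparing the functions themselves.\<close>

lemma riesz_eq_multiplier:
  assumes y: "y > 0" and \<mu>: "\<mu> \<in> V" and z: "z \<in> V"
    and riesz: "\<And>l. l \<in> V \<Longrightarrow> y * gip z l = L2_inner \<Omega> s l"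
    and bal: "\<And>l. l \<in> V \<Longrightarrow> L2_inner \<Omega> s l + \<tau> * (y * gip \<mu> l) = 0"
    and \<eta>: "\<eta> \<in> V" "mean \<eta> = 0"
  shows "L2_inner \<Omega> z \<eta> = - \<tau> * L2_inner \<Omega> \<mu> \<eta>"
proof -
  obtain w where w: "w \<in> V" "\<And>l. l \<in> V \<Longrightarrow> y * gip w l = L2_inner \<Omega> \<eta> l"
    using riesz_mean_zero[OF y V_L2[OF \<eta>(1)] \<eta>(2)] by blast
  have "L2_inner \<Omega> z \<eta> = y * gip z w"
    using w(2)[OF z] by (simp only: L2_inner_commute[of \<Omega> "grad \<Omega> z"] L2_inner_commute[of \<Omega> z])
  also have "\<dots> = L2_inner \<Omega> s w" by (rule riesz[OF w(1)])
  also have "\<dots> = - \<tau> * (y * gip \<mu> w)" using bal[OF w(1)] by simp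
  also have "y * gip \<mu> w = L2_inner \<Omega> \<mu> \<eta>"
    using w(2)[OF \<mu>] by (simp only: L2_inner_commute[of \<Omega> "grad \<Omega> \<mu>"] L2_inner_commute[of \<Omega> \<mu>])
  finally show ?thesis .
qed

text \<open>Multiplied by \<tau>, the mean constraint becomes the compatibility condition under
  which \<open>riesz_mean_zero\<close> applies to the defect.\<close>

lemma affine_space_iff:
  assumes "\<tau> > 0" "v0 \<in> L2 \<Omega>" "r \<in> L2 \<Omega>"
  shows "v \<in> affine_space \<Omega> \<tau> V v0 r \<longleftrightarrow> v \<in> V \<and> mean (\<lambda>x. v x - v0 x - \<tau> * r x) = 0"
proof -
  have "mean (\<lambda>x. v x - v0 x - \<tau> * r x) = mean (\<lambda>x. v x - v0 x) - \<tau> * mean r" if "v \<in> V"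
    using L2_integrable[OF domain(3) V_L2[OF that]] L2_integrable[OF domain(3) assms(2)]
      L2_integrable[OF domain(3) assms(3)] by simp
  then show ?thesis
    using assms(1) by (auto simp: affine_space_def field_simps)
qed

end

section \<open>Quadratic energies\<close>

text \<open>The gradient, elastic and fluid energies all have this form, with W a curve that may be
  nonlinear in t. Symmetry of A cancels the factor 1/2 in the derivative. It also gives the
  factorisation \<open>a \<bullet> A a - b \<bullet> A b = (a - b) \<bullet> A (a + b)\<close>, so
  the increments are controlled by products of two L2 functions.\<close>

lemma quadratic_energy_derivative:
  fixes W :: "real \<Rightarrow> real^'d \<Rightarrow> 'b::euclidean_space" and A :: "real^'d \<Rightarrow> 'b \<Rightarrow> 'b"
  assumes W: "\<And>t. W t \<in> L2 \<Omega>" and W': "W' \<in> L2 \<Omega>" and k: "k \<in> L2 \<Omega>"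
    and lin: "\<And>x. linear (A x)" and sym: "\<And>x e f. e \<bullet> A x f = f \<bullet> A x e"
    and A_bound: "AE x in lebesgue_on \<Omega>. \<forall>e. norm (A x e) \<le> C * norm e"
    and A_meas: "\<And>f. f \<in> borel_measurable (lebesgue_on \<Omega>) \<Longrightarrow> (\<lambda>x. A x (f x)) \<in> borel_measurable (lebesgue_on \<Omega>)"
    and lip: "\<And>t. \<bar>t\<bar> \<le> 1 \<Longrightarrow> AE x in lebesgue_on \<Omega>. norm (W t x - W 0 x) \<le> \<bar>t\<bar> * \<bar>k x\<bar>"
    and deriv: "AE x in lebesgue_on \<Omega>. ((\<lambda>t. W t x) has_vector_derivative W' x) (at 0)"
  shows "\<And>t. integrable (lebesgue_on \<Omega>) (\<lambda>x. (1/2) * (W t x \<bullet> A x (W t x)))"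
    "((\<lambda>t. LINT x|lebesgue_on \<Omega>. (1/2) * (W t x \<bullet> A x (W t x))) has_real_derivative
      (LINT x|lebesgue_on \<Omega>. W' x \<bullet> A x (W 0 x))) (at 0)"
proof -
  have AW: "(\<lambda>x. A x (f x)) \<in> L2 \<Omega>" if "f \<in> L2 \<Omega>" for f
    using A_bound by (intro L2_dominated[OF that] A_meas L2_D(1)[OF that]) (auto elim: AE_mp)
  show int: "integrable (lebesgue_on \<Omega>) (\<lambda>x. (1/2) * (W t x \<bullet> A x (W t x)))" for t
    by (intro integrable_mult_right L2_integrable_inner W AW)
  \<comment> \<open>For increments of size at most 1 the difference of the two values of W is at
    most \<bar>t\<bar> times \<bar>k\<bar>, and their sum is at most \<open>2 * norm (W 0 x)\<close>
    plus \<bar>k\<bar> in norm.\<close>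
  let ?D = "\<lambda>x. (1/2) * (\<bar>C\<bar> * (2 * (norm (k x) * norm (W 0 x)) + norm (k x) * norm (k x)))"
  show "((\<lambda>t. LINT x|lebesgue_on \<Omega>. (1/2) * (W t x \<bullet> A x (W t x))) has_real_derivative
      (LINT x|lebesgue_on \<Omega>. W' x \<bullet> A x (W 0 x))) (at 0)"
  proof (rule has_real_derivative_integral(2)[OF int])
    show "integrable (lebesgue_on \<Omega>) ?D"
      by (intro integrable_mult_right Bochner_Integration.integrable_add L2_integrable_mult_norm k W)
    show "(\<lambda>x. W' x \<bullet> A x (W 0 x)) \<in> borel_measurable (lebesgue_on \<Omega>)"
      by (intro borel_measurable_inner A_meas L2_D(1)[OF W'] L2_D(1)[OF W])
    show "AE x in lebesgue_on \<Omega>. ((\<lambda>t. (1/2) * (W t x \<bullet> A x (W t x))) has_real_derivative W' x \<bullet> A x (W 0 x)) (at 0)"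
      using deriv
    proof eventually_elim
      case (elim x)
      then have d: "((\<lambda>t. W t x) has_derivative (\<lambda>h. h *\<^sub>R W' x)) (at 0)"
        by (simp add: has_vector_derivative_def)
      have bl: "bounded_linear (A x)" using lin by (simp add: linear_conv_bounded_linear)
      have dA: "((\<lambda>t. A x (W t x)) has_derivative (\<lambda>h. A x (h *\<^sub>R W' x))) (at 0)"
        by (rule bounded_linear.has_derivative[OF bl d])
      have "((\<lambda>t. (1/2) * (W t x \<bullet> A x (W t x))) has_derivative
          (\<lambda>h. (1/2) * (W 0 x \<bullet> A x (h *\<^sub>R W' x) + (h *\<^sub>R W' x) \<bullet> A x (W 0 x)))) (at 0)"
        by (intro has_derivative_mult_right has_derivative_inner d dA)
      then show ?case
        unfolding has_field_derivative_def
        by (rule has_derivative_eq_rhs)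
          (simp add: fun_eq_iff sym[of "W 0 x"] linear_cmul[OF lin] mult.commute)
    qed
    fix t :: real assume "\<bar>t - 0\<bar> \<le> 1"
    then have t: "\<bar>t\<bar> \<le> 1" by simp
    show "AE x in lebesgue_on \<Omega>. \<bar>(1/2) * (W t x \<bullet> A x (W t x)) - (1/2) * (W 0 x \<bullet> A x (W 0 x))\<bar> \<le> \<bar>t - 0\<bar> * ?D x"
      using lip[OF t] A_bound
    proof eventually_elim
      case (elim x)
      let ?a = "W t x" and ?b = "W 0 x"
      have "?a \<bullet> A x ?a - ?b \<bullet> A x ?b = (?a - ?b) \<bullet> A x (?a + ?b)"
        using sym[where e = ?a and f = ?b and x = x]
        by (simp add: linear_add[OF lin] inner_diff_left inner_add_right)
      also have "\<bar>\<dots>\<bar> \<le> norm (?a - ?b) * norm (A x (?a + ?b))"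
        by (rule Cauchy_Schwarz_ineq2)
      also have "\<dots> \<le> (\<bar>t\<bar> * \<bar>k x\<bar>) * (\<bar>C\<bar> * (2 * norm ?b + \<bar>k x\<bar>))"
      proof (rule mult_mono)
        have "norm (A x (?a + ?b)) \<le> C * norm (?a + ?b)" using elim by blast
        also have "\<dots> \<le> \<bar>C\<bar> * norm (?a + ?b)" by (intro mult_right_mono) auto
        also have "\<dots> \<le> \<bar>C\<bar> * (2 * norm ?b + \<bar>k x\<bar>)"
        proof (intro mult_left_mono)
          have "norm (?a + ?b) \<le> norm (?a - ?b) + norm (2 *\<^sub>R ?b)"
            using norm_triangle_ineq[of "?a - ?b" "2 *\<^sub>R ?b"] by (simp add: scaleR_2)
          moreover have "\<bar>t\<bar> * \<bar>k x\<bar> \<le> \<bar>k x\<bar>" using t by (simp add: mult_left_le_one_le)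
          ultimately show "norm (?a + ?b) \<le> 2 * norm ?b + \<bar>k x\<bar>" using elim by simp
        qed simp
        finally show "norm (A x (?a + ?b)) \<le> \<bar>C\<bar> * (2 * norm ?b + \<bar>k x\<bar>)" .
      qed (use elim in auto)
      finally have "(1/2) * \<bar>?a \<bullet> A x ?a - ?b \<bullet> A x ?b\<bar>
          \<le> (1/2) * ((\<bar>t\<bar> * \<bar>k x\<bar>) * (\<bar>C\<bar> * (2 * norm ?b + \<bar>k x\<bar>)))"
        by (rule mult_left_mono) simp
      moreover have "\<bar>(1/2) * (?a \<bullet> A x ?a) - (1/2) * (?b \<bullet> A x ?b)\<bar> = (1/2) * \<bar>?a \<bullet> A x ?a - ?b \<bullet> A x ?b\<bar>"
        by (simp add: abs_if field_simps)
      ultimately show ?case by (simp add: algebra_simps)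
    qed
  qed
qed

section \<open>Coefficient functions\<close>

lemma lipschitz_compose_L2:
  fixes f :: "real \<Rightarrow> 'b::euclidean_space"
  assumes \<Omega>: "\<Omega> \<in> lmeasurable" and f: "L-lipschitz_on UNIV f" and g: "g \<in> L2 \<Omega>"
  shows "(\<lambda>x. f (g x)) \<in> L2 \<Omega>"
proof (rule L2_dominated)
  interpret finite_measure "lebesgue_on \<Omega>" using \<Omega> by (rule finite_measure_lebesgue_on)
  have "(\<lambda>x. \<bar>g x\<bar>) \<in> L2 \<Omega>" using g by (rule L2_dominated[where K = 1]) (use L2_D(1)[OF g] in auto)
  moreover have "(\<lambda>x. norm (f 0)) \<in> L2 \<Omega>" by (simp add: L2_def)
  ultimately show "(\<lambda>x. L *\<^sub>R \<bar>g x\<bar> + 1 *\<^sub>R norm (f 0)) \<in> L2 \<Omega>" by (intro L2_lincomb)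
  show "(\<lambda>x. f (g x)) \<in> borel_measurable (lebesgue_on \<Omega>)"
    by (rule borel_measurable_continuous_on[OF lipschitz_on_continuous_on[OF f] L2_D(1)[OF g]])
  have "norm (f s) \<le> norm (L * \<bar>s\<bar> + norm (f 0))" for s
  proof -
    have "norm (f s - f 0) \<le> L * \<bar>s\<bar>"
      using lipschitz_onD[OF f, of s 0] by (simp add: dist_norm)
    moreover have "norm (f s) \<le> norm (f s - f 0) + norm (f 0)"
      using norm_triangle_ineq[of "f s - f 0" "f 0"] by simp
    ultimately show ?thesis by simp
  qed
  then show "AE x in lebesgue_on \<Omega>. norm (f (g x)) \<le> 1 * norm (L *\<^sub>R \<bar>g x\<bar> + 1 *\<^sub>R norm (f 0))" by simp
qed

lemma vector_derivative_tendsto: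
  fixes f :: "real \<Rightarrow> 'b::real_normed_vector"
  assumes "f differentiable (at s)"
  shows "((\<lambda>h. (f (s + h) - f s) /\<^sub>R h) \<longlongrightarrow> vector_derivative f (at s)) (at 0)"
proof -
  let ?D = "vector_derivative f (at s)"
  have "(f has_vector_derivative ?D) (at s)"
    using assms vector_derivative_works by blast
  then have "((\<lambda>h. norm (f (s + h) - f s - h *\<^sub>R ?D) / norm h) \<longlongrightarrow> 0) (at 0)"
    by (simp add: has_vector_derivative_def has_derivative_at)
  moreover have "norm (f (s + h) - f s - h *\<^sub>R ?D) / norm h = norm ((f (s + h) - f s) /\<^sub>R h - ?D)"
    if "h \<noteq> 0" for h
  proof -
    have "(f (s + h) - f s) /\<^sub>R h - ?D = (f (s + h) - f s - h *\<^sub>R ?D) /\<^sub>R h"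
      using that by (simp add: scaleR_diff_right)
    then show "norm (f (s + h) - f s - h *\<^sub>R ?D) / norm h = norm ((f (s + h) - f s) /\<^sub>R h - ?D)"
      by (simp only: norm_scaleR) (simp add: divide_inverse mult.commute)
  qed
  ultimately have "((\<lambda>h. norm ((f (s + h) - f s) /\<^sub>R h - ?D)) \<longlongrightarrow> 0) (at 0)"
    by (auto elim!: Lim_transform_eventually simp: eventually_at_filter)
  then have "((\<lambda>h. (f (s + h) - f s) /\<^sub>R h - ?D) \<longlongrightarrow> 0) (at 0)"
    by (rule tendsto_norm_zero_cancel)
  then show ?thesis by (rule LIM_zero_cancel)
qed

text \<open>The derivative may be discontinuous, but it is a pointwise limit of difference
  quotients, which are continuous.\<close>

lemma borel_measurable_vector_derivative:
  fixes f :: "real \<Rightarrow> 'b::euclidean_space"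
  assumes f: "\<And>s. f differentiable (at s)"
  shows "(\<lambda>s. vector_derivative f (at s)) \<in> borel_measurable borel"
proof (rule borel_measurable_LIMSEQ_metric)
  have cont: "continuous_on UNIV f"
    using f differentiable_imp_continuous_within by (auto simp: continuous_on_eq_continuous_within)
  show "(\<lambda>s. (f (s + inverse (real (Suc n))) - f s) /\<^sub>R inverse (real (Suc n))) \<in> borel_measurable borel" for n
    by (intro borel_measurable_continuous_onI continuous_intros continuous_on_compose2[OF cont]) auto
  fix s :: real
  have "filterlim (\<lambda>n. inverse (real (Suc n))) (at 0) sequentially"
    using LIMSEQ_inverse_real_of_nat by (simp add: filterlim_at)
  then show "(\<lambda>n. (f (s + inverse (real (Suc n))) - f s) /\<^sub>R inverse (real (Suc n)))
      \<longlonglongrightarrow> vector_derivative f (at s)"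
    by (rule filterlim_compose[OF vector_derivative_tendsto[OF f]])
qed

lemma vector_derivative_bound_lipschitz:
  fixes f :: "real \<Rightarrow> 'b::real_normed_vector"
  assumes f: "f differentiable (at s)" and L: "L-lipschitz_on UNIV f"
  shows "norm (vector_derivative f (at s)) \<le> L"
proof (rule tendsto_upperbound[OF tendsto_norm[OF vector_derivative_tendsto[OF f]]])
  have "norm ((f (s + h) - f s) /\<^sub>R h) \<le> L" if h: "h \<noteq> 0" for h
  proof -
    have "norm (f (s + h) - f s) \<le> L * \<bar>h\<bar>"
      using lipschitz_onD[OF L, of "s + h" s] by (simp add: dist_norm)
    then show "norm ((f (s + h) - f s) /\<^sub>R h) \<le> L"
      using h by (simp only: norm_scaleR) (simp add: field_simps)
  qed
  then show "\<forall>\<^sub>F h in at 0. norm ((f (s + h) - f s) /\<^sub>R h) \<le> L"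
    by (simp add: eventually_at_filter)
qed simp

lemma deriv_eq_vector_derivative:
  fixes f :: "real \<Rightarrow> real"
  assumes "f differentiable (at s)"
  shows "deriv f s = vector_derivative f (at s)"
proof -
  have "(f has_vector_derivative vector_derivative f (at s)) (at s)"
    using assms vector_derivative_works by blast
  then show ?thesis
    by (intro DERIV_imp_deriv) (simp add: has_real_derivative_iff_has_vector_derivative)
qed

text \<open>The tangent at s lies below f at \<open>s + 1\<close> and at \<open>s - 1\<close>, so
  the slope is bounded by the oscillation of f on the enlarged interval. In this way convexity
  replaces a Lipschitz condition, which is assumed for the derivative of \<open>Psi_c\<close> but
  not for that of \<open>Psi_e\<close>.\<close>

lemma convex_deriv_bounded:
  fixes f :: "real \<Rightarrow> real"
  assumes f: "convex_on UNIV f" and d: "\<And>s. f differentiable (at s)"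
  obtains K where "\<And>s. \<bar>s\<bar> \<le> R \<Longrightarrow> \<bar>deriv f s\<bar> \<le> K"
proof -
  have cont: "continuous_on UNIV f"
    using d differentiable_imp_continuous_within by (auto simp: continuous_on_eq_continuous_within)
  have "bounded (f ` {- R - 1..R + 1})"
    by (intro compact_imp_bounded compact_continuous_image continuous_on_subset[OF cont]) auto
  then have "\<exists>K. \<forall>s\<in>{- R - 1..R + 1}. \<bar>f s\<bar> \<le> K"
    by (simp add: bounded_iff)
  then obtain K where K: "\<And>s. s \<in> {- R - 1..R + 1} \<Longrightarrow> \<bar>f s\<bar> \<le> K" by blast
  have "\<bar>deriv f s\<bar> \<le> 2 * K" if "\<bar>s\<bar> \<le> R" for s
  proof -
    have "(f has_real_derivative deriv f s) (at s)"
      using d[of s] by (simp add: DERIV_deriv_iff_real_differentiable)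
    then have tangent: "f y - f s \<ge> deriv f s * (y - s)" for y
      using convex_on_imp_above_tangent[OF f, where c = s and x = y and f' = "deriv f s"] by simp
    have "\<bar>f (s + 1)\<bar> \<le> K" "\<bar>f (s - 1)\<bar> \<le> K" "\<bar>f s\<bar> \<le> K" using that by (auto intro!: K)
    then show ?thesis using tangent[of "s + 1"] tangent[of "s - 1"] by simp
  qed
  then show thesis by (rule that)
qed

lemma linear_compose_L2:
  fixes f :: "'b::euclidean_space \<Rightarrow> 'c::euclidean_space"
  assumes f: "linear f" and g: "g \<in> L2 \<Omega>"
  shows "(\<lambda>x. f (g x)) \<in> L2 \<Omega>"
proof -
  have bl: "bounded_linear f" using f by (simp add: linear_conv_bounded_linear)
  then obtain K where K: "\<And>x. norm (f x) \<le> norm x * K" using bounded_linear.bounded by blast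
  have "(\<lambda>x. f (g x)) \<in> borel_measurable (lebesgue_on \<Omega>)"
    by (rule borel_measurable_continuous_on[OF linear_continuous_on[OF bl] L2_D(1)[OF g]])
  then show ?thesis
    by (rule L2_dominated[OF g, where K = K]) (use K in \<open>auto simp: mult.commute\<close>)
qed

lemma vec_L2:
  fixes f :: "real^'d \<Rightarrow> 'b::euclidean_space^'n"
  assumes f: "\<And>i. (\<lambda>x. f x $ i) \<in> L2 \<Omega>"
  shows "f \<in> L2 \<Omega>"
proof -
  have "f \<in> borel_measurable (lebesgue_on \<Omega>)"
  proof (subst borel_measurable_euclidean_space, intro ballI)
    fix b :: "'b^'n" assume "b \<in> Basis"
    then obtain i c where b: "b = axis i c" "c \<in> Basis" by (auto simp: Basis_vec_def)
    show "(\<lambda>x. f x \<bullet> b) \<in> borel_measurable (lebesgue_on \<Omega>)"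
      unfolding b(1) inner_axis using L2_D(1)[OF f] by (intro borel_measurable_inner) auto
  qed
  moreover have "(norm (f x))\<^sup>2 = (\<Sum>i\<in>UNIV. (norm (f x $ i))\<^sup>2)" for x
    by (simp add: power2_norm_eq_inner inner_vec_def)
  ultimately show ?thesis
    using L2_D(2)[OF f] by (simp add: L2_def)
qed

lemma bilinear_contract: "bilinear (contract :: real^'d^'d^'d^'d \<Rightarrow> real^'d^'d \<Rightarrow> real^'d^'d)"
  unfolding bilinear_def contract_def
  by (auto intro!: linearI simp: vec_eq_iff algebra_simps sum.distrib sum_distrib_left)

text \<open>This is the major symmetry of the tensor; adjacent sums are swapped until the index pair
  k, l stands in front of i, j.\<close>

lemma contract_symmetric:
  fixes \<C> :: "real^'d^'d^'d^'d"
  assumes "elastic_symmetries \<C>"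
  shows "e \<bullet> contract \<C> f = f \<bullet> contract \<C> e"
proof -
  have \<C>: "\<C> $ i $ j $ k $ l = \<C> $ k $ l $ i $ j" for i j k l
    using assms unfolding elastic_symmetries_def by blast
  have "e \<bullet> contract \<C> f = (\<Sum>i\<in>UNIV. \<Sum>j\<in>UNIV. \<Sum>k\<in>UNIV. \<Sum>l\<in>UNIV. \<C> $ i $ j $ k $ l * e $ i $ j * f $ k $ l)"
    by (simp add: inner_vec_def contract_def sum_distrib_left ac_simps)
  also have "\<dots> = (\<Sum>i\<in>UNIV. \<Sum>k\<in>UNIV. \<Sum>j\<in>UNIV. \<Sum>l\<in>UNIV. \<C> $ i $ j $ k $ l * e $ i $ j * f $ k $ l)"
    by (intro sum.cong refl sum.swap)
  also have "\<dots> = (\<Sum>k\<in>UNIV. \<Sum>i\<in>UNIV. \<Sum>j\<in>UNIV. \<Sum>l\<in>UNIV. \<C> $ i $ j $ k $ l * e $ i $ j * f $ k $ l)"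
    by (rule sum.swap)
  also have "\<dots> = (\<Sum>k\<in>UNIV. \<Sum>i\<in>UNIV. \<Sum>l\<in>UNIV. \<Sum>j\<in>UNIV. \<C> $ i $ j $ k $ l * e $ i $ j * f $ k $ l)"
    by (intro sum.cong refl sum.swap)
  also have "\<dots> = (\<Sum>k\<in>UNIV. \<Sum>l\<in>UNIV. \<Sum>i\<in>UNIV. \<Sum>j\<in>UNIV. \<C> $ i $ j $ k $ l * e $ i $ j * f $ k $ l)"
    by (intro sum.cong refl sum.swap)
  also have "\<dots> = (\<Sum>k\<in>UNIV. \<Sum>l\<in>UNIV. \<Sum>i\<in>UNIV. \<Sum>j\<in>UNIV. \<C> $ k $ l $ i $ j * f $ k $ l * e $ i $ j)"
    by (intro sum.cong refl) (subst \<C>, simp)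
  also have "\<dots> = f \<bullet> contract \<C> e"
    by (simp add: inner_vec_def contract_def sum_distrib_left ac_simps)
  finally show ?thesis .
qed

text \<open>E is the field formed with the chosen gradients of the moved functions, W the explicit
  curve. They agree off a null set that varies with t: the integrals are equal for each t, whereas a
  pointwise derivative is available for W.\<close>

lemma quadratic_energy_derivative_AE:
  fixes W :: "real \<Rightarrow> real^'d \<Rightarrow> 'b::euclidean_space" and A :: "real^'d \<Rightarrow> 'b \<Rightarrow> 'b"
  assumes E: "\<And>t. E t \<in> L2 \<Omega>" "\<And>t. AE x in lebesgue_on \<Omega>. E t x = W t x"
    and W: "\<And>t. W t \<in> L2 \<Omega>" and W': "W' \<in> L2 \<Omega>" and k: "k \<in> L2 \<Omega>"
    and lin: "\<And>x. linear (A x)" and sym: "\<And>x e f. e \<bullet> A x f = f \<bullet> A x e"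
    and A_bound: "AE x in lebesgue_on \<Omega>. \<forall>e. norm (A x e) \<le> C * norm e"
    and A_meas: "\<And>f. f \<in> borel_measurable (lebesgue_on \<Omega>) \<Longrightarrow> (\<lambda>x. A x (f x)) \<in> borel_measurable (lebesgue_on \<Omega>)"
    and lip: "\<And>t. \<bar>t\<bar> \<le> 1 \<Longrightarrow> AE x in lebesgue_on \<Omega>. norm (W t x - W 0 x) \<le> \<bar>t\<bar> * \<bar>k x\<bar>"
    and deriv: "AE x in lebesgue_on \<Omega>. ((\<lambda>t. W t x) has_vector_derivative W' x) (at 0)"
  shows "((\<lambda>t. LINT x|lebesgue_on \<Omega>. (1/2) * (E t x \<bullet> A x (E t x))) has_real_derivative
      (LINT x|lebesgue_on \<Omega>. W' x \<bullet> A x (W 0 x))) (at 0)"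
proof -
  have "(LINT x|lebesgue_on \<Omega>. (1/2) * (E t x \<bullet> A x (E t x))) = (LINT x|lebesgue_on \<Omega>. (1/2) * (W t x \<bullet> A x (W t x)))" for t
  proof (rule integral_cong_AE)
    show "(\<lambda>x. (1/2) * (E t x \<bullet> A x (E t x))) \<in> borel_measurable (lebesgue_on \<Omega>)"
      by (intro borel_measurable_times borel_measurable_const borel_measurable_inner A_meas L2_D(1)[OF E(1)])
    show "(\<lambda>x. (1/2) * (W t x \<bullet> A x (W t x))) \<in> borel_measurable (lebesgue_on \<Omega>)"
      by (intro borel_measurable_times borel_measurable_const borel_measurable_inner A_meas L2_D(1)[OF W])
    show "AE x in lebesgue_on \<Omega>. (1/2) * (E t x \<bullet> A x (E t x)) = (1/2) * (W t x \<bullet> A x (W t x))"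
      using E(2)[of t] by eventually_elim simp
  qed
  then show ?thesis
    using quadratic_energy_derivative(2)[OF W W' k lin sym A_bound A_meas lip deriv] by simp
qed

lemma integrable_mult_bounded:
  fixes g \<eta> :: "'a \<Rightarrow> real"
  assumes g: "integrable M g" and \<eta>: "\<eta> \<in> borel_measurable M" "AE x in M. \<bar>\<eta> x\<bar> \<le> B"
  shows "integrable M (\<lambda>x. g x * \<eta> x)"
proof (rule Bochner_Integration.integrable_bound)
  show "integrable M (\<lambda>x. B * g x)" using g by simp
  show "(\<lambda>x. g x * \<eta> x) \<in> borel_measurable M" using g \<eta> by (intro borel_measurable_times) auto
  show "AE x in M. norm (g x * \<eta> x) \<le> norm (B * g x)"
    using \<eta>(2)
  proof eventually_elim
    case (elim x)
    then have "\<bar>g x\<bar> * \<bar>\<eta> x\<bar> \<le> \<bar>g x\<bar> * \<bar>B\<bar>" by (intro mult_left_mono) auto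
    then show ?case by (simp add: abs_mult mult.commute)
  qed
qed

lemma lipschitz_measurable: "L-lipschitz_on UNIV (f :: real \<Rightarrow> 'b::euclidean_space) \<Longrightarrow> f \<in> borel_measurable borel"
  by (intro borel_measurable_continuous_onI lipschitz_on_continuous_on)

lemma deriv_measurable:
  fixes f :: "real \<Rightarrow> real"
  assumes "\<And>s. f differentiable (at s)"
  shows "deriv f \<in> borel_measurable borel"
proof -
  have "deriv f = (\<lambda>s. vector_derivative f (at s))"
    using deriv_eq_vector_derivative[OF assms] by (simp add: fun_eq_iff)
  then show ?thesis using borel_measurable_vector_derivative[OF assms] by simp
qed

lemma deriv_lipschitz_bound:
  fixes f :: "real \<Rightarrow> real"
  assumes "f differentiable (at s)" "L-lipschitz_on UNIV f"
  shows "\<bar>deriv f s\<bar> \<le> L"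
  using vector_derivative_bound_lipschitz[OF assms] deriv_eq_vector_derivative[OF assms(1)] by simp

text \<open>Convexity bounds every forward difference quotient on the unit interval by the slope of
  the chord, and the right-hand limit of these quotients is the derivative.\<close>

lemma tangent_le_chord:
  fixes g :: "real \<Rightarrow> real"
  assumes D: "(g has_real_derivative G) (at 0)"
    and conv: "\<And>t. 0 \<le> t \<Longrightarrow> t \<le> 1 \<Longrightarrow> g t \<le> (1 - t) * g 0 + t * g 1"
  shows "G \<le> g 1 - g 0"
proof (rule tendsto_upperbound)
  have "((\<lambda>h. (g (0 + h) - g 0) / h) \<longlongrightarrow> G) (at 0)" using D by (simp add: DERIV_def)
  then show "((\<lambda>h. (g h - g 0) / h) \<longlongrightarrow> G) (at_right 0)"
    using filterlim_at_split by auto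
  have "(g h - g 0) / h \<le> g 1 - g 0" if "0 < h" "h < 1" for h
  proof -
    have "g h - g 0 \<le> (g 1 - g 0) * h" using conv[of h] that by (simp add: algebra_simps)
    then show ?thesis using that by (simp add: divide_le_eq)
  qed
  then show "\<forall>\<^sub>F h in at_right 0. (g h - g 0) / h \<le> g 1 - g 0"
    by (auto simp: eventually_at_right_field intro!: exI[of _ 1])
qed simp

lemma bounded_bilinear_contract: "bounded_bilinear (contract :: real^'d^'d^'d^'d \<Rightarrow> _)"
  using bilinear_contract by (simp add: bilinear_conv_bounded_bilinear)

lemma contract_measurable:
  fixes c :: "'a \<Rightarrow> real^'d^'d^'d^'d"
  assumes "c \<in> borel_measurable M" "f \<in> borel_measurable M"
  shows "(\<lambda>x. contract (c x) (f x)) \<in> borel_measurable M"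
proof -
  have "continuous_on UNIV (\<lambda>z. contract (fst z :: real^'d^'d^'d^'d) (snd z))"
    by (intro bounded_bilinear.continuous_on[OF bounded_bilinear_contract] continuous_intros)
  then show ?thesis using borel_measurable_continuous_Pair[OF assms] by blast
qed

lemma contract_bounded:
  fixes c :: "'a \<Rightarrow> real^'d^'d^'d^'d"
  assumes "AE x in M. norm (c x) \<le> B"
  obtains K where "AE x in M. \<forall>e. norm (contract (c x) e) \<le> K * norm e"
proof -
  obtain K where K: "K > 0" "\<And>C e. norm (contract (C :: real^'d^'d^'d^'d) e) \<le> norm C * norm e * K"
    using bounded_bilinear.pos_bounded[OF bounded_bilinear_contract] by blast
  have "AE x in M. \<forall>e. norm (contract (c x) e) \<le> (B * K) * norm e"
    using assms
  proof eventually_elim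
    case (elim x)
    show ?case
    proof
      fix e
      have "norm (contract (c x) e) \<le> norm (c x) * (norm e * K)" using K(2)[of "c x" e] by (simp add: mult.assoc)
      also have "\<dots> \<le> B * (norm e * K)" using elim K(1) by (intro mult_right_mono) auto
      finally show "norm (contract (c x) e) \<le> (B * K) * norm e" by (simp add: ac_simps)
    qed
  qed
  then show thesis by (rule that)
qed

lemma contract_L2:
  fixes c :: "real^'d \<Rightarrow> real^'d^'d^'d^'d"
  assumes c: "c \<in> borel_measurable (lebesgue_on \<Omega>)" "AE x in lebesgue_on \<Omega>. norm (c x) \<le> B"
    and f: "f \<in> L2 \<Omega>"
  shows "(\<lambda>x. contract (c x) (f x)) \<in> L2 \<Omega>"
proof -
  obtain K where K: "AE x in lebesgue_on \<Omega>. \<forall>e. norm (contract (c x) e) \<le> K * norm e"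
    by (rule contract_bounded[OF c(2)])
  show ?thesis
    by (rule L2_dominated[OF f contract_measurable[OF c(1) L2_D(1)[OF f]]])
      (use K in \<open>auto elim: AE_mp\<close>)
qed

section \<open>Strain and divergence\<close>

definition H1_vec :: "(real^'d) set \<Rightarrow> (real^'d \<Rightarrow> real^'d) set" where
  "H1_vec \<Omega> = {u. \<forall>i. (\<lambda>x. u x $ i) \<in> H1 \<Omega>}"

lemma H1_vec_L2: "u \<in> H1_vec \<Omega> \<Longrightarrow> u \<in> L2 \<Omega>"
  by (rule vec_L2) (simp add: H1_vec_def H1_D)

lemma jacobian_L2: "u \<in> H1_vec \<Omega> \<Longrightarrow> jacobian \<Omega> u \<in> L2 \<Omega>"
  by (rule vec_L2) (simp add: jacobian_def H1_vec_def H1_D)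

lemma jacobian_lincomb:
  assumes \<Omega>: "open \<Omega>" "\<Omega> \<in> lmeasurable" and u: "u \<in> H1_vec \<Omega>" and v: "v \<in> H1_vec \<Omega>"
  shows "AE x in lebesgue_on \<Omega>.
    jacobian \<Omega> (\<lambda>x. a *\<^sub>R u x + b *\<^sub>R v x) x = a *\<^sub>R jacobian \<Omega> u x + b *\<^sub>R jacobian \<Omega> v x"
proof -
  have "AE x in lebesgue_on \<Omega>. grad \<Omega> (\<lambda>x. (a *\<^sub>R u x + b *\<^sub>R v x) $ i) x
      = a *\<^sub>R grad \<Omega> (\<lambda>x. u x $ i) x + b *\<^sub>R grad \<Omega> (\<lambda>x. v x $ i) x" for i
    using u v by (intro grad_lincomb \<Omega>) (auto simp: H1_vec_def)
  then have "AE x in lebesgue_on \<Omega>. \<forall>i\<in>UNIV. grad \<Omega> (\<lambda>x. (a *\<^sub>R u x + b *\<^sub>R v x) $ i) x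
      = a *\<^sub>R grad \<Omega> (\<lambda>x. u x $ i) x + b *\<^sub>R grad \<Omega> (\<lambda>x. v x $ i) x"
    by (intro AE_finite_allI) auto
  then show ?thesis
    by eventually_elim (simp add: jacobian_def vec_eq_iff)
qed

lemma linear_symmetric_part: "linear (\<lambda>A :: real^'d^'d. (1/2) *\<^sub>R (A + transpose A))"
  by (rule linearI) (simp_all add: vec_eq_iff transpose_def algebra_simps)

lemma linear_trace: "linear (trace :: real^'d^'d \<Rightarrow> real)"
  by (rule linearI) (simp_all add: trace_def sum.distrib sum_distrib_left)

lemma strain_L2: "u \<in> H1_vec \<Omega> \<Longrightarrow> strain \<Omega> u \<in> L2 \<Omega>"
  using linear_compose_L2[OF linear_symmetric_part jacobian_L2] by (simp add: strain_def[abs_def])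

lemma divergence_L2: "u \<in> H1_vec \<Omega> \<Longrightarrow> divergence \<Omega> u \<in> L2 \<Omega>"
  using linear_compose_L2[OF linear_trace jacobian_L2] by (simp add: divergence_def[abs_def])

lemma strain_lincomb:
  assumes "open \<Omega>" "\<Omega> \<in> lmeasurable" "u \<in> H1_vec \<Omega>" "v \<in> H1_vec \<Omega>"
  shows "AE x in lebesgue_on \<Omega>.
    strain \<Omega> (\<lambda>x. a *\<^sub>R u x + b *\<^sub>R v x) x = a *\<^sub>R strain \<Omega> u x + b *\<^sub>R strain \<Omega> v x"
  using jacobian_lincomb[OF assms, of a b]
proof eventually_elim
  case (elim x)
  show ?case
    unfolding strain_def elim linear_add[OF linear_symmetric_part] linear_cmul[OF linear_symmetric_part]
    by (rule refl)
qed

lemma divergence_lincomb: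
  assumes "open \<Omega>" "\<Omega> \<in> lmeasurable" "u \<in> H1_vec \<Omega>" "v \<in> H1_vec \<Omega>"
  shows "AE x in lebesgue_on \<Omega>.
    divergence \<Omega> (\<lambda>x. a *\<^sub>R u x + b *\<^sub>R v x) x = a * divergence \<Omega> u x + b * divergence \<Omega> v x"
  using jacobian_lincomb[OF assms, of a b]
proof eventually_elim
  case (elim x)
  then show ?case
    unfolding divergence_def elim by (simp add: linear_add[OF linear_trace] linear_cmul[OF linear_trace])
qed

section \<open>The energy and its first variation\<close>

text \<open>Collects what the variational argument draws from the assumptions. The Lipschitz and
  upper bounds are parameters so that they can occur in dominating functions, and the mesh survives
  as \<open>V_ch_bounded\<close>.\<close>

locale chb =
  fixes P :: "('d::finite) chb_model" and S :: "'d chb_step" and LM L\<alpha> LC LT CM :: real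
  assumes constants: "gam P > 0" "ell P > 0" "mob P > 0" "kap P > 0" "tau S > 0"
    and Psi_c: "convex_on UNIV (Psi_c P)" "\<And>s. Psi_c P differentiable (at s)"
    and Psi_e: "convex_on UNIV (Psi_e P)" "\<And>s. Psi_e P differentiable (at s)"
    and Biot_M: "LM-lipschitz_on UNIV (Biot_M P)" "\<And>s. Biot_M P differentiable (at s)" "\<And>s. \<bar>Biot_M P s\<bar> \<le> CM"
    and Biot_alpha: "L\<alpha>-lipschitz_on UNIV (Biot_alpha P)" "\<And>s. Biot_alpha P differentiable (at s)"
      "\<And>s. \<bar>Biot_alpha P s\<bar> \<le> 1"
    and stiff: "LC-lipschitz_on UNIV (stiff P)" "\<And>s. stiff P differentiable (at s)"
      "\<And>s. elastic_symmetries (stiff P s)"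
    and eigen: "LT-lipschitz_on UNIV (eigen P)" "\<And>s. eigen P differentiable (at s)"
    and sources: "src_R P \<in> L2 (Omega P)" "src_S P \<in> L2 (Omega P)" "load P \<in> L2 (Omega P)"
    and space_ch: "scalar_space (Omega P) (V_ch S)" and space_f: "scalar_space (Omega P) (V_f S)"
    and V_ch_bounded: "\<And>v. v \<in> V_ch S \<Longrightarrow> \<exists>B. AE x in lebesgue_on (Omega P). \<bar>v x\<bar> \<le> B"
    and V_u: "V_u S \<subseteq> H1_vec (Omega P)" "V_u S \<noteq> {}"
      "\<And>u v a b. u \<in> V_u S \<Longrightarrow> v \<in> V_u S \<Longrightarrow> (\<lambda>x. a *\<^sub>R u x + b *\<^sub>R v x) \<in> V_u S"
    and previous: "phi0 S \<in> V_ch S" "u0 S \<in> V_u S" "theta0 S \<in> V_f S"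
begin

abbreviation \<Omega> where "\<Omega> \<equiv> Omega P"
abbreviation dx where "dx \<equiv> lebesgue_on (Omega P)"

sublocale ch: scalar_space "Omega P" "V_ch S" by (rule space_ch)
sublocale fl: scalar_space "Omega P" "V_f S" by (rule space_f)

sublocale finite_measure "lebesgue_on (Omega P)"
  using ch.domain(3) by (rule finite_measure_lebesgue_on)

section \<open>Integrability of the coefficients and energy densities\<close>

lemma V_u_H1: "u \<in> V_u S \<Longrightarrow> u \<in> H1_vec \<Omega>"
  using V_u(1) by blast

lemma ch_measurable: "v \<in> V_ch S \<Longrightarrow> v \<in> borel_measurable dx"
  by (rule L2_D(1)[OF ch.V_L2])

lemma compose_measurable:
  fixes f :: "real \<Rightarrow> 'b::euclidean_space"
  assumes "f \<in> borel_measurable borel" "v \<in> V_ch S"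
  shows "(\<lambda>x. f (v x)) \<in> borel_measurable dx"
  using measurable_compose[OF ch_measurable[OF assms(2)] assms(1)] .

text \<open>\<open>E_e_si\<close>, \<open>E_f_si\<close> and \<open>energy_e\<close> contain
  products of two L2 functions and are thus merely integrable. Their pairing with a phase-field test
  function is meaningful because the latter is essentially bounded.\<close>

lemma integrable_mult_ch:
  assumes "integrable dx g" "v \<in> V_ch S"
  shows "integrable dx (\<lambda>x. g x * v x)"
  using V_ch_bounded[OF assms(2)] integrable_mult_bounded[OF assms(1) ch_measurable[OF assms(2)]] by blast

lemma L2_mult_ch:
  fixes g :: "real^'d \<Rightarrow> 'b::euclidean_space"
  assumes g: "g \<in> L2 \<Omega>" and v: "v \<in> V_ch S"
  shows "(\<lambda>x. v x *\<^sub>R g x) \<in> L2 \<Omega>"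
proof -
  obtain B where B: "AE x in dx. \<bar>v x\<bar> \<le> B" using V_ch_bounded[OF v] by blast
  have "AE x in dx. norm (v x *\<^sub>R g x) \<le> B * norm (g x)"
    using B by eventually_elim (simp add: mult_right_mono)
  then show ?thesis
    by (rule L2_dominated[OF g borel_measurable_scaleR[OF ch_measurable[OF v] L2_D(1)[OF g]]])
qed

lemma L2_mult_bounded:
  fixes g :: "real^'d \<Rightarrow> 'b::euclidean_space"
  assumes g: "g \<in> L2 \<Omega>" and v: "v \<in> V_ch S"
    and f: "f \<in> borel_measurable borel" "\<And>s. \<bar>f s\<bar> \<le> B"
  shows "(\<lambda>x. f (v x) *\<^sub>R g x) \<in> L2 \<Omega>"
proof -
  have "AE x in dx. norm (f (v x) *\<^sub>R g x) \<le> B * norm (g x)"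
    using f(2) by (intro AE_I2) (simp add: mult_right_mono)
  then show ?thesis
    by (rule L2_dominated[OF g borel_measurable_scaleR[OF compose_measurable[OF f(1) v] L2_D(1)[OF g]]])
qed

lemma convex_deriv_L2:
  assumes f: "convex_on UNIV f" "\<And>s. f differentiable (at s)" and v: "v \<in> V_ch S"
  shows "(\<lambda>x. deriv f (v x)) \<in> L2 \<Omega>"
proof -
  obtain B where B: "AE x in dx. \<bar>v x\<bar> \<le> B" using V_ch_bounded[OF v] by blast
  obtain K where K: "\<And>s. \<bar>s\<bar> \<le> B \<Longrightarrow> \<bar>deriv f s\<bar> \<le> K" using convex_deriv_bounded[OF f] by blast
  have "AE x in dx. norm (deriv f (v x)) \<le> K" using B by eventually_elim (simp add: K)
  then show ?thesis
    by (rule L2_bounded[OF ch.domain(3) compose_measurable[OF deriv_measurable[OF f(2)] v]])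
qed

text \<open>Lipschitz continuity alone allows linear growth; the bound comes from
  \<open>phi0\<close> being bounded almost everywhere.\<close>

lemma stiff_bounded:
  obtains B where "AE x in dx. norm (stiff P (phi0 S x)) \<le> B"
proof -
  obtain B where B: "AE x in dx. \<bar>phi0 S x\<bar> \<le> B" using V_ch_bounded[OF previous(1)] by blast
  have "AE x in dx. norm (stiff P (phi0 S x)) \<le> norm (stiff P 0) + LC * B"
    using B
  proof eventually_elim
    case (elim x)
    have "norm (stiff P (phi0 S x) - stiff P 0) \<le> LC * \<bar>phi0 S x\<bar>"
      using lipschitz_onD[OF stiff(1), of "phi0 S x" 0] by (simp add: dist_norm)
    also have "\<dots> \<le> LC * B" using elim lipschitz_on_nonneg[OF stiff(1)] by (intro mult_left_mono)
    finally show ?case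
      using norm_triangle_ineq[of "stiff P (phi0 S x) - stiff P 0" "stiff P 0"] by simp
  qed
  then show thesis by (rule that)
qed

lemma stiff_measurable: "(\<lambda>x. stiff P (phi0 S x)) \<in> borel_measurable dx"
  by (intro compose_measurable lipschitz_measurable[OF stiff(1)] previous)

lemma elastic_strain_L2:
  assumes "v \<in> V_ch S" "u \<in> V_u S"
  shows "elastic_strain P v u \<in> L2 \<Omega>"
proof -
  have "(\<lambda>x. strain \<Omega> u x - eigen P (v x)) \<in> L2 \<Omega>"
    using assms V_u_H1 by (intro L2_diff strain_L2 lipschitz_compose_L2[OF ch.domain(3) eigen(1)] ch.V_L2) auto
  then show ?thesis by (simp add: elastic_strain_def[abs_def])
qed

lemma stress_L2:
  assumes "v \<in> V_ch S" "u \<in> V_u S"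
  shows "stress P S v u \<in> L2 \<Omega>"
proof -
  obtain B where B: "AE x in dx. norm (stiff P (phi0 S x)) \<le> B" by (rule stiff_bounded)
  from contract_L2[OF stiff_measurable B elastic_strain_L2[OF assms]] show ?thesis by (simp add: stress_def[abs_def])
qed

lemma fluid_excess_L2:
  assumes "v \<in> V_ch S" "u \<in> V_u S" "\<theta> \<in> V_f S"
  shows "fluid_excess P v u \<theta> \<in> L2 \<Omega>"
proof -
  have "(\<lambda>x. \<theta> x - Biot_alpha P (v x) *\<^sub>R divergence \<Omega> u x) \<in> L2 \<Omega>"
    using assms V_u_H1
    by (intro L2_diff fl.V_L2 L2_mult_bounded[OF divergence_L2 _ lipschitz_measurable[OF Biot_alpha(1)] Biot_alpha(3)]) auto
  then show ?thesis by (simp add: fluid_excess_def[abs_def])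
qed

lemma pressure_L2:
  assumes "v \<in> V_ch S" "u \<in> V_u S" "\<theta> \<in> V_f S"
  shows "pressure P S v u \<theta> \<in> L2 \<Omega>"
  using L2_mult_bounded[OF fluid_excess_L2[OF assms] previous(1) lipschitz_measurable[OF Biot_M(1)] Biot_M(3)]
  by (simp add: pressure_def[abs_def])

lemma eigen_deriv_measurable: "(\<lambda>s. vector_derivative (eigen P) (at s)) \<in> borel_measurable borel"
  by (rule borel_measurable_vector_derivative[OF eigen(2)])

lemma eigen_deriv_bound: "norm (vector_derivative (eigen P) (at s)) \<le> LT"
  by (rule vector_derivative_bound_lipschitz[OF eigen(2,1)])

lemma eigen_deriv_L2:
  assumes "v \<in> V_ch S"
  shows "(\<lambda>x. vector_derivative (eigen P) (at (v x))) \<in> L2 \<Omega>"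
  by (rule L2_bounded[OF ch.domain(3) compose_measurable[OF eigen_deriv_measurable assms]])
    (use eigen_deriv_bound in auto)

lemma eigen_stress_integrable:
  assumes "v \<in> V_ch S" "u \<in> V_u S"
  shows "integrable dx (\<lambda>x. vector_derivative (eigen P) (at (v x)) \<bullet> stress P S v u x)"
  by (intro L2_integrable_inner eigen_deriv_L2 stress_L2 assms)

lemma alpha_deriv_L2:
  assumes "v \<in> V_ch S" "u \<in> V_u S"
  shows "(\<lambda>x. deriv (Biot_alpha P) (v x) * divergence \<Omega> u x) \<in> L2 \<Omega>"
  using L2_mult_bounded[OF divergence_L2[OF V_u_H1[OF assms(2)]] assms(1) deriv_measurable[OF Biot_alpha(2)]
      deriv_lipschitz_bound[OF Biot_alpha(2,1)]] by simp

lemma alpha_pressure_integrable: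
  assumes "v \<in> V_ch S" "u \<in> V_u S" "\<theta> \<in> V_f S"
  shows "integrable dx (\<lambda>x. deriv (Biot_alpha P) (v x) * pressure P S v u \<theta> x * divergence \<Omega> u x)"
  using L2_integrable_inner[OF alpha_deriv_L2[OF assms(1,2)] pressure_L2[OF assms]]
  by (simp add: ac_simps)

lemma old_elastic_integrable: "integrable dx (old_elastic P S)"
proof -
  have m: "(\<lambda>x. vector_derivative (stiff P) (at (phi0 S x))) \<in> borel_measurable dx"
    by (intro compose_measurable[OF borel_measurable_vector_derivative] stiff(2) previous)
  have b: "AE x in dx. norm (vector_derivative (stiff P) (at (phi0 S x))) \<le> LC"
    using vector_derivative_bound_lipschitz[OF stiff(2,1)] by simp
  have "integrable dx (\<lambda>x. elastic_strain P (phi0 S) (u0 S) x \<bullet>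
      contract (vector_derivative (stiff P) (at (phi0 S x))) (elastic_strain P (phi0 S) (u0 S) x))"
    by (intro L2_integrable_inner contract_L2[OF m b] elastic_strain_L2 previous)
  then show ?thesis by (simp add: old_elastic_def[abs_def])
qed

lemma old_fluid_integrable: "integrable dx (old_fluid P S)"
proof -
  have "integrable dx (\<lambda>x. (deriv (Biot_M P) (phi0 S x) *\<^sub>R fluid_excess P (phi0 S) (u0 S) (theta0 S) x)
      \<bullet> fluid_excess P (phi0 S) (u0 S) (theta0 S) x)"
    by (intro L2_integrable_inner L2_mult_bounded[OF _ _ deriv_measurable[OF Biot_M(2)]
          deriv_lipschitz_bound[OF Biot_M(2,1)]] fluid_excess_L2 previous)
  then have "integrable dx (\<lambda>x. (1/2) * ((deriv (Biot_M P) (phi0 S x) *\<^sub>R fluid_excess P (phi0 S) (u0 S) (theta0 S) x)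
      \<bullet> fluid_excess P (phi0 S) (u0 S) (theta0 S) x))"
    by (rule integrable_mult_right)
  then show ?thesis by (simp add: old_fluid_def[abs_def] power2_eq_square mult.assoc)
qed

lemma energy_e_integrable: "integrable dx (energy_e P S)"
proof -
  have "integrable dx (\<lambda>x. deriv (Psi_e P) (phi0 S x))"
    by (intro L2_integrable ch.domain convex_deriv_L2 Psi_e previous)
  then show ?thesis
    using old_elastic_integrable old_fluid_integrable by (simp add: energy_e_def[abs_def])
qed

section \<open>Derivatives of the separate energy terms along a line\<close>

lemma elastic_derivative:
  assumes v: "v \<in> V_ch S" and \<eta>: "\<eta> \<in> V_ch S" and u: "u \<in> V_u S" and w: "w \<in> V_u S"
  shows "((\<lambda>t. LINT x|dx. (1/2) * (elastic_strain P (\<lambda>x. v x + t * \<eta> x) (\<lambda>x. u x + t *\<^sub>R w x) x \<bullet>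
        stress P S (\<lambda>x. v x + t * \<eta> x) (\<lambda>x. u x + t *\<^sub>R w x) x))
      has_real_derivative (LINT x|dx. (strain \<Omega> w x - \<eta> x *\<^sub>R vector_derivative (eigen P) (at (v x))) \<bullet> stress P S v u x)) (at 0)"
proof -
  let ?v = "\<lambda>t x. v x + t * \<eta> x" and ?u = "\<lambda>t x. u x + t *\<^sub>R w x"
  let ?E = "\<lambda>t. elastic_strain P (?v t) (?u t)"
  let ?W = "\<lambda>t x. (strain \<Omega> u x + t *\<^sub>R strain \<Omega> w x) - eigen P (?v t x)"
  let ?W' = "\<lambda>x. strain \<Omega> w x - \<eta> x *\<^sub>R vector_derivative (eigen P) (at (v x))"
  let ?A = "\<lambda>x. contract (stiff P (phi0 S x))"
  have vt: "?v t \<in> V_ch S" for t using ch.lincomb_closed[OF v \<eta>, of 1 t] by simp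
  have ut: "?u t \<in> V_u S" for t using V_u(3)[OF u w, of 1 t] by simp
  obtain B where B: "AE x in dx. norm (stiff P (phi0 S x)) \<le> B" by (rule stiff_bounded)
  obtain K where K: "AE x in dx. \<forall>e. norm (?A x e) \<le> K * norm e"
    by (rule contract_bounded[OF B])
  have "((\<lambda>t. LINT x|dx. (1/2) * (?E t x \<bullet> ?A x (?E t x))) has_real_derivative
      (LINT x|dx. ?W' x \<bullet> ?A x (?W 0 x))) (at 0)"
  \<comment> \<open>The Lipschitz constant of the curve in t at each x: the strain moves at speed
    \<open>strain \<Omega> w x\<close>, the eigenstrain at most at speed LT times
    \<bar>\<eta>\<bar>.\<close>
  proof (rule quadratic_energy_derivative_AE[where k = "\<lambda>x. 1 *\<^sub>R norm (strain \<Omega> w x) + LT *\<^sub>R \<bar>\<eta> x\<bar>" and C = K])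
    show "?E t \<in> L2 \<Omega>" for t by (intro elastic_strain_L2 vt ut)
    show "AE x in dx. ?E t x = ?W t x" for t
      using strain_lincomb[OF ch.domain(1,3) V_u_H1[OF u] V_u_H1[OF w], of 1 t]
      by eventually_elim (simp add: elastic_strain_def)
    have "(\<lambda>x. (1 *\<^sub>R strain \<Omega> u x + t *\<^sub>R strain \<Omega> w x) - eigen P (?v t x)) \<in> L2 \<Omega>" for t
      by (intro L2_diff L2_lincomb strain_L2 V_u_H1 u w lipschitz_compose_L2[OF ch.domain(3) eigen(1)] ch.V_L2 vt)
    then show "?W t \<in> L2 \<Omega>" for t by simp
    show "?W' \<in> L2 \<Omega>"
      by (intro L2_diff strain_L2 V_u_H1 w L2_mult_ch eigen_deriv_L2 v \<eta>)
    have "(\<lambda>x. norm (strain \<Omega> w x)) \<in> L2 \<Omega>"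
      by (rule L2_dominated[OF strain_L2[OF V_u_H1[OF w]], where K = 1])
        (use L2_D(1)[OF strain_L2[OF V_u_H1[OF w]]] in auto)
    moreover have "(\<lambda>x. \<bar>\<eta> x\<bar>) \<in> L2 \<Omega>"
      by (rule L2_dominated[OF ch.V_L2[OF \<eta>], where K = 1]) (use ch_measurable[OF \<eta>] in auto)
    ultimately show "(\<lambda>x. 1 *\<^sub>R norm (strain \<Omega> w x) + LT *\<^sub>R \<bar>\<eta> x\<bar>) \<in> L2 \<Omega>"
      by (rule L2_lincomb)
    show "linear (?A x)" for x using bilinear_contract unfolding bilinear_def by blast
    show "e \<bullet> ?A x f = f \<bullet> ?A x e" for x e f by (rule contract_symmetric[OF stiff(3)])
    show "AE x in dx. \<forall>e. norm (?A x e) \<le> K * norm e" by (rule K)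
    show "(\<lambda>x. ?A x (f x)) \<in> borel_measurable dx" if "f \<in> borel_measurable dx" for f
      by (rule contract_measurable[OF stiff_measurable that])
    fix t :: real
    have "norm (?W t x - ?W 0 x) \<le> \<bar>t\<bar> * \<bar>1 *\<^sub>R norm (strain \<Omega> w x) + LT *\<^sub>R \<bar>\<eta> x\<bar>\<bar>" for x
    proof -
      have "?W t x - ?W 0 x = t *\<^sub>R strain \<Omega> w x - (eigen P (?v t x) - eigen P (v x))" by simp
      then have "norm (?W t x - ?W 0 x) \<le> norm (t *\<^sub>R strain \<Omega> w x) + norm (eigen P (?v t x) - eigen P (v x))"
        by (metis norm_triangle_ineq4)
      also have "norm (eigen P (?v t x) - eigen P (v x)) \<le> LT * (\<bar>t\<bar> * \<bar>\<eta> x\<bar>)"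
        using lipschitz_onD[OF eigen(1), of "?v t x" "v x"] by (simp add: dist_norm abs_mult)
      finally show ?thesis
        using lipschitz_on_nonneg[OF eigen(1)] by (simp add: algebra_simps)
    qed
    then show "AE x in dx. norm (?W t x - ?W 0 x) \<le> \<bar>t\<bar> * \<bar>1 *\<^sub>R norm (strain \<Omega> w x) + LT *\<^sub>R \<bar>\<eta> x\<bar>\<bar>" by simp
  next
    have "((\<lambda>t. ?W t x) has_vector_derivative ?W' x) (at 0)" for x
    proof -
      have "(eigen P has_vector_derivative vector_derivative (eigen P) (at (v x))) (at (v x + 0 * \<eta> x))"
        using eigen(2) vector_derivative_works by auto
      moreover have "((\<lambda>t. v x + t * \<eta> x) has_real_derivative \<eta> x) (at 0)"
        by (auto intro!: derivative_eq_intros)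
      ultimately have "((\<lambda>t. eigen P (v x + t * \<eta> x)) has_vector_derivative
          \<eta> x *\<^sub>R vector_derivative (eigen P) (at (v x))) (at 0)"
        using vector_diff_chain_at[of "\<lambda>t. v x + t * \<eta> x" "\<eta> x" 0 "eigen P"]
        by (simp add: has_real_derivative_iff_has_vector_derivative o_def)
      moreover have "((\<lambda>t. strain \<Omega> u x + t *\<^sub>R strain \<Omega> w x) has_vector_derivative strain \<Omega> w x) (at 0)"
        by (auto intro!: derivative_eq_intros)
      ultimately show ?thesis by (intro has_vector_derivative_diff)
    qed
    then show "AE x in dx. ((\<lambda>t. ?W t x) has_vector_derivative ?W' x) (at 0)" by simp
  qed
  then show ?thesis by (simp add: stress_def elastic_strain_def)
qed

text \<open>Here two unknowns multiply, so the curve contains \<alpha> of the moved phase field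
  times the moved divergence. Its velocity has the term \<eta> times \<alpha>' times the divergence
  of u, which is in L2 because \<eta> is essentially bounded.\<close>

lemma fluid_derivative:
  assumes v: "v \<in> V_ch S" and \<eta>: "\<eta> \<in> V_ch S" and u: "u \<in> V_u S" and w: "w \<in> V_u S"
    and \<theta>: "\<theta> \<in> V_f S" and \<zeta>: "\<zeta> \<in> V_f S"
  shows "((\<lambda>t. LINT x|dx. (1/2) *
          (fluid_excess P (\<lambda>x. v x + t * \<eta> x) (\<lambda>x. u x + t *\<^sub>R w x) (\<lambda>x. \<theta> x + t * \<zeta> x) x \<bullet>
           (Biot_M P (phi0 S x) * fluid_excess P (\<lambda>x. v x + t * \<eta> x) (\<lambda>x. u x + t *\<^sub>R w x) (\<lambda>x. \<theta> x + t * \<zeta> x) x)))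
      has_real_derivative
        (LINT x|dx. (\<zeta> x - (Biot_alpha P (v x) * divergence \<Omega> w x
            + \<eta> x * (deriv (Biot_alpha P) (v x) * divergence \<Omega> u x))) \<bullet> pressure P S v u \<theta> x)) (at 0)"
proof -
  let ?v = "\<lambda>t x. v x + t * \<eta> x" and ?u = "\<lambda>t x. u x + t *\<^sub>R w x" and ?\<theta> = "\<lambda>t x. \<theta> x + t * \<zeta> x"
  let ?E = "\<lambda>t. fluid_excess P (?v t) (?u t) (?\<theta> t)"
  let ?W = "\<lambda>t x. ?\<theta> t x - Biot_alpha P (?v t x) * (divergence \<Omega> u x + t * divergence \<Omega> w x)"
  let ?W' = "\<lambda>x. \<zeta> x - (Biot_alpha P (v x) * divergence \<Omega> w x
            + \<eta> x * (deriv (Biot_alpha P) (v x) * divergence \<Omega> u x))"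
  let ?A = "\<lambda>x e. Biot_M P (phi0 S x) * e"
  have vt: "?v t \<in> V_ch S" for t using ch.lincomb_closed[OF v \<eta>, of 1 t] by simp
  have ut: "?u t \<in> V_u S" for t using V_u(3)[OF u w, of 1 t] by simp
  have \<theta>t: "?\<theta> t \<in> V_f S" for t using fl.lincomb_closed[OF \<theta> \<zeta>, of 1 t] by simp
  note du = divergence_L2[OF V_u_H1[OF u]] and dw = divergence_L2[OF V_u_H1[OF w]]
  note \<alpha>m = lipschitz_measurable[OF Biot_alpha(1)]
  obtain B where B: "AE x in dx. \<bar>\<eta> x\<bar> \<le> B" using V_ch_bounded[OF \<eta>] by blast
  \<comment> \<open>The summands bound the motion of \<theta>, of the divergence (as \<alpha> is at
    most 1 in absolute value) and of \<alpha>. In the last one \<bar>\<eta>\<bar> is replaced by its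
    essential bound B, which keeps the product in L2.\<close>
  let ?k = "\<lambda>x. (\<bar>\<zeta> x\<bar> + \<bar>divergence \<Omega> w x\<bar>) + (L\<alpha> * B) *\<^sub>R \<bar>divergence \<Omega> u x\<bar>"
  have "((\<lambda>t. LINT x|dx. (1/2) * (?E t x \<bullet> ?A x (?E t x))) has_real_derivative
      (LINT x|dx. ?W' x \<bullet> ?A x (?W 0 x))) (at 0)"
  proof (rule quadratic_energy_derivative_AE[where k = ?k and C = CM])
    show "?E t \<in> L2 \<Omega>" for t by (intro fluid_excess_L2 vt ut \<theta>t)
    show "AE x in dx. ?E t x = ?W t x" for t
      using divergence_lincomb[OF ch.domain(1,3) V_u_H1[OF u] V_u_H1[OF w], of 1 t]
      by eventually_elim (simp add: fluid_excess_def)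
    have "(\<lambda>x. ?\<theta> t x - Biot_alpha P (?v t x) *\<^sub>R (1 *\<^sub>R divergence \<Omega> u x + t *\<^sub>R divergence \<Omega> w x)) \<in> L2 \<Omega>" for t
      by (intro L2_diff fl.V_L2 \<theta>t L2_mult_bounded[OF L2_lincomb[OF du dw] vt \<alpha>m Biot_alpha(3)])
    then show "?W t \<in> L2 \<Omega>" for t by simp
    have "(\<lambda>x. \<zeta> x - (Biot_alpha P (v x) *\<^sub>R divergence \<Omega> w x
            + \<eta> x *\<^sub>R (deriv (Biot_alpha P) (v x) * divergence \<Omega> u x))) \<in> L2 \<Omega>"
      by (intro L2_diff L2_add fl.V_L2 \<zeta> L2_mult_bounded[OF dw v \<alpha>m Biot_alpha(3)] L2_mult_ch alpha_deriv_L2 v u \<eta>)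
    then show "?W' \<in> L2 \<Omega>" by simp
    have abs_L2: "(\<lambda>x. \<bar>g x\<bar>) \<in> L2 \<Omega>" if "g \<in> L2 \<Omega>" for g :: "real^'d \<Rightarrow> real"
      by (rule L2_dominated[OF that, where K = 1]) (use L2_D(1)[OF that] in auto)
    show "?k \<in> L2 \<Omega>"
      by (intro L2_add L2_scaleR abs_L2 du dw fl.V_L2 \<zeta>)
    show "linear (?A x)" for x by (rule linearI) (simp_all add: algebra_simps)
    show "e \<bullet> ?A x f = f \<bullet> ?A x e" for x e f by simp
    show "AE x in dx. \<forall>e. norm (?A x e) \<le> CM * norm e"
      using Biot_M(3) by (simp add: abs_mult mult_right_mono)
    show "(\<lambda>x. ?A x (f x)) \<in> borel_measurable dx" if "f \<in> borel_measurable dx" for f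
      by (rule borel_measurable_times[OF compose_measurable[OF lipschitz_measurable[OF Biot_M(1)] previous(1)] that])
    fix t :: real assume t: "\<bar>t\<bar> \<le> 1"
    show "AE x in dx. norm (?W t x - ?W 0 x) \<le> \<bar>t\<bar> * \<bar>?k x\<bar>"
      using B
    proof eventually_elim
      case (elim x)
      let ?d = "divergence \<Omega> u x" and ?e = "divergence \<Omega> w x"
      have L0: "L\<alpha> \<ge> 0" using lipschitz_on_nonneg[OF Biot_alpha(1)] .
      have "\<bar>Biot_alpha P (?v t x) - Biot_alpha P (v x)\<bar> \<le> L\<alpha> * (\<bar>t\<bar> * \<bar>\<eta> x\<bar>)"
        using lipschitz_onD[OF Biot_alpha(1), of "?v t x" "v x"] by (simp add: dist_norm abs_mult)
      also have "\<dots> \<le> L\<alpha> * (\<bar>t\<bar> * B)" using elim L0 by (intro mult_left_mono) auto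
      finally have 1: "\<bar>(Biot_alpha P (?v t x) - Biot_alpha P (v x)) * ?d\<bar> \<le> L\<alpha> * (\<bar>t\<bar> * B) * \<bar>?d\<bar>"
        by (simp only: abs_mult) (rule mult_right_mono, auto)
      have 2: "\<bar>Biot_alpha P (?v t x) * (t * ?e)\<bar> \<le> \<bar>t\<bar> * \<bar>?e\<bar>"
        using mult_right_mono[OF Biot_alpha(3)[of "?v t x"], of "\<bar>t * ?e\<bar>"] by (simp add: abs_mult)
      \<comment> \<open>The product increment is split so that \<alpha> at the moved phase field
        meets only the new part of the divergence, and the difference of \<alpha> only the old one;
        no term of second order in t remains.\<close>
      have "?W t x - ?W 0 x = t * \<zeta> x - Biot_alpha P (?v t x) * (t * ?e) - (Biot_alpha P (?v t x) - Biot_alpha P (v x)) * ?d"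
        by (simp add: algebra_simps)
      also have "\<bar>\<dots>\<bar> \<le> \<bar>t\<bar> * \<bar>\<zeta> x\<bar> + \<bar>t\<bar> * \<bar>?e\<bar> + L\<alpha> * (\<bar>t\<bar> * B) * \<bar>?d\<bar>"
        using 1 2 abs_mult[of t "\<zeta> x"] by linarith
      also have "\<dots> = \<bar>t\<bar> * ?k x" by (simp add: algebra_simps)
      also have "\<dots> \<le> \<bar>t\<bar> * \<bar>?k x\<bar>" by (intro mult_left_mono) auto
      finally show ?case by simp
    qed
  next
    have "((\<lambda>t. ?W t x) has_vector_derivative ?W' x) (at 0)" for x
    proof -
      have "(Biot_alpha P has_real_derivative deriv (Biot_alpha P) (v x)) (at (v x + 0 * \<eta> x))"
        using Biot_alpha(2) by (simp add: DERIV_deriv_iff_real_differentiable)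
      moreover have "((\<lambda>t. v x + t * \<eta> x) has_real_derivative \<eta> x) (at 0)"
        by (auto intro!: derivative_eq_intros)
      ultimately have *: "((\<lambda>t. Biot_alpha P (v x + t * \<eta> x)) has_real_derivative deriv (Biot_alpha P) (v x) * \<eta> x) (at 0)"
        by (rule DERIV_chain2)
      have "((\<lambda>t. ?W t x) has_real_derivative ?W' x) (at 0)"
        by (rule derivative_eq_intros * refl | simp)+
      then show ?thesis by (simp add: has_real_derivative_iff_has_vector_derivative)
    qed
    then show "AE x in dx. ((\<lambda>t. ?W t x) has_vector_derivative ?W' x) (at 0)" by simp
  qed
  then show ?thesis by (simp add: pressure_def fluid_excess_def)
qed

lemma gradient_derivative:
  assumes v: "v \<in> V_ch S" and \<eta>: "\<eta> \<in> V_ch S"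
  shows "((\<lambda>t. LINT x|dx. (1/2) * (grad \<Omega> (\<lambda>x. v x + t * \<eta> x) x \<bullet> ((gam P * ell P) *\<^sub>R grad \<Omega> (\<lambda>x. v x + t * \<eta> x) x)))
      has_real_derivative (LINT x|dx. grad \<Omega> \<eta> x \<bullet> ((gam P * ell P) *\<^sub>R grad \<Omega> v x))) (at 0)"
proof -
  let ?v = "\<lambda>t x. v x + t * \<eta> x"
  let ?W = "\<lambda>t x. grad \<Omega> v x + t *\<^sub>R grad \<Omega> \<eta> x"
  let ?A = "\<lambda>x e. (gam P * ell P) *\<^sub>R e"
  have vt: "?v t \<in> V_ch S" for t using ch.lincomb_closed[OF v \<eta>, of 1 t] by simp
  have "((\<lambda>t. LINT x|dx. (1/2) * (grad \<Omega> (?v t) x \<bullet> ?A x (grad \<Omega> (?v t) x))) has_real_derivative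
      (LINT x|dx. grad \<Omega> \<eta> x \<bullet> ?A x (?W 0 x))) (at 0)"
  proof (rule quadratic_energy_derivative_AE[where k = "\<lambda>x. norm (grad \<Omega> \<eta> x)" and C = "\<bar>gam P * ell P\<bar>"])
    show "grad \<Omega> (?v t) \<in> L2 \<Omega>" for t by (rule ch.V_grad_L2[OF vt])
    show "AE x in dx. grad \<Omega> (?v t) x = ?W t x" for t
      using ch.grad_lincomb_V[OF v \<eta>, of 1 t] by simp
    have "(\<lambda>x. 1 *\<^sub>R grad \<Omega> v x + t *\<^sub>R grad \<Omega> \<eta> x) \<in> L2 \<Omega>" for t
      by (intro L2_lincomb ch.V_grad_L2 v \<eta>)
    then show "?W t \<in> L2 \<Omega>" for t by simp
    show "grad \<Omega> \<eta> \<in> L2 \<Omega>" by (rule ch.V_grad_L2[OF \<eta>])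
    then show "(\<lambda>x. norm (grad \<Omega> \<eta> x)) \<in> L2 \<Omega>"
      by (rule L2_dominated[where K = 1]) (use L2_D(1)[OF ch.V_grad_L2[OF \<eta>]] in auto)
    show "linear (?A x)" for x :: "real^'d" by (rule linearI) (simp_all add: algebra_simps)
    show "(\<lambda>x. ?A x (f x)) \<in> borel_measurable dx" if "f \<in> borel_measurable dx" for f :: "real^'d \<Rightarrow> real^'d"
      using that by measurable
    show "AE x in dx. ((\<lambda>t. ?W t x) has_vector_derivative grad \<Omega> \<eta> x) (at 0)"
      by (intro AE_I2) (auto intro!: derivative_eq_intros)
  qed (auto simp: inner_commute)
  then show ?thesis by simp
qed

lemma ch_compose_bounded:
  assumes v: "v \<in> V_ch S" and f: "continuous_on UNIV (f :: real \<Rightarrow> real)"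
  shows "integrable dx (\<lambda>x. f (v x))"
proof -
  obtain B where B: "AE x in dx. \<bar>v x\<bar> \<le> B" using V_ch_bounded[OF v] by blast
  have "bounded (f ` {- B..B})"
    by (intro compact_imp_bounded compact_continuous_image continuous_on_subset[OF f]) auto
  then have "\<exists>K. \<forall>s\<in>{- B..B}. \<bar>f s\<bar> \<le> K" by (simp add: bounded_iff)
  then obtain K where K: "\<forall>s\<in>{- B..B}. \<bar>f s\<bar> \<le> K" by blast
  have "AE x in dx. norm (f (v x)) \<le> K" using B
  proof eventually_elim
    case (elim x)
    then have "v x \<in> {- B..B}" by auto
    then show ?case using K by simp
  qed
  then show ?thesis
    by (rule integrable_const_bound) (rule compose_measurable[OF borel_measurable_continuous_onI[OF f] v])
qed

lemma Psi_derivative: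
  assumes v: "v \<in> V_ch S" and \<eta>: "\<eta> \<in> V_ch S"
  shows "((\<lambda>t. LINT x|dx. Psi_c P (v x + t * \<eta> x)) has_real_derivative
      (LINT x|dx. deriv (Psi_c P) (v x) * \<eta> x)) (at 0)"
proof -
  obtain B where B: "AE x in dx. \<bar>v x\<bar> \<le> B" using V_ch_bounded[OF v] by blast
  obtain C where C: "AE x in dx. \<bar>\<eta> x\<bar> \<le> C" using V_ch_bounded[OF \<eta>] by blast
  \<comment> \<open>For \<bar>t\<bar> at most 1 the values of \<open>v + t * \<eta>\<close> stay
    within \<open>B + C\<close>, so one bound on the derivative serves for all of them.\<close>
  obtain K where K: "\<And>s. \<bar>s\<bar> \<le> B + C \<Longrightarrow> \<bar>deriv (Psi_c P) s\<bar> \<le> K"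
    using convex_deriv_bounded[OF Psi_c] by blast
  have D: "(Psi_c P has_real_derivative deriv (Psi_c P) s) (at s)" for s
    using Psi_c(2) by (simp add: DERIV_deriv_iff_real_differentiable)
  have cont: "continuous_on UNIV (Psi_c P)"
    using D DERIV_isCont by (auto intro!: continuous_at_imp_continuous_on)
  show ?thesis
  proof (rule has_real_derivative_integral(2))
    have "(\<lambda>x. v x + t * \<eta> x) \<in> V_ch S" for t using ch.lincomb_closed[OF v \<eta>, of 1 t] by simp
    then show "integrable dx (\<lambda>x. Psi_c P (v x + t * \<eta> x))" for t
      by (rule ch_compose_bounded[OF _ cont])
    show "integrable dx (\<lambda>x. K * \<bar>\<eta> x\<bar>)"
      using L2_integrable[OF ch.domain(3) ch.V_L2[OF \<eta>]] by simp
    show "(\<lambda>x. deriv (Psi_c P) (v x) * \<eta> x) \<in> borel_measurable dx"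
      by (intro borel_measurable_times compose_measurable deriv_measurable Psi_c(2) v ch_measurable \<eta>)
    have "((\<lambda>t. Psi_c P (v x + t * \<eta> x)) has_real_derivative deriv (Psi_c P) (v x) * \<eta> x) (at 0)" for x
    proof (rule DERIV_chain2[where f = "Psi_c P" and g = "\<lambda>t. v x + t * \<eta> x"])
      show "(Psi_c P has_real_derivative deriv (Psi_c P) (v x)) (at (v x + 0 * \<eta> x))" using D by simp
      show "((\<lambda>t. v x + t * \<eta> x) has_real_derivative \<eta> x) (at 0)"
        by (auto intro!: derivative_eq_intros)
    qed
    then show "AE x in dx. ((\<lambda>t. Psi_c P (v x + t * \<eta> x)) has_real_derivative deriv (Psi_c P) (v x) * \<eta> x) (at 0)"
      by simp
    fix t :: real assume t: "\<bar>t - 0\<bar> \<le> 1"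
    show "AE x in dx. \<bar>Psi_c P (v x + t * \<eta> x) - Psi_c P (v x + 0 * \<eta> x)\<bar> \<le> \<bar>t - 0\<bar> * (K * \<bar>\<eta> x\<bar>)"
      using B C
    proof eventually_elim
      case (elim x)
      have te: "\<bar>t * \<eta> x\<bar> \<le> C"
        using t elim(2) mult_mono[of "\<bar>t\<bar>" 1 "\<bar>\<eta> x\<bar>" C] by (simp add: abs_mult)
      have "norm (Psi_c P (v x + t * \<eta> x) - Psi_c P (v x)) \<le> K * norm (v x + t * \<eta> x - v x)"
      proof (rule field_differentiable_bound[where f = "Psi_c P" and f' = "deriv (Psi_c P)"
            and S = "{- (B + C)..B + C}"])
        show "(Psi_c P has_field_derivative deriv (Psi_c P) s) (at s within {- (B + C)..B + C})" for s
          using D by (rule has_field_derivative_at_within)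
        show "norm (deriv (Psi_c P) s) \<le> K" if "s \<in> {- (B + C)..B + C}" for s
          using K[of s] that by auto
        show "v x + t * \<eta> x \<in> {- (B + C)..B + C}" "v x \<in> {- (B + C)..B + C}"
          using elim te by auto
      qed simp
      then show ?case by (simp add: abs_mult ac_simps)
    qed
  qed
qed

section \<open>Residuals of the discrete equations and the first variation of the energy\<close>

definition residual_ch where
  "residual_ch v u \<theta> \<eta> =
     gam P * (ell P * L2_inner \<Omega> (grad \<Omega> v) (grad \<Omega> \<eta>)
       + 1 / ell P * L2_inner \<Omega> (\<lambda>x. deriv (Psi_c P) (v x) - deriv (Psi_e P) (phi0 S x)) \<eta>)
     + L2_inner \<Omega> (E_e_si P S v u) \<eta> + L2_inner \<Omega> (E_f_si P S v u \<theta>) \<eta>"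

definition residual_u where
  "residual_u v u \<theta> w =
     L2_inner \<Omega> (stress P S v u) (strain \<Omega> w)
     - L2_inner \<Omega> (\<lambda>x. Biot_alpha P (v x) * pressure P S v u \<theta> x) (divergence \<Omega> w)
     - L2_inner \<Omega> (load P) w"

definition residual_f where
  "residual_f v u \<theta> \<zeta> = L2_inner \<Omega> (pressure P S v u \<theta>) \<zeta>"

lemma Psi_diff_L2:
  assumes "v \<in> V_ch S"
  shows "(\<lambda>x. deriv (Psi_c P) (v x) - deriv (Psi_e P) (phi0 S x)) \<in> L2 \<Omega>"
  by (intro L2_diff convex_deriv_L2 Psi_c Psi_e assms previous)

lemma E_e_si_integrable:
  assumes "v \<in> V_ch S" "u \<in> V_u S"
  shows "integrable dx (E_e_si P S v u)"
  using eigen_stress_integrable[OF assms] old_elastic_integrable by (simp add: E_e_si_def[abs_def])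

lemma E_f_si_integrable:
  assumes "v \<in> V_ch S" "u \<in> V_u S" "\<theta> \<in> V_f S"
  shows "integrable dx (E_f_si P S v u \<theta>)"
  using alpha_pressure_integrable[OF assms] old_fluid_integrable by (simp add: E_f_si_def[abs_def])

text \<open>The counterpart of \<open>ch.ip_lincomb_right\<close> for g that is integrable but need
  not be in L2.\<close>

lemma ip_lincomb_ch:
  assumes g: "integrable dx g" and v: "v \<in> V_ch S" and w: "w \<in> V_ch S"
  shows "L2_inner \<Omega> g (\<lambda>x. a * v x + b * w x) = a * L2_inner \<Omega> g v + b * L2_inner \<Omega> g w"
proof -
  have "L2_inner \<Omega> g (\<lambda>x. a * v x + b * w x) = (LINT x|dx. a * (g x * v x) + b * (g x * w x))"
    by (simp add: L2_inner_def algebra_simps)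
  also have "\<dots> = a * L2_inner \<Omega> g v + b * L2_inner \<Omega> g w"
    using integrable_mult_ch[OF g v] integrable_mult_ch[OF g w] by (simp add: L2_inner_def)
  finally show ?thesis .
qed

lemma residual_ch_linear:
  assumes "v \<in> V_ch S" "u \<in> V_u S" "\<theta> \<in> V_f S"
  shows "linear_functional_on (V_ch S) (residual_ch v u \<theta>)"
  unfolding linear_functional_on_def residual_ch_def
  using assms ip_lincomb_ch[OF L2_integrable[OF ch.domain(3) Psi_diff_L2[OF assms(1)]]]
    ip_lincomb_ch[OF E_e_si_integrable[OF assms(1,2)]] ip_lincomb_ch[OF E_f_si_integrable[OF assms]]
  by (simp add: ch.gip_lincomb_right algebra_simps add_divide_distrib)

lemma residual_f_linear:
  assumes "v \<in> V_ch S" "u \<in> V_u S" "\<theta> \<in> V_f S"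
  shows "linear_functional_on (V_f S) (residual_f v u \<theta>)"
  unfolding linear_functional_on_def residual_f_def
  using fl.ip_lincomb_right[OF fl.V_L2 fl.V_L2 pressure_L2[OF assms]] by simp

lemma alpha_pressure_L2:
  assumes "v \<in> V_ch S" "u \<in> V_u S" "\<theta> \<in> V_f S"
  shows "(\<lambda>x. Biot_alpha P (v x) * pressure P S v u \<theta> x) \<in> L2 \<Omega>"
  using L2_mult_bounded[OF pressure_L2[OF assms] assms(1) lipschitz_measurable[OF Biot_alpha(1)] Biot_alpha(3)]
  by simp

text \<open>With factor 0 this says that the zero displacement has zero residual. That is not
  immediate, since the chosen gradient of the zero function vanishes only almost everywhere.\<close>

lemma residual_u_scale:
  assumes "v \<in> V_ch S" "u \<in> V_u S" "\<theta> \<in> V_f S" and w: "w \<in> V_u S"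
  shows "residual_u v u \<theta> (\<lambda>x. a *\<^sub>R w x) = a * residual_u v u \<theta> w"
proof -
  have aw: "(\<lambda>x. a *\<^sub>R w x) \<in> V_u S" using V_u(3)[OF w w, of a 0] by simp
  have scale: "L2_inner \<Omega> g h' = a * L2_inner \<Omega> g h"
    if "h \<in> L2 \<Omega>" "h' \<in> L2 \<Omega>" "g \<in> L2 \<Omega>" "AE x in dx. h' x = a *\<^sub>R h x + 0 *\<^sub>R h x"
    for g h h' :: "real^'d \<Rightarrow> 'b::euclidean_space"
  proof -
    have "L2_inner \<Omega> h' g = L2_inner \<Omega> (\<lambda>x. a *\<^sub>R h x + 0 *\<^sub>R h x) g"
      using that by (intro L2_inner_cong_AE L2_lincomb)
    also have "\<dots> = a * L2_inner \<Omega> h g + 0 * L2_inner \<Omega> h g"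
      using that by (intro L2_inner_lincomb_left)
    finally show ?thesis by (simp add: L2_inner_commute[of \<Omega> g])
  qed
  have "L2_inner \<Omega> (stress P S v u) (strain \<Omega> (\<lambda>x. a *\<^sub>R w x)) = a * L2_inner \<Omega> (stress P S v u) (strain \<Omega> w)"
    using strain_lincomb[OF ch.domain(1,3) V_u_H1[OF w] V_u_H1[OF w], of a 0]
    by (intro scale strain_L2 V_u_H1 w aw stress_L2 assms) simp
  moreover have "L2_inner \<Omega> (\<lambda>x. Biot_alpha P (v x) * pressure P S v u \<theta> x) (divergence \<Omega> (\<lambda>x. a *\<^sub>R w x))
      = a * L2_inner \<Omega> (\<lambda>x. Biot_alpha P (v x) * pressure P S v u \<theta> x) (divergence \<Omega> w)"
    using divergence_lincomb[OF ch.domain(1,3) V_u_H1[OF w] V_u_H1[OF w], of a 0]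
    by (intro scale divergence_L2 V_u_H1 w aw alpha_pressure_L2 assms) simp
  moreover have "L2_inner \<Omega> (load P) (\<lambda>x. a *\<^sub>R w x) = a * L2_inner \<Omega> (load P) w"
    by (simp add: L2_inner_def)
  ultimately show ?thesis
    by (simp add: residual_u_def right_diff_distrib)
qed

text \<open>The residuals are variations of the potential without its dissipation. The pairings with
  \<open>energy_e\<close> and with the load belong to the potential but not to
  \<open>energy_c\<close>, so their contributions are taken out again.\<close>

lemma energy_c_derivative:
  assumes v: "v \<in> V_ch S" and \<eta>: "\<eta> \<in> V_ch S" and u: "u \<in> V_u S" and w: "w \<in> V_u S"
    and \<theta>: "\<theta> \<in> V_f S" and \<zeta>: "\<zeta> \<in> V_f S"
  shows "((\<lambda>t. energy_c P S (\<lambda>x. v x + t * \<eta> x) (\<lambda>x. u x + t *\<^sub>R w x) (\<lambda>x. \<theta> x + t * \<zeta> x))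
      has_real_derivative residual_ch v u \<theta> \<eta> - L2_inner \<Omega> (energy_e P S) \<eta>
        + residual_u v u \<theta> w + L2_inner \<Omega> (load P) w + residual_f v u \<theta> \<zeta>) (at 0)"
proof -
  let ?v = "\<lambda>t x. v x + t * \<eta> x" and ?u = "\<lambda>t x. u x + t *\<^sub>R w x" and ?\<theta> = "\<lambda>t x. \<theta> x + t * \<zeta> x"
  have vt: "?v t \<in> V_ch S" for t using ch.lincomb_closed[OF v \<eta>, of 1 t] by simp
  have ut: "?u t \<in> V_u S" for t using V_u(3)[OF u w, of 1 t] by simp
  have \<theta>t: "?\<theta> t \<in> V_f S" for t using fl.lincomb_closed[OF \<theta> \<zeta>, of 1 t] by simp
  let ?I1 = "\<lambda>t x. (1/2) * (grad \<Omega> (?v t) x \<bullet> ((gam P * ell P) *\<^sub>R grad \<Omega> (?v t) x))"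
  let ?I2 = "\<lambda>t x. (1/2) * (elastic_strain P (?v t) (?u t) x \<bullet> stress P S (?v t) (?u t) x)"
  let ?fe = "\<lambda>t. fluid_excess P (?v t) (?u t) (?\<theta> t)"
  let ?I3 = "\<lambda>t x. (1/2) * (?fe t x \<bullet> (Biot_M P (phi0 S x) * ?fe t x))"
  have int1: "integrable dx (?I1 t)" for t
    by (intro integrable_mult_right L2_integrable_inner L2_scaleR ch.V_grad_L2 vt)
  have int2: "integrable dx (?I2 t)" for t
    by (intro integrable_mult_right L2_integrable_inner elastic_strain_L2 stress_L2 vt ut)
  have int3: "integrable dx (?I3 t)" for t
    using L2_integrable_inner[OF fluid_excess_L2 pressure_L2, OF vt[of t] ut[of t] \<theta>t[of t] vt[of t] ut[of t] \<theta>t[of t]]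
    by (simp add: pressure_def)
  \<comment> \<open>Each density is brought into the form one half of
    \<open>W \<bullet> A W\<close>, for which the derivatives have been computed.\<close>
  have "energy_c P S (?v t) (?u t) (?\<theta> t)
      = (LINT x|dx. ?I1 t x + ?I2 t x + ?I3 t x) + gam P / ell P * (LINT x|dx. Psi_c P (?v t x))" for t
    by (simp add: energy_c_def dot_square_norm power2_eq_square ac_simps)
  then have eq: "energy_c P S (?v t) (?u t) (?\<theta> t)
      = (LINT x|dx. ?I1 t x) + (LINT x|dx. ?I2 t x) + (LINT x|dx. ?I3 t x) + gam P / ell P * (LINT x|dx. Psi_c P (?v t x))" for t
    using int1[of t] int2[of t] int3[of t] by simp
  let ?T = "\<lambda>x. vector_derivative (eigen P) (at (v x))"
  let ?p = "pressure P S v u \<theta>" and ?s = "stress P S v u"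
  let ?\<alpha>' = "\<lambda>x. deriv (Biot_alpha P) (v x)"
  have D: "((\<lambda>t. energy_c P S (?v t) (?u t) (?\<theta> t)) has_real_derivative
      (LINT x|dx. grad \<Omega> \<eta> x \<bullet> ((gam P * ell P) *\<^sub>R grad \<Omega> v x))
      + (LINT x|dx. (strain \<Omega> w x - \<eta> x *\<^sub>R ?T x) \<bullet> ?s x)
      + (LINT x|dx. (\<zeta> x - (Biot_alpha P (v x) * divergence \<Omega> w x + \<eta> x * (?\<alpha>' x * divergence \<Omega> u x))) \<bullet> ?p x)
      + gam P / ell P * (LINT x|dx. deriv (Psi_c P) (v x) * \<eta> x)) (at 0)"
    unfolding eq
    by (intro DERIV_add DERIV_cmult gradient_derivative elastic_derivative fluid_derivative Psi_derivative assms)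
  have c1: "(LINT x|dx. grad \<Omega> \<eta> x \<bullet> ((gam P * ell P) *\<^sub>R grad \<Omega> v x))
      = gam P * (ell P * L2_inner \<Omega> (grad \<Omega> v) (grad \<Omega> \<eta>))"
    by (simp add: L2_inner_def inner_commute)
  have c2: "(LINT x|dx. (strain \<Omega> w x - \<eta> x *\<^sub>R ?T x) \<bullet> ?s x)
      = L2_inner \<Omega> ?s (strain \<Omega> w) - (LINT x|dx. (?T x \<bullet> ?s x) * \<eta> x)"
  proof -
    have "(LINT x|dx. (strain \<Omega> w x - \<eta> x *\<^sub>R ?T x) \<bullet> ?s x) = (LINT x|dx. ?s x \<bullet> strain \<Omega> w x - (?T x \<bullet> ?s x) * \<eta> x)"
    proof -
      have "(a - e *\<^sub>R T) \<bullet> s = s \<bullet> a - (T \<bullet> s) * e" for a T s :: "real^'d^'d" and e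
        by (simp add: inner_diff_left inner_commute[of a s])
      then show ?thesis by (simp only:)
    qed
    also have "\<dots> = L2_inner \<Omega> ?s (strain \<Omega> w) - (LINT x|dx. (?T x \<bullet> ?s x) * \<eta> x)"
      unfolding L2_inner_def
      by (intro Bochner_Integration.integral_diff L2_integrable_inner stress_L2 strain_L2 V_u_H1
          integrable_mult_ch eigen_stress_integrable assms)
    finally show ?thesis .
  qed
  have c3: "(LINT x|dx. (\<zeta> x - (Biot_alpha P (v x) * divergence \<Omega> w x + \<eta> x * (?\<alpha>' x * divergence \<Omega> u x))) \<bullet> ?p x)
      = L2_inner \<Omega> ?p \<zeta> - L2_inner \<Omega> (\<lambda>x. Biot_alpha P (v x) * ?p x) (divergence \<Omega> w)
        - (LINT x|dx. (?\<alpha>' x * ?p x * divergence \<Omega> u x) * \<eta> x)"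
  proof -
    have "(LINT x|dx. (\<zeta> x - (Biot_alpha P (v x) * divergence \<Omega> w x + \<eta> x * (?\<alpha>' x * divergence \<Omega> u x))) \<bullet> ?p x)
        = (LINT x|dx. (?p x \<bullet> \<zeta> x - (Biot_alpha P (v x) * ?p x) \<bullet> divergence \<Omega> w x)
            - (?\<alpha>' x * ?p x * divergence \<Omega> u x) * \<eta> x)"
      by (simp add: algebra_simps)
    also have "\<dots> = L2_inner \<Omega> ?p \<zeta> - L2_inner \<Omega> (\<lambda>x. Biot_alpha P (v x) * ?p x) (divergence \<Omega> w)
        - (LINT x|dx. (?\<alpha>' x * ?p x * divergence \<Omega> u x) * \<eta> x)"
      unfolding L2_inner_def
      using L2_integrable_inner[OF pressure_L2[OF v u \<theta>] fl.V_L2[OF \<zeta>]]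
        L2_integrable_inner[OF alpha_pressure_L2[OF v u \<theta>] divergence_L2[OF V_u_H1[OF w]]]
        integrable_mult_ch[OF alpha_pressure_integrable[OF v u \<theta>] \<eta>]
      by (simp only: Bochner_Integration.integral_diff Bochner_Integration.integrable_diff)
    finally show ?thesis .
  qed
  have Pc: "integrable dx (\<lambda>x. deriv (Psi_c P) (v x))" and Pe: "integrable dx (\<lambda>x. deriv (Psi_e P) (phi0 S x))"
    by (intro L2_integrable ch.domain convex_deriv_L2 Psi_c Psi_e v previous)+
  have i1: "L2_inner \<Omega> (\<lambda>x. deriv (Psi_c P) (v x) - deriv (Psi_e P) (phi0 S x)) \<eta>
      = (LINT x|dx. deriv (Psi_c P) (v x) * \<eta> x) - (LINT x|dx. deriv (Psi_e P) (phi0 S x) * \<eta> x)"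
    using integrable_mult_ch[OF Pc \<eta>] integrable_mult_ch[OF Pe \<eta>]
    by (simp add: L2_inner_def left_diff_distrib)
  have i2: "L2_inner \<Omega> (E_e_si P S v u) \<eta>
      = (LINT x|dx. old_elastic P S x * \<eta> x) - (LINT x|dx. (?T x \<bullet> ?s x) * \<eta> x)"
  proof -
    have "L2_inner \<Omega> (E_e_si P S v u) \<eta> = (LINT x|dx. old_elastic P S x * \<eta> x - (?T x \<bullet> ?s x) * \<eta> x)"
      by (simp add: L2_inner_def E_e_si_def algebra_simps)
    then show ?thesis
      using integrable_mult_ch[OF old_elastic_integrable \<eta>] integrable_mult_ch[OF eigen_stress_integrable[OF v u] \<eta>]
      by simp
  qed
  have i3: "L2_inner \<Omega> (E_f_si P S v u \<theta>) \<eta>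
      = (LINT x|dx. old_fluid P S x * \<eta> x) - (LINT x|dx. (?\<alpha>' x * ?p x * divergence \<Omega> u x) * \<eta> x)"
  proof -
    have "L2_inner \<Omega> (E_f_si P S v u \<theta>) \<eta>
        = (LINT x|dx. old_fluid P S x * \<eta> x - (?\<alpha>' x * ?p x * divergence \<Omega> u x) * \<eta> x)"
      by (simp add: L2_inner_def E_f_si_def left_diff_distrib)
    then show ?thesis
      using integrable_mult_ch[OF old_fluid_integrable \<eta>] integrable_mult_ch[OF alpha_pressure_integrable[OF v u \<theta>] \<eta>]
      by (simp only: Bochner_Integration.integral_diff)
  qed
  have i4: "L2_inner \<Omega> (energy_e P S) \<eta>
      = - (gam P / ell P) * (LINT x|dx. deriv (Psi_e P) (phi0 S x) * \<eta> x)
        + (LINT x|dx. old_elastic P S x * \<eta> x) + (LINT x|dx. old_fluid P S x * \<eta> x)"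
  proof -
    have "L2_inner \<Omega> (energy_e P S) \<eta>
        = (LINT x|dx. - (gam P / ell P) * (deriv (Psi_e P) (phi0 S x) * \<eta> x) + old_elastic P S x * \<eta> x + old_fluid P S x * \<eta> x)"
      by (simp add: L2_inner_def energy_e_def ring_distribs mult.assoc)
    then show ?thesis
      using integrable_mult_ch[OF old_fluid_integrable \<eta>] integrable_mult_ch[OF old_elastic_integrable \<eta>]
        integrable_mult_ch[OF Pe \<eta>]
      by simp
  qed
  \<comment> \<open>The derivative of \<open>Psi_e\<close> and the old energy densities occur
    equally in \<open>residual_ch\<close> and in \<open>energy_e\<close> and cancel.\<close>
  show ?thesis
    by (rule DERIV_cong[OF D], unfold c1 c2 c3 residual_ch_def residual_u_def residual_f_def i1 i2 i3 i4)
      (simp add: ring_distribs diff_divide_distrib)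
qed

section \<open>Minimizers and solutions of the discrete problem\<close>

abbreviation defect_ch where "defect_ch v \<equiv> \<lambda>x. v x - phi0 S x - tau S * src_R P x"
abbreviation defect_f where "defect_f \<theta> \<equiv> \<lambda>x. \<theta> x - theta0 S x - tau S * src_S P x"

lemma defect_ch_L2: "v \<in> V_ch S \<Longrightarrow> defect_ch v \<in> L2 \<Omega>"
  using L2_diff[OF L2_diff[OF ch.V_L2 ch.V_L2[OF previous(1)]] L2_scaleR[OF sources(1), of "tau S"]] by simp

lemma defect_f_L2: "\<theta> \<in> V_f S \<Longrightarrow> defect_f \<theta> \<in> L2 \<Omega>"
  using L2_diff[OF L2_diff[OF fl.V_L2 fl.V_L2[OF previous(3)]] L2_scaleR[OF sources(2), of "tau S"]] by simp

lemma admissible_iff: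
  "(v, u, \<theta>) \<in> admissible P S \<longleftrightarrow> v \<in> V_ch S \<and> ch.mean (defect_ch v) = 0 \<and> u \<in> V_u S \<and>
     \<theta> \<in> V_f S \<and> fl.mean (defect_f \<theta>) = 0"
  using ch.affine_space_iff[OF constants(5) ch.V_L2[OF previous(1)] sources(1)]
    fl.affine_space_iff[OF constants(5) fl.V_L2[OF previous(3)] sources(2)]
  by (auto simp: admissible_def)

text \<open>The source terms are merged into the defects, so that the balance laws and the
  dissipation terms speak of the same functionals.\<close>

lemma solves_discrete_iff:
  "solves_discrete P S v \<mu> u \<theta> p \<longleftrightarrow>
     v \<in> V_ch S \<and> \<mu> \<in> V_ch S \<and> u \<in> V_u S \<and> \<theta> \<in> V_f S \<and> p \<in> V_f S \<and>
     (\<forall>\<eta>\<in>V_ch S. L2_inner \<Omega> (defect_ch v) \<eta> + tau S * (mob P * ch.gip \<mu> \<eta>) = 0) \<and>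
     (\<forall>\<eta>\<in>V_ch S. L2_inner \<Omega> \<mu> \<eta> = residual_ch v u \<theta> \<eta>) \<and>
     (\<forall>w\<in>V_u S. residual_u v u \<theta> w = 0) \<and>
     (\<forall>\<zeta>\<in>V_f S. L2_inner \<Omega> (defect_f \<theta>) \<zeta> + tau S * (kap P * fl.gip p \<zeta>) = 0) \<and>
     (\<forall>\<zeta>\<in>V_f S. L2_inner \<Omega> p \<zeta> = residual_f v u \<theta> \<zeta>)"
proof -
  have scale: "L2_inner \<Omega> (\<lambda>x. c *\<^sub>R f x) g = c * L2_inner \<Omega> f g" for c and f g :: "real^'d \<Rightarrow> real^'d"
    by (simp add: L2_inner_def)
  have split: "L2_inner \<Omega> (\<lambda>x. f x - c * r x) \<eta> = L2_inner \<Omega> f \<eta> - c * L2_inner \<Omega> r \<eta>"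
    if "f \<in> L2 \<Omega>" "r \<in> L2 \<Omega>" "\<eta> \<in> L2 \<Omega>" for f r \<eta> :: "real^'d \<Rightarrow> real" and c
    using L2_inner_lincomb_left[OF that, of 1 "- c"] by simp
  have 1: "L2_inner \<Omega> (defect_ch v) \<eta> = L2_inner \<Omega> (\<lambda>x. v x - phi0 S x) \<eta> - tau S * L2_inner \<Omega> (src_R P) \<eta>"
    if "v \<in> V_ch S" "\<eta> \<in> V_ch S" for \<eta>
    by (intro split L2_diff ch.V_L2 that previous sources)
  have 2: "L2_inner \<Omega> (defect_f \<theta>) \<zeta> = L2_inner \<Omega> (\<lambda>x. \<theta> x - theta0 S x) \<zeta> - tau S * L2_inner \<Omega> (src_S P) \<zeta>"
    if "\<theta> \<in> V_f S" "\<zeta> \<in> V_f S" for \<zeta>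
    by (intro split L2_diff fl.V_L2 that previous sources)
  show ?thesis
    unfolding solves_discrete_def Let_def residual_ch_def residual_u_def residual_f_def scale
    by (intro conj_cong ball_cong refl) (auto simp: 1 2)
qed

text \<open>Apart from \<open>energy_c\<close>, the potential is exactly quadratic along an
  admissible line. Stationarity needs only the linear coefficient, minimality also that q is
  nonnegative.\<close>

lemma potential_line:
  assumes v: "v \<in> V_ch S" "ch.mean (defect_ch v) = 0" and \<theta>: "\<theta> \<in> V_f S" "fl.mean (defect_f \<theta>) = 0"
    and u: "u \<in> V_u S"
    and z: "z \<in> V_ch S" "ch.mean z = 0" "\<And>l. l \<in> V_ch S \<Longrightarrow> mob P * ch.gip z l = L2_inner \<Omega> (defect_ch v) l"
    and y: "y \<in> V_f S" "fl.mean y = 0" "\<And>l. l \<in> V_f S \<Longrightarrow> kap P * fl.gip y l = L2_inner \<Omega> (defect_f \<theta>) l"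
    and \<eta>: "\<eta> \<in> V_ch S" "ch.mean \<eta> = 0" and \<zeta>: "\<zeta> \<in> V_f S" "fl.mean \<zeta> = 0" and w: "w \<in> V_u S"
  obtains q where "q \<ge> 0"
    "\<And>t. potential P S (\<lambda>x. v x + t * \<eta> x) (\<lambda>x. u x + t *\<^sub>R w x) (\<lambda>x. \<theta> x + t * \<zeta> x)
       = potential P S v u \<theta>
         + (energy_c P S (\<lambda>x. v x + t * \<eta> x) (\<lambda>x. u x + t *\<^sub>R w x) (\<lambda>x. \<theta> x + t * \<zeta> x) - energy_c P S v u \<theta>)
         + t * (L2_inner \<Omega> z \<eta> / tau S + L2_inner \<Omega> y \<zeta> / tau S
             + L2_inner \<Omega> (energy_e P S) \<eta> - L2_inner \<Omega> (load P) w) + t\<^sup>2 * q"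
proof -
  obtain q1 where q1: "q1 \<ge> 0" "\<And>t. (dual_norm \<Omega> (mob P) (V_ch S) (\<lambda>x. defect_ch v x + t * \<eta> x))\<^sup>2
      = (dual_norm \<Omega> (mob P) (V_ch S) (defect_ch v))\<^sup>2 + 2 * t * L2_inner \<Omega> z \<eta> + t\<^sup>2 * q1"
    by (rule ch.dual_norm_step[OF constants(3) z defect_ch_L2[OF v(1)] \<eta>]) blast+
  obtain q2 where q2: "q2 \<ge> 0" "\<And>t. (dual_norm \<Omega> (kap P) (V_f S) (\<lambda>x. defect_f \<theta> x + t * \<zeta> x))\<^sup>2
      = (dual_norm \<Omega> (kap P) (V_f S) (defect_f \<theta>))\<^sup>2 + 2 * t * L2_inner \<Omega> y \<zeta> + t\<^sup>2 * q2"
    by (rule fl.dual_norm_step[OF constants(4) y defect_f_L2[OF \<theta>(1)] \<zeta>]) blast+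
  have d1: "defect_ch (\<lambda>x. v x + t * \<eta> x) = (\<lambda>x. defect_ch v x + t * \<eta> x)" for t by (simp add: fun_eq_iff)
  have d2: "defect_f (\<lambda>x. \<theta> x + t * \<zeta> x) = (\<lambda>x. defect_f \<theta> x + t * \<zeta> x)" for t by (simp add: fun_eq_iff)
  have e: "L2_inner \<Omega> (energy_e P S) (\<lambda>x. v x + t * \<eta> x) = L2_inner \<Omega> (energy_e P S) v + t * L2_inner \<Omega> (energy_e P S) \<eta>" for t
    using ip_lincomb_ch[OF energy_e_integrable v(1) \<eta>(1), of 1 t] by simp
  have l: "L2_inner \<Omega> (load P) (\<lambda>x. u x + t *\<^sub>R w x) = L2_inner \<Omega> (load P) u + t * L2_inner \<Omega> (load P) w" for t
    using L2_inner_lincomb_left[OF H1_vec_L2[OF V_u_H1[OF u]] H1_vec_L2[OF V_u_H1[OF w]] sources(3), of 1 t]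
    by (simp add: L2_inner_commute[of \<Omega> "load P"])
  show thesis
  proof (rule that)
    show "q1 / (2 * tau S) + q2 / (2 * tau S) \<ge> 0" using q1(1) q2(1) constants(5) by simp
    fix t
    have "((dual_norm \<Omega> (mob P) (V_ch S) (defect_ch v))\<^sup>2 + 2 * t * L2_inner \<Omega> z \<eta> + t\<^sup>2 * q1) / (2 * tau S)
        = (dual_norm \<Omega> (mob P) (V_ch S) (defect_ch v))\<^sup>2 / (2 * tau S) + t * (L2_inner \<Omega> z \<eta> / tau S) + t\<^sup>2 * (q1 / (2 * tau S))"
      using constants(5) by (simp add: add_divide_distrib)
    moreover have "((dual_norm \<Omega> (kap P) (V_f S) (defect_f \<theta>))\<^sup>2 + 2 * t * L2_inner \<Omega> y \<zeta> + t\<^sup>2 * q2) / (2 * tau S)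
        = (dual_norm \<Omega> (kap P) (V_f S) (defect_f \<theta>))\<^sup>2 / (2 * tau S) + t * (L2_inner \<Omega> y \<zeta> / tau S) + t\<^sup>2 * (q2 / (2 * tau S))"
      using constants(5) by (simp add: add_divide_distrib)
    ultimately show "potential P S (\<lambda>x. v x + t * \<eta> x) (\<lambda>x. u x + t *\<^sub>R w x) (\<lambda>x. \<theta> x + t * \<zeta> x)
       = potential P S v u \<theta>
         + (energy_c P S (\<lambda>x. v x + t * \<eta> x) (\<lambda>x. u x + t *\<^sub>R w x) (\<lambda>x. \<theta> x + t * \<zeta> x) - energy_c P S v u \<theta>)
         + t * (L2_inner \<Omega> z \<eta> / tau S + L2_inner \<Omega> y \<zeta> / tau S
             + L2_inner \<Omega> (energy_e P S) \<eta> - L2_inner \<Omega> (load P) w)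
         + t\<^sup>2 * (q1 / (2 * tau S) + q2 / (2 * tau S))"
      unfolding potential_def d1 d2 q1(2) q2(2) e l by (simp only: ring_distribs)
  qed
qed

text \<open>Mean-free directions preserve the constraints, so a whole line through the minimizer is
  admissible. The stationarity condition is then separated by varying one unknown at a time.\<close>

lemma min_imp_discrete:
  assumes min: "solves_min P S v u \<theta>"
  shows "\<exists>\<mu> p. solves_discrete P S v \<mu> u \<theta> p"
proof -
  have adm: "(v, u, \<theta>) \<in> admissible P S"
    and le: "\<And>v' u' \<theta>'. (v', u', \<theta>') \<in> admissible P S \<Longrightarrow> potential P S v u \<theta> \<le> potential P S v' u' \<theta>'"
    using min unfolding solves_min_def is_arg_min_def by (auto simp: not_less)
  then have v: "v \<in> V_ch S" "ch.mean (defect_ch v) = 0" and u: "u \<in> V_u S"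
    and \<theta>: "\<theta> \<in> V_f S" "fl.mean (defect_f \<theta>) = 0"
    unfolding admissible_iff by auto
  obtain z where z: "z \<in> V_ch S" "ch.mean z = 0" "\<And>l. l \<in> V_ch S \<Longrightarrow> mob P * ch.gip z l = L2_inner \<Omega> (defect_ch v) l"
    using ch.riesz_mean_zero[OF constants(3) defect_ch_L2[OF v(1)] v(2)] by blast
  obtain y where y: "y \<in> V_f S" "fl.mean y = 0" "\<And>l. l \<in> V_f S \<Longrightarrow> kap P * fl.gip y l = L2_inner \<Omega> (defect_f \<theta>) l"
    using fl.riesz_mean_zero[OF constants(4) defect_f_L2[OF \<theta>(1)] \<theta>(2)] by blast
  have stat: "L2_inner \<Omega> z \<eta> / tau S + residual_ch v u \<theta> \<eta> + residual_u v u \<theta> w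
      + (L2_inner \<Omega> y \<zeta> / tau S + residual_f v u \<theta> \<zeta>) = 0"
    if \<eta>: "\<eta> \<in> V_ch S" "ch.mean \<eta> = 0" and w: "w \<in> V_u S" and \<zeta>: "\<zeta> \<in> V_f S" "fl.mean \<zeta> = 0" for \<eta> w \<zeta>
  proof -
    let ?v = "\<lambda>t x. v x + t * \<eta> x" and ?u = "\<lambda>t x. u x + t *\<^sub>R w x" and ?\<theta> = "\<lambda>t x. \<theta> x + t * \<zeta> x"
    let ?c = "L2_inner \<Omega> z \<eta> / tau S + L2_inner \<Omega> y \<zeta> / tau S
             + L2_inner \<Omega> (energy_e P S) \<eta> - L2_inner \<Omega> (load P) w"
    obtain q where q: "\<And>t. potential P S (?v t) (?u t) (?\<theta> t) = potential P S v u \<theta>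
         + (energy_c P S (?v t) (?u t) (?\<theta> t) - energy_c P S v u \<theta>) + t * ?c + t\<^sup>2 * q"
      by (rule potential_line[OF v \<theta> u z y \<eta> \<zeta> w]) blast+
    let ?G = "residual_ch v u \<theta> \<eta> - L2_inner \<Omega> (energy_e P S) \<eta>
        + residual_u v u \<theta> w + L2_inner \<Omega> (load P) w + residual_f v u \<theta> \<zeta>"
    have "((\<lambda>t. potential P S v u \<theta> + (energy_c P S (?v t) (?u t) (?\<theta> t) - energy_c P S v u \<theta>) + t * ?c + t\<^sup>2 * q)
        has_real_derivative 0 + (?G - 0) + 1 * ?c + 0 * q) (at 0)"
      by (intro DERIV_add DERIV_diff DERIV_const DERIV_cmult_right DERIV_ident energy_c_derivative v(1) \<theta>(1) \<eta>(1) \<zeta>(1) u w)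
        (auto intro!: derivative_eq_intros)
    then have D: "((\<lambda>t. potential P S (?v t) (?u t) (?\<theta> t)) has_real_derivative ?G + ?c) (at 0)"
      unfolding q by simp
    have "potential P S (?v 0) (?u 0) (?\<theta> 0) \<le> potential P S (?v t) (?u t) (?\<theta> t)" for t
    proof -
      have "?v t \<in> V_ch S" "?u t \<in> V_u S" "?\<theta> t \<in> V_f S"
        using ch.lincomb_closed[OF v(1) \<eta>(1), of 1 t] fl.lincomb_closed[OF \<theta>(1) \<zeta>(1), of 1 t] V_u(3)[OF u w, of 1 t]
        by simp_all
      moreover have "ch.mean (defect_ch (?v t)) = 0"
      proof -
        have "ch.mean (\<lambda>x. 1 * defect_ch v x + t * \<eta> x) = 1 * ch.mean (defect_ch v) + t * ch.mean \<eta>"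
          by (intro ch.mean_lincomb defect_ch_L2 ch.V_L2 v \<eta>)
        moreover have "defect_ch (?v t) = (\<lambda>x. 1 * defect_ch v x + t * \<eta> x)" by (simp add: fun_eq_iff)
        ultimately show ?thesis using v(2) \<eta>(2) by (simp only:)
      qed
      moreover have "fl.mean (defect_f (?\<theta> t)) = 0"
      proof -
        have "fl.mean (\<lambda>x. 1 * defect_f \<theta> x + t * \<zeta> x) = 1 * fl.mean (defect_f \<theta>) + t * fl.mean \<zeta>"
          by (intro fl.mean_lincomb defect_f_L2 fl.V_L2 \<theta> \<zeta>)
        moreover have "defect_f (?\<theta> t) = (\<lambda>x. 1 * defect_f \<theta> x + t * \<zeta> x)" by (simp add: fun_eq_iff)
        ultimately show ?thesis using \<theta>(2) \<zeta>(2) by (simp only:)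
      qed
      ultimately have "(?v t, ?u t, ?\<theta> t) \<in> admissible P S" unfolding admissible_iff by blast
      from le[OF this] show ?thesis by simp
    qed
    \<comment> \<open>The minimum at 0 is two-sided; the radius 1 is arbitrary. In the sum the
      pairings with \<open>energy_e\<close> and the load cancel, leaving residuals and
      dissipation.\<close>
    then have "?G + ?c = 0"
      by (intro DERIV_local_min[OF D, of 1]) auto
    then show ?thesis by simp
  qed
  \<comment> \<open>Zero directions are obtained as zero multiples of members of the spaces; they
    switch off two of the three variations.\<close>
  obtain w0 where w0: "w0 \<in> V_u S" using V_u(2) by blast
  have zero_u: "(\<lambda>x. 0 *\<^sub>R w0 x) \<in> V_u S" "residual_u v u \<theta> (\<lambda>x. 0 *\<^sub>R w0 x) = 0"
    using V_u(3)[OF w0 w0, of 0 0] residual_u_scale[OF v(1) u \<theta>(1) w0, of 0] by simp_all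
  have zero_ch: "(\<lambda>x. 0) \<in> V_ch S" "residual_ch v u \<theta> (\<lambda>x. 0) = 0"
    using ch.lincomb_closed[OF v(1) v(1), of 0 0]
      linear_functional_onD[OF residual_ch_linear[OF v(1) u \<theta>(1)] v(1) v(1), of 0 0] by simp_all
  have zero_f: "(\<lambda>x. 0) \<in> V_f S" "residual_f v u \<theta> (\<lambda>x. 0) = 0"
    using fl.lincomb_closed[OF \<theta>(1) \<theta>(1), of 0 0]
      linear_functional_onD[OF residual_f_linear[OF v(1) u \<theta>(1)] \<theta>(1) \<theta>(1), of 0 0] by simp_all
  have ip0: "L2_inner \<Omega> g (\<lambda>x. 0) = 0" for g :: "real^'d \<Rightarrow> real" by (simp add: L2_inner_def)
  have stat_ch: "L2_inner \<Omega> z \<eta> / tau S + residual_ch v u \<theta> \<eta> = 0" if "\<eta> \<in> V_ch S" "ch.mean \<eta> = 0" for \<eta>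
    using stat[OF that zero_u(1) zero_f(1)] zero_u(2) zero_f(2) by (simp add: ip0)
  have stat_f: "L2_inner \<Omega> y \<zeta> / tau S + residual_f v u \<theta> \<zeta> = 0" if "\<zeta> \<in> V_f S" "fl.mean \<zeta> = 0" for \<zeta>
    using stat[OF zero_ch(1) _ zero_u(1) that] zero_u(2) zero_ch(2) by (simp add: ip0)
  have stat_u: "residual_u v u \<theta> w = 0" if "w \<in> V_u S" for w
    using stat[OF zero_ch(1) _ that zero_f(1)] zero_ch(2) zero_f(2) by (simp add: ip0)
  obtain \<mu> where \<mu>: "\<mu> \<in> V_ch S" "\<And>\<eta>. \<eta> \<in> V_ch S \<Longrightarrow> L2_inner \<Omega> \<mu> \<eta> = residual_ch v u \<theta> \<eta>"
    "\<And>\<eta>. \<eta> \<in> V_ch S \<Longrightarrow> tau S * ch.gip \<mu> \<eta> = - ch.gip z \<eta>"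
    by (rule ch.multiplier_ex[OF constants(5) z(1,2) residual_ch_linear[OF v(1) u \<theta>(1)] stat_ch]) blast+
  obtain p where p: "p \<in> V_f S" "\<And>\<zeta>. \<zeta> \<in> V_f S \<Longrightarrow> L2_inner \<Omega> p \<zeta> = residual_f v u \<theta> \<zeta>"
    "\<And>\<zeta>. \<zeta> \<in> V_f S \<Longrightarrow> tau S * fl.gip p \<zeta> = - fl.gip y \<zeta>"
    by (rule fl.multiplier_ex[OF constants(5) y(1,2) residual_f_linear[OF v(1) u \<theta>(1)] stat_f]) blast+
  have "L2_inner \<Omega> (defect_ch v) \<eta> + tau S * (mob P * ch.gip \<mu> \<eta>) = 0" if "\<eta> \<in> V_ch S" for \<eta>
  proof -
    have "tau S * (mob P * ch.gip \<mu> \<eta>) = mob P * (tau S * ch.gip \<mu> \<eta>)" by (simp only: mult.left_commute)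
    then show ?thesis using \<mu>(3)[OF that] z(3)[OF that] by simp
  qed
  moreover have "L2_inner \<Omega> (defect_f \<theta>) \<zeta> + tau S * (kap P * fl.gip p \<zeta>) = 0" if "\<zeta> \<in> V_f S" for \<zeta>
  proof -
    have "tau S * (kap P * fl.gip p \<zeta>) = kap P * (tau S * fl.gip p \<zeta>)" by (simp only: mult.left_commute)
    then show ?thesis using p(3)[OF that] y(3)[OF that] by simp
  qed
  ultimately have "solves_discrete P S v \<mu> u \<theta> p"
    unfolding solves_discrete_iff using v(1) \<mu>(1,2) u \<theta>(1) p(1,2) stat_u by blast
  then show ?thesis by blast
qed

text \<open>On the line to a competitor, convexity puts the change of \<open>energy_c\<close> above
  its derivative at 0, the discrete equations cancel that derivative against the linear term, and
  the dissipation adds a nonnegative square.\<close>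

lemma discrete_imp_min:
  assumes conv: "energy_c_convex P S" and sol: "solves_discrete P S v \<mu> u \<theta> p"
  shows "solves_min P S v u \<theta>"
proof -
  have v: "v \<in> V_ch S" and \<mu>: "\<mu> \<in> V_ch S" and u: "u \<in> V_u S" and \<theta>: "\<theta> \<in> V_f S" and p: "p \<in> V_f S"
    and bal_ch: "\<And>\<eta>. \<eta> \<in> V_ch S \<Longrightarrow> L2_inner \<Omega> (defect_ch v) \<eta> + tau S * (mob P * ch.gip \<mu> \<eta>) = 0"
    and \<mu>_eq: "\<And>\<eta>. \<eta> \<in> V_ch S \<Longrightarrow> L2_inner \<Omega> \<mu> \<eta> = residual_ch v u \<theta> \<eta>"
    and u_eq: "\<And>w. w \<in> V_u S \<Longrightarrow> residual_u v u \<theta> w = 0"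
    and bal_f: "\<And>\<zeta>. \<zeta> \<in> V_f S \<Longrightarrow> L2_inner \<Omega> (defect_f \<theta>) \<zeta> + tau S * (kap P * fl.gip p \<zeta>) = 0"
    and p_eq: "\<And>\<zeta>. \<zeta> \<in> V_f S \<Longrightarrow> L2_inner \<Omega> p \<zeta> = residual_f v u \<theta> \<zeta>"
    using sol unfolding solves_discrete_iff by blast+
  \<comment> \<open>Testing the balance law with 1 removes the gradient term, so a solution of (D)
    satisfies the constraint of (M).\<close>
  have mean_v: "ch.mean (defect_ch v) = 0"
  proof -
    obtain one where "one \<in> V_ch S" "\<And>x. x \<in> \<Omega> \<Longrightarrow> one x = 1" "\<And>s. L2_inner \<Omega> s one = ch.mean s"
      using ch.constant_one by metis
    then show ?thesis using bal_ch[of one] ch.gip_constant(2)[of one 1 \<mu>] \<mu> by simp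
  qed
  have mean_\<theta>: "fl.mean (defect_f \<theta>) = 0"
  proof -
    obtain one where "one \<in> V_f S" "\<And>x. x \<in> \<Omega> \<Longrightarrow> one x = 1" "\<And>s. L2_inner \<Omega> s one = fl.mean s"
      using fl.constant_one by metis
    then show ?thesis using bal_f[of one] fl.gip_constant(2)[of one 1 p] p by simp
  qed
  have adm: "(v, u, \<theta>) \<in> admissible P S"
    unfolding admissible_iff using v mean_v u \<theta> mean_\<theta> by blast
  obtain z where z: "z \<in> V_ch S" "ch.mean z = 0" "\<And>l. l \<in> V_ch S \<Longrightarrow> mob P * ch.gip z l = L2_inner \<Omega> (defect_ch v) l"
    using ch.riesz_mean_zero[OF constants(3) defect_ch_L2[OF v] mean_v] by blast
  obtain y where y: "y \<in> V_f S" "fl.mean y = 0" "\<And>l. l \<in> V_f S \<Longrightarrow> kap P * fl.gip y l = L2_inner \<Omega> (defect_f \<theta>) l"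
    using fl.riesz_mean_zero[OF constants(4) defect_f_L2[OF \<theta>] mean_\<theta>] by blast
  have "potential P S v u \<theta> \<le> potential P S v2 u2 \<theta>2" if adm2: "(v2, u2, \<theta>2) \<in> admissible P S" for v2 u2 \<theta>2
  proof -
    have 2: "v2 \<in> V_ch S" "ch.mean (defect_ch v2) = 0" "u2 \<in> V_u S" "\<theta>2 \<in> V_f S" "fl.mean (defect_f \<theta>2) = 0"
      using adm2 unfolding admissible_iff by auto
    define \<eta> where "\<eta> = (\<lambda>x. v2 x - v x)"
    define w where "w = (\<lambda>x. u2 x - u x)"
    define \<zeta> where "\<zeta> = (\<lambda>x. \<theta>2 x - \<theta> x)"
    have \<eta>: "\<eta> \<in> V_ch S" using ch.lincomb_closed[OF 2(1) v, of 1 "- 1"] by (simp add: \<eta>_def)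
    have w: "w \<in> V_u S" using V_u(3)[OF 2(3) u, of 1 "- 1"] by (simp add: w_def)
    have \<zeta>: "\<zeta> \<in> V_f S" using fl.lincomb_closed[OF 2(4) \<theta>, of 1 "- 1"] by (simp add: \<zeta>_def)
    have mean_\<eta>: "ch.mean \<eta> = 0"
    proof -
      have "ch.mean (\<lambda>x. 1 * defect_ch v2 x + (- 1) * defect_ch v x) = 1 * ch.mean (defect_ch v2) + (- 1) * ch.mean (defect_ch v)"
        by (intro ch.mean_lincomb defect_ch_L2 2 v)
      then show ?thesis using 2 mean_v by (simp add: \<eta>_def)
    qed
    have mean_\<zeta>: "fl.mean \<zeta> = 0"
    proof -
      have "fl.mean (\<lambda>x. 1 * defect_f \<theta>2 x + (- 1) * defect_f \<theta> x) = 1 * fl.mean (defect_f \<theta>2) + (- 1) * fl.mean (defect_f \<theta>)"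
        by (intro fl.mean_lincomb defect_f_L2 2 \<theta>)
      then show ?thesis using 2 mean_\<theta> by (simp add: \<zeta>_def)
    qed
    let ?v = "\<lambda>t x. v x + t * \<eta> x" and ?u = "\<lambda>t x. u x + t *\<^sub>R w x" and ?\<theta> = "\<lambda>t x. \<theta> x + t * \<zeta> x"
    let ?c = "L2_inner \<Omega> z \<eta> / tau S + L2_inner \<Omega> y \<zeta> / tau S
             + L2_inner \<Omega> (energy_e P S) \<eta> - L2_inner \<Omega> (load P) w"
    obtain q where q: "q \<ge> 0" "\<And>t. potential P S (?v t) (?u t) (?\<theta> t) = potential P S v u \<theta>
         + (energy_c P S (?v t) (?u t) (?\<theta> t) - energy_c P S v u \<theta>) + t * ?c + t\<^sup>2 * q"
      by (rule potential_line[OF v mean_v \<theta> mean_\<theta> u z y \<eta> mean_\<eta> \<zeta> mean_\<zeta> w]) blast+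
    let ?G = "residual_ch v u \<theta> \<eta> - L2_inner \<Omega> (energy_e P S) \<eta>
        + residual_u v u \<theta> w + L2_inner \<Omega> (load P) w + residual_f v u \<theta> \<zeta>"
    let ?g = "\<lambda>t. energy_c P S (?v t) (?u t) (?\<theta> t)"
    have line: "?v t = (\<lambda>x. (1 - t) * v x + t * v2 x)" "?u t = (\<lambda>x. (1 - t) *\<^sub>R u x + t *\<^sub>R u2 x)"
      "?\<theta> t = (\<lambda>x. (1 - t) * \<theta> x + t * \<theta>2 x)" for t
      by (simp_all add: \<eta>_def w_def \<zeta>_def algebra_simps)
    have end1: "?v 1 = v2" "?u 1 = u2" "?\<theta> 1 = \<theta>2" by (simp_all add: \<eta>_def w_def \<zeta>_def)
    have end0: "?v 0 = v" "?u 0 = u" "?\<theta> 0 = \<theta>" by simp_all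
    have "?G \<le> ?g 1 - ?g 0"
    proof (rule tangent_le_chord[OF energy_c_derivative[OF v \<eta> u w \<theta> \<zeta>]])
      fix t :: real assume "0 \<le> t" "t \<le> 1"
      then show "?g t \<le> (1 - t) * ?g 0 + t * ?g 1"
        using conv adm adm2 unfolding end0 end1 line energy_c_convex_def by force
    qed
    then have G: "?G \<le> energy_c P S v2 u2 \<theta>2 - energy_c P S v u \<theta>" unfolding end0 end1 .
    \<comment> \<open>The representative of the defect may be replaced by a multiple of \<mu>, since
      the difference of two admissible phase fields has mean zero.\<close>
    have "L2_inner \<Omega> z \<eta> = - tau S * L2_inner \<Omega> \<mu> \<eta>"
      by (rule ch.riesz_eq_multiplier[OF constants(3) \<mu> z(1,3) bal_ch \<eta> mean_\<eta>])
    then have 3: "L2_inner \<Omega> z \<eta> / tau S = - residual_ch v u \<theta> \<eta>"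
      using \<mu>_eq[OF \<eta>] constants(5) by simp
    have "L2_inner \<Omega> y \<zeta> = - tau S * L2_inner \<Omega> p \<zeta>"
      by (rule fl.riesz_eq_multiplier[OF constants(4) p y(1,3) bal_f \<zeta> mean_\<zeta>])
    then have 4: "L2_inner \<Omega> y \<zeta> / tau S = - residual_f v u \<theta> \<zeta>"
      using p_eq[OF \<zeta>] constants(5) by simp
    \<comment> \<open>The competitor is reached at t = 1. By 3, 4 and \<open>u_eq\<close> the linear
      term is \<open>- ?G\<close>, so G and \<open>q \<ge> 0\<close> give the inequality.\<close>
    have "potential P S v2 u2 \<theta>2 = potential P S v u \<theta>
         + (energy_c P S v2 u2 \<theta>2 - energy_c P S v u \<theta>) + ?c + q"
      using q(2)[of 1] unfolding end1 by simp
    then show ?thesis using G 3 4 u_eq[OF w] q(1) by linarith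
  qed
  then show ?thesis
    unfolding solves_min_def is_arg_min_def using adm by (auto simp: not_less)
qed

end

theorem lemma4:
  fixes P :: "('d::finite) chb_model" and S :: "'d chb_step"
    and \<Psi> :: "real \<Rightarrow> real" and \<T> :: "(real^'d) set set"
    and h cM CM c\<alpha> C\<alpha> cC CC cT CT :: real
    and \<phi> \<theta> :: "real^'d \<Rightarrow> real" and u :: "real^'d \<Rightarrow> real^'d"
  assumes dimension: "CARD('d) \<in> {2, 3}"
    and domain: "lipschitz_domain (Omega P)"
    and constants: "gam P > 0" "ell P > 0"
    and A1: "\<forall>s. \<Psi> s \<ge> 0" "\<forall>s. \<Psi> s = Psi_c P s - Psi_e P s"
      "convex_on UNIV (Psi_c P)" "convex_on UNIV (Psi_e P)"
      "\<forall>s. Psi_c P differentiable (at s)" "\<forall>s. Psi_e P differentiable (at s)"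
      "\<exists>L. L-lipschitz_on UNIV (deriv (Psi_c P))"
    and A2: "mob P > 0" "kap P > 0"
      "\<exists>L. L-lipschitz_on UNIV (Biot_M P)" "\<forall>s. Biot_M P differentiable (at s)"
      "\<exists>L. L-lipschitz_on UNIV (Biot_alpha P)" "\<forall>s. Biot_alpha P differentiable (at s)"
      "0 < cM" "\<forall>s. cM \<le> Biot_M P s \<and> Biot_M P s \<le> CM"
      "0 < c\<alpha>" "\<forall>s. c\<alpha> \<le> Biot_alpha P s \<and> Biot_alpha P s \<le> C\<alpha>" "C\<alpha> \<le> 1"
    and A3: "\<forall>s. elastic_symmetries (stiff P s)"
      "\<exists>L. L-lipschitz_on UNIV (stiff P)" "\<forall>s. stiff P differentiable (at s)"
      "0 < cC" "0 < CC"
      "\<forall>s e. transpose e = e \<longrightarrow>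
         cC * (norm e)\<^sup>2 \<le> e \<bullet> contract (stiff P s) e \<and>
         e \<bullet> contract (stiff P s) e \<le> CC * (norm e)\<^sup>2"
    and A4: "\<forall>s. transpose (eigen P s) = eigen P s"
      "\<exists>L. L-lipschitz_on UNIV (eigen P)" "\<forall>s. eigen P differentiable (at s)"
      "0 < cT" "0 < CT"
      "\<forall>v \<in> L2 (Omega P).
         cT * L2_norm (Omega P) v \<le> L2_norm (Omega P) (\<lambda>x. eigen P (v x)) \<and>
         L2_norm (Omega P) (\<lambda>x. eigen P (v x)) \<le> CT * L2_norm (Omega P) v"
    and A5: "src_R P \<in> L2 (Omega P)" "src_S P \<in> L2 (Omega P)" "load P \<in> L2 (Omega P)"
    and spaces: "is_mesh (Omega P) h \<T>" "fe_space_H1 (Omega P) \<T> (V_ch S)"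
      "fe_space_H10_vec (Omega P) \<T> (V_u S)" "fe_space_H1 (Omega P) \<T> (V_f S)"
    and time_step: "tau S > 0"
    and previous: "phi0 S \<in> V_ch S" "u0 S \<in> V_u S" "theta0 S \<in> V_f S"
  shows "(energy_c_convex P S \<longrightarrow>
            (solves_min P S \<phi> u \<theta> \<longleftrightarrow> (\<exists>\<mu> p. solves_discrete P S \<phi> \<mu> u \<theta> p)))
         \<and> (solves_min P S \<phi> u \<theta> \<longrightarrow> (\<exists>\<mu> p. solves_discrete P S \<phi> \<mu> u \<theta> p))"
proof -
  obtain LM where LM: "LM-lipschitz_on UNIV (Biot_M P)" using A2(3) by blast
  obtain L\<alpha> where L\<alpha>: "L\<alpha>-lipschitz_on UNIV (Biot_alpha P)" using A2(5) by blast
  obtain LC where LC: "LC-lipschitz_on UNIV (stiff P)" using A3(2) by blast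
  obtain LT where LT: "LT-lipschitz_on UNIV (eigen P)" using A4(2) by blast
  have dom: "open (Omega P)" "connected (Omega P)" "bounded (Omega P)" "Omega P \<noteq> {}"
    using domain unfolding lipschitz_domain_def by auto
  have lm: "Omega P \<in> lmeasurable"
    using dom by (intro bounded_set_imp_lmeasurable) (auto simp: borel_open)
  have space: "scalar_space (Omega P) V" if "fe_space_H1 (Omega P) \<T> V" for V
    using that dom lm unfolding fe_space_H1_def by (intro scalar_space.intro) auto
  interpret chb P S LM L\<alpha> LC LT CM
  proof (rule chb.intro)
    \<comment> \<open>The positive lower bound turns the upper bound into a bound on the absolute
      value.\<close>
    show "\<bar>Biot_M P s\<bar> \<le> CM" for s using A2(7,8) by (smt (verit))
    show "\<bar>Biot_alpha P s\<bar> \<le> 1" for s using A2(9,10,11) by (smt (verit))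
    \<comment> \<open>The mesh enters here: boundedness of finite element functions comes from their
      being C1 on each of finitely many compact elements.\<close>
    show "\<exists>B. AE x in lebesgue_on (Omega P). \<bar>v x\<bar> \<le> B" if "v \<in> V_ch S" for v
    proof -
      have "piecewise_C1 \<T> v" using spaces(2) that unfolding fe_space_H1_def by blast
      then obtain B where "AE x in lebesgue_on (Omega P). \<bar>v x\<bar> \<le> B"
        using piecewise_C1_bounded[OF spaces(1)] lm by blast
      then show ?thesis by blast
    qed
    show "V_u S \<subseteq> H1_vec (Omega P)"
      using spaces(3) unfolding fe_space_H10_vec_def H1_vec_def H10_def by blast
    show "V_u S \<noteq> {}" using spaces(3) unfolding fe_space_H10_vec_def fin_dim_space_def by blast
    show "(\<lambda>x. a *\<^sub>R u x + b *\<^sub>R v x) \<in> V_u S" if "u \<in> V_u S" "v \<in> V_u S" for u v a b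
      using spaces(3) that unfolding fe_space_H10_vec_def fin_dim_space_def by blast
  qed (simp_all add: constants A1 A2 A3 A4 A5 time_step previous LM L\<alpha> LC LT space spaces)
  show ?thesis using min_imp_discrete discrete_imp_min by blast
qed

end
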